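(* Let $p$ be an odd prime, $\Lambda=\mathbb{Z}[G(p,p-1)]$ and $1\le n\le p-1$. For every extension of $\Lambda$-modules \[ 0\to R(\hat n)\to K\to\mathbb{Z}[C_{p-1}]\to 0 \] all of whose $k$-invariants are non-zero, there exists an imbedding (injective $\Lambda$-homomorphism) $i:R(n)\to\Lambda$ such that $K\cong\Lambda/i(R(n))$.
   Context: Modules are right modules. For an odd prime $p$, $G(p,p-1)=\langle x,y\mid x^p=1,\ y^{p-1}=1,\ yx=x^my\rangle$, where $m$ is an integer of multiplicative order $p-1$ modulo $p$, and $\Lambda=\mathbb{Z}[G(p,p-1)]$. The ring $\mathbb{Z}[C_{p-1}]$, with $C_{p-1}=\langle y\rangle$, is a $\Lambda$-module via the ring homomorphism $\Lambda\to\mathbb{Z}[C_{p-1}]$, $x\mapsto1$, $y\mapsto y$. Let $\mathcal{T}_{p-1}=\{(a_{i,j})\in M_{p-1}(\mathbb{Z})\mid a_{i,j}\in p\mathbb{Z}\text{ if }i>j\}$. There is a surjective ring homomorphism $\tilde\lambda:\Lambda\to\mathcal{T}_{p-1}$, realized as follows. Let $\zeta=e^{2\pi i/p}$ and let $\sigma$ be the automorphism of $\mathbb{Z}[\zeta]$ with $\sigma(\zeta)=\zeta^m$. Let $\Lambda$ act on the right on the ideal $(\zeta-1)\mathbb{Z}[\zeta]$ by $v\cdot x=v\zeta$, $v\cdot y=\sigma^{-1}(v)$; $\tilde\lambda(a)$ is the matrix of $v\mapsto v\cdot a$ acting on row vectors with respect to the $\mathbb{Z}$-basis $(\zeta-1)^j$,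 $1\le j\le p-1$. Then $\mathcal{T}_{p-1}$ is a right $\Lambda$-module via $t\cdot a=t\,\tilde\lambda(a)$, and $R(i)$ denotes its $i$-th row, i.e. $R(i)=\{(r_1,\dots,r_{p-1})\in\mathbb{Z}^{p-1}\mid r_j\in p\mathbb{Z}\text{ for }j<i\}$. Thus $\mathcal{T}_{p-1}\cong\bigoplus_{i=1}^{p-1}R(i)$. Write $R(\hat n)=\bigoplus_{i\ne n}R(i)$. Derived module category: $\mathrm{Hom}_{\mathcal{D}er}(M,N)$ is the quotient of $\mathrm{Hom}_\Lambda(M,N)$ by the homomorphisms factoring through a projective module. $k$-invariants: the kernel of $\Lambda\to\mathbb{Z}[C_{p-1}]$ is $(x-1)\Lambda\cong\bigoplus_{i=1}^{p-1}R(i)$; fix the resulting exact sequence $\Psi=(0\to\bigoplus_{i=1}^{p-1}R(i)\to\Lambda\to\mathbb{Z}[C_{p-1}]\to0)$. Pushout $\overline f\mapsto f_*(\Psi)$ is an isomorphism $\mathrm{Hom}_{\mathcal{D}er}(\bigoplus_{i=1}^{p-1}R(i),R(\hat n))\cong\mathrm{Ext}^1_\Lambda(\mathbb{Z}[C_{p-1}],R(\hat n))$. Every $\Lambda$-homomorphism $R(j)\to R(i)$ is multiplication by an integer; $\mathrm{Hom}_{\mathcal{D}er}(R(j),R(i))=0$ for $i\ne j$, and $\mathrm{End}_{\mathcal{D}er}(R(i))=\mathbb{Z}/p\mathbb{Z}$, multiplication by $d$ corresponding to $d+p\mathbb{Z}$. If an extension is congruent to $f_*(\Psi)$ and the component $R(i)\to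 R(i)$ of $f$ ($i\neq n$) is multiplication by $d_i\in\mathbb{Z}$, the $k$-invariants of the extension are the $p-2$ classes $d_i+p\mathbb{Z}\in\mathbb{Z}/p\mathbb{Z}$, $i\ne n$; they are well defined and determine the extension class. *)

theory Defs
  imports
    Complex_Main
    "HOL-Algebra.Elementary_Groups"
    "HOL-Algebra.AbelCoset"
    "HOL-Computational_Algebra.Polynomial"
    "HOL-Number_Theory.Number_Theory"
begin

text \<open>A letter \<open>(s, True)\<close> stands for the generator \<open>s\<close>, and \<open>(s, False)\<close> for its inverse.\<close>

type_synonym 's word = "('s \<times> bool) list"

inductive word_eq :: "('s word \<times> 's word) set \<Rightarrow> 's word \<Rightarrow> 's word \<Rightarrow> bool"
  for rels :: "('s word \<times> 's word) set"
where
  word_eq_refl: "word_eq rels u u"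
| word_eq_sym: "word_eq rels u v \<Longrightarrow> word_eq rels v u"
| word_eq_trans: "word_eq rels u v \<Longrightarrow> word_eq rels v w \<Longrightarrow> word_eq rels u w"
| word_eq_append: "word_eq rels u u' \<Longrightarrow> word_eq rels v v' \<Longrightarrow> word_eq rels (u @ v) (u' @ v')"
| word_eq_cancel: "word_eq rels [(s, b), (s, \<not> b)] []"
| word_eq_rel: "(u, v) \<in> rels \<Longrightarrow> word_eq rels u v"

text \<open>All elements of the type \<open>'s\<close> are generators.\<close>

definition presented_group :: "('s word \<times> 's word) set \<Rightarrow> 's word set monoid" where
  "presented_group rels =
    \<lparr>carrier = UNIV // {(u, v). word_eq rels u v},
     monoid.mult = (\<lambda>A B. {w. \<exists>u\<in>A. \<exists>v\<in>B. word_eq rels (u @ v) w}),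
     one = {w. word_eq rels [] w}\<rparr>"

fun eval_word :: "('h, 'z) monoid_scheme \<Rightarrow> ('s \<Rightarrow> 'h) \<Rightarrow> 's word \<Rightarrow> 'h" where
  "eval_word H h [] = \<one>\<^bsub>H\<^esub>"
| "eval_word H h ((s, b) # w) = (if b then h s else inv\<^bsub>H\<^esub> (h s)) \<otimes>\<^bsub>H\<^esub> eval_word H h w"

text \<open>The homomorphism from a presented group to \<open>H\<close> sending each generator \<open>s\<close> to \<open>h s\<close>
  (meaningful when the \<open>h s\<close> satisfy the relations, so that all words of a class have the same value).\<close>

definition presented_hom :: "('h, 'z) monoid_scheme \<Rightarrow> ('s \<Rightarrow> 'h) \<Rightarrow> 's word set \<Rightarrow> 'h" where
  "presented_hom H h A = the_elem (eval_word H h ` A)"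

definition power_word :: "'s \<Rightarrow> int \<Rightarrow> 's word" where
  "power_word s k = replicate (nat \<bar>k\<bar>) (s, k \<ge> 0)"

datatype gen = Gen_x | Gen_y

definition G_rels :: "nat \<Rightarrow> int \<Rightarrow> (gen word \<times> gen word) set" where
  "G_rels p m =
    {(power_word Gen_x (int p), []),
     (power_word Gen_y (int (p - 1)), []),
     (power_word Gen_y 1 @ power_word Gen_x 1, power_word Gen_x m @ power_word Gen_y 1)}"

definition G_grp :: "nat \<Rightarrow> int \<Rightarrow> gen word set monoid" where
  "G_grp p m = presented_group (G_rels p m)"

definition int_group_ring :: "('g, 'z) monoid_scheme \<Rightarrow> ('g \<Rightarrow> int) ring" where
  "int_group_ring G =
    \<lparr>carrier = {a. finite {g. a g \<noteq> 0} \<and> {g. a g \<noteq> 0} \<subseteq> carrier G},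
     monoid.mult = (\<lambda>a b k. \<Sum>(g, h) \<in> {(g, h). a g \<noteq> 0 \<and> b h \<noteq> 0 \<and> g \<otimes>\<^bsub>G\<^esub> h = k}. a g * b h),
     one = (\<lambda>k. if k = \<one>\<^bsub>G\<^esub> then 1 else 0),
     zero = (\<lambda>k. 0),
     add = (\<lambda>a b k. a k + b k)\<rparr>"

definition group_ring_map :: "('g \<Rightarrow> 'h) \<Rightarrow> ('g \<Rightarrow> int) \<Rightarrow> ('h \<Rightarrow> int)" where
  "group_ring_map \<phi> a = (\<lambda>k. \<Sum>g | a g \<noteq> 0 \<and> \<phi> g = k. a g)"

definition Lam :: "nat \<Rightarrow> int \<Rightarrow> (gen word set \<Rightarrow> int) ring" where
  "Lam p m = int_group_ring (G_grp p m)"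

text \<open>\<^term>\<open>integer_mod_group (p - 1)\<close> is the cyclic group of order \<open>p - 1\<close>, written additively,
  with generator \<open>1\<close>.\<close>

definition ZC :: "nat \<Rightarrow> (int \<Rightarrow> int) ring" where
  "ZC p = int_group_ring (integer_mod_group (p - 1))"

text \<open>The ring homomorphism \<open>\<Lambda> \<rightarrow> \<int>[C\<^bsub>p-1\<^esub>]\<close> with \<open>x \<mapsto> 1\<close> and \<open>y \<mapsto> y\<close>.\<close>

definition eps :: "nat \<Rightarrow> (gen word set \<Rightarrow> int) \<Rightarrow> (int \<Rightarrow> int)" where
  "eps p = group_ring_map
    (presented_hom (integer_mod_group (p - 1)) (\<lambda>s. case s of Gen_x \<Rightarrow> 0 | Gen_y \<Rightarrow> 1))"

text \<open>As in the library's record for modules over commutative rings, the multiplicative fields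
  inherited from rings carry no meaning.\<close>

record ('a, 'b) rmodule = "'b ring" +
  ract :: "'b \<Rightarrow> 'a \<Rightarrow> 'b" (infixl \<open>\<cdot>\<index>\<close> 70)

locale right_module = R?: ring R + M?: abelian_group M
  for R :: "('a, 'r) ring_scheme" (structure) and M :: "('a, 'b, 'z) rmodule_scheme" (structure) +
  assumes ract_closed:
      "\<lbrakk>v \<in> carrier M; a \<in> carrier R\<rbrakk> \<Longrightarrow> v \<cdot>\<^bsub>M\<^esub> a \<in> carrier M"
    and ract_add_left:
      "\<lbrakk>v \<in> carrier M; w \<in> carrier M; a \<in> carrier R\<rbrakk>
        \<Longrightarrow> (v \<oplus>\<^bsub>M\<^esub> w) \<cdot>\<^bsub>M\<^esub> a = v \<cdot>\<^bsub>M\<^esub> a \<oplus>\<^bsub>M\<^esub> w \<cdot>\<^bsub>M\<^esub> a"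
    and ract_add_right:
      "\<lbrakk>v \<in> carrier M; a \<in> carrier R; b \<in> carrier R\<rbrakk>
        \<Longrightarrow> v \<cdot>\<^bsub>M\<^esub> (a \<oplus> b) = v \<cdot>\<^bsub>M\<^esub> a \<oplus>\<^bsub>M\<^esub> v \<cdot>\<^bsub>M\<^esub> b"
    and ract_mult:
      "\<lbrakk>v \<in> carrier M; a \<in> carrier R; b \<in> carrier R\<rbrakk>
        \<Longrightarrow> v \<cdot>\<^bsub>M\<^esub> (a \<otimes> b) = (v \<cdot>\<^bsub>M\<^esub> a) \<cdot>\<^bsub>M\<^esub> b"
    and ract_one:
      "v \<in> carrier M \<Longrightarrow> v \<cdot>\<^bsub>M\<^esub> \<one> = v"

definition rmod_hom ::
  "('a, 'r) ring_scheme \<Rightarrow> ('a, 'b, 'y) rmodule_scheme \<Rightarrow> ('a, 'c, 'z) rmodule_scheme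
    \<Rightarrow> ('b \<Rightarrow> 'c) set" where
  "rmod_hom R M N = {f \<in> carrier M \<rightarrow> carrier N.
     (\<forall>v\<in>carrier M. \<forall>w\<in>carrier M. f (v \<oplus>\<^bsub>M\<^esub> w) = f v \<oplus>\<^bsub>N\<^esub> f w) \<and>
     (\<forall>v\<in>carrier M. \<forall>a\<in>carrier R. f (v \<cdot>\<^bsub>M\<^esub> a) = f v \<cdot>\<^bsub>N\<^esub> a)}"

definition rmod_isomorphic ::
  "('a, 'r) ring_scheme \<Rightarrow> ('a, 'b, 'y) rmodule_scheme \<Rightarrow> ('a, 'c, 'z) rmodule_scheme \<Rightarrow> bool" where
  "rmod_isomorphic R M N \<longleftrightarrow> (\<exists>f \<in> rmod_hom R M N. bij_betw f (carrier M) (carrier N))"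

text \<open>The right module over the domain of the ring homomorphism \<open>\<phi>\<close> obtained from \<open>S\<close> by restriction.\<close>

definition restrict_rmod :: "('s, 'z) ring_scheme \<Rightarrow> ('a \<Rightarrow> 's) \<Rightarrow> ('a, 's) rmodule" where
  "restrict_rmod S \<phi> =
    \<lparr>carrier = carrier S, monoid.mult = monoid.mult S, one = \<one>\<^bsub>S\<^esub>, zero = \<zero>\<^bsub>S\<^esub>, add = add S,
     ract = (\<lambda>v a. v \<otimes>\<^bsub>S\<^esub> \<phi> a)\<rparr>"

definition regular_rmod :: "('a, 'z) ring_scheme \<Rightarrow> ('a, 'a) rmodule" where
  "regular_rmod R = restrict_rmod R (\<lambda>a. a)"

text \<open>The direct sum over a \<^emph>\<open>finite\<close> index set (so there is no support condition).\<close>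

definition dsum_rmod :: "'i set \<Rightarrow> ('i \<Rightarrow> ('a, 'b, 'z) rmodule_scheme) \<Rightarrow> ('a, 'i \<Rightarrow> 'b) rmodule" where
  "dsum_rmod I M =
    \<lparr>carrier = (\<Pi>\<^sub>E i\<in>I. carrier (M i)),
     monoid.mult = (\<lambda>s t. undefined), one = undefined,
     zero = (\<lambda>i\<in>I. \<zero>\<^bsub>M i\<^esub>),
     add = (\<lambda>s t. \<lambda>i\<in>I. s i \<oplus>\<^bsub>M i\<^esub> t i),
     ract = (\<lambda>s a. \<lambda>i\<in>I. s i \<cdot>\<^bsub>M i\<^esub> a)\<rparr>"

definition dsum_inj :: "'i set \<Rightarrow> ('i \<Rightarrow> ('a, 'b, 'z) rmodule_scheme) \<Rightarrow> 'i \<Rightarrow> 'b \<Rightarrow> 'i \<Rightarrow> 'b" where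
  "dsum_inj I M i v = (\<lambda>j\<in>I. if j = i then v else \<zero>\<^bsub>M j\<^esub>)"

definition prod_rmod ::
  "('a, 'b, 'y) rmodule_scheme \<Rightarrow> ('a, 'c, 'z) rmodule_scheme \<Rightarrow> ('a, 'b \<times> 'c) rmodule" where
  "prod_rmod M N =
    \<lparr>carrier = carrier M \<times> carrier N,
     monoid.mult = (\<lambda>s t. undefined), one = undefined,
     zero = (\<zero>\<^bsub>M\<^esub>, \<zero>\<^bsub>N\<^esub>),
     add = (\<lambda>(v, w) (v', w'). (v \<oplus>\<^bsub>M\<^esub> v', w \<oplus>\<^bsub>N\<^esub> w')),
     ract = (\<lambda>(v, w) a. (v \<cdot>\<^bsub>M\<^esub> a, w \<cdot>\<^bsub>N\<^esub> a))\<rparr>"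

text \<open>For a submodule \<open>N\<close> all the cosets in the union defining the action coincide.\<close>

definition quot_rmod :: "('a, 'b, 'z) rmodule_scheme \<Rightarrow> 'b set \<Rightarrow> ('a, 'b set) rmodule" where
  "quot_rmod M N =
    \<lparr>carrier = a_rcosets\<^bsub>M\<^esub> N,
     monoid.mult = (\<lambda>A B. undefined), one = undefined,
     zero = N,
     add = set_add M,
     ract = (\<lambda>A a. \<Union>v\<in>A. N +>\<^bsub>M\<^esub> (v \<cdot>\<^bsub>M\<^esub> a))\<rparr>"

definition short_exact ::
  "('a, 'r) ring_scheme \<Rightarrow> ('a, 'b, 'x) rmodule_scheme \<Rightarrow> ('b \<Rightarrow> 'k) \<Rightarrow> ('a, 'k, 'y) rmodule_scheme
    \<Rightarrow> ('k \<Rightarrow> 'c) \<Rightarrow> ('a, 'c, 'z) rmodule_scheme \<Rightarrow> bool" where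
  "short_exact R B \<alpha> K \<beta> C \<longleftrightarrow>
     \<alpha> \<in> rmod_hom R B K \<and> \<beta> \<in> rmod_hom R K C \<and>
     inj_on \<alpha> (carrier B) \<and>
     \<alpha> ` carrier B = {k \<in> carrier K. \<beta> k = \<zero>\<^bsub>C\<^esub>} \<and>
     \<beta> ` carrier K = carrier C"

text \<open>For extensions of \<open>C\<close> by \<open>B\<close> the map \<open>\<phi>\<close> is bijective by the five lemma, so this relation
  is symmetric.\<close>

definition congruent_ext ::
  "('a, 'r) ring_scheme \<Rightarrow> ('a, 'b, 'x) rmodule_scheme
    \<Rightarrow> ('b \<Rightarrow> 'k) \<Rightarrow> ('a, 'k, 'y) rmodule_scheme \<Rightarrow> ('k \<Rightarrow> 'c)
    \<Rightarrow> ('b \<Rightarrow> 'l) \<Rightarrow> ('a, 'l, 'z) rmodule_scheme \<Rightarrow> ('l \<Rightarrow> 'c) \<Rightarrow> bool" where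
  "congruent_ext R B \<alpha> K \<beta> \<alpha>' K' \<beta>' \<longleftrightarrow>
     (\<exists>\<phi> \<in> rmod_hom R K K'.
        (\<forall>b\<in>carrier B. \<phi> (\<alpha> b) = \<alpha>' b) \<and> (\<forall>k\<in>carrier K. \<beta>' (\<phi> k) = \<beta> k))"

text \<open>The pushout of \<open>0 \<rightarrow> A \<rightarrow> L \<rightarrow> C \<rightarrow> 0\<close> (with maps \<open>\<iota>\<close>, \<open>\<epsilon>\<close>) along \<open>f : A \<rightarrow> B\<close>
  is \<open>(B \<oplus> L) / {(f a, - \<iota> a)}\<close>, with the maps \<open>b \<mapsto> [(b, 0)]\<close> and \<open>[(b, l)] \<mapsto> \<epsilon> l\<close>.\<close>

definition pushout_rel ::
  "('a, 'b, 'x) rmodule_scheme \<Rightarrow> ('b \<Rightarrow> 'l) \<Rightarrow> ('a, 'l, 'y) rmodule_scheme \<Rightarrow> ('b \<Rightarrow> 'c)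
    \<Rightarrow> ('c \<times> 'l) set" where
  "pushout_rel A \<iota> L f = (\<lambda>a. (f a, \<ominus>\<^bsub>L\<^esub> \<iota> a)) ` carrier A"

definition pushout_rmod ::
  "('a, 'b, 'x) rmodule_scheme \<Rightarrow> ('b \<Rightarrow> 'l) \<Rightarrow> ('a, 'l, 'y) rmodule_scheme \<Rightarrow> ('b \<Rightarrow> 'c)
    \<Rightarrow> ('a, 'c, 'z) rmodule_scheme \<Rightarrow> ('a, ('c \<times> 'l) set) rmodule" where
  "pushout_rmod A \<iota> L f B = quot_rmod (prod_rmod B L) (pushout_rel A \<iota> L f)"

definition pushout_in ::
  "('a, 'b, 'x) rmodule_scheme \<Rightarrow> ('b \<Rightarrow> 'l) \<Rightarrow> ('a, 'l, 'y) rmodule_scheme \<Rightarrow> ('b \<Rightarrow> 'c)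
    \<Rightarrow> ('a, 'c, 'z) rmodule_scheme \<Rightarrow> 'c \<Rightarrow> ('c \<times> 'l) set" where
  "pushout_in A \<iota> L f B b = pushout_rel A \<iota> L f +>\<^bsub>prod_rmod B L\<^esub> (b, \<zero>\<^bsub>L\<^esub>)"

definition pushout_out :: "('l \<Rightarrow> 'd) \<Rightarrow> ('c \<times> 'l) set \<Rightarrow> 'd" where
  "pushout_out \<epsilon> A = the_elem ((\<lambda>(b, l). \<epsilon> l) ` A)"

definition zeta :: "nat \<Rightarrow> complex" where
  "zeta p = exp (2 * of_real pi * \<i> / of_nat p)"

definition Z_zeta :: "nat \<Rightarrow> complex set" where
  "Z_zeta p = range (\<lambda>f :: int poly. poly (map_poly of_int f) (zeta p))"

text \<open>The ring automorphism of \<open>\<int>[\<zeta>]\<close> with \<open>\<zeta> \<mapsto> \<zeta>\<^sup>m\<close>; being extensional makes it unique as a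
  total function.\<close>

definition sigma :: "nat \<Rightarrow> int \<Rightarrow> complex \<Rightarrow> complex" where
  "sigma p m = (THE s. s \<in> extensional (Z_zeta p) \<and> bij_betw s (Z_zeta p) (Z_zeta p) \<and>
     (\<forall>u\<in>Z_zeta p. \<forall>v\<in>Z_zeta p. s (u + v) = s u + s v \<and> s (u * v) = s u * s v) \<and>
     s (zeta p) = zeta p powi m)"

fun letter_act :: "nat \<Rightarrow> int \<Rightarrow> gen \<times> bool \<Rightarrow> complex \<Rightarrow> complex" where
  "letter_act p m (Gen_x, True) v = v * zeta p"
| "letter_act p m (Gen_x, False) v = v / zeta p"
| "letter_act p m (Gen_y, True) v = inv_into (Z_zeta p) (sigma p m) v"
| "letter_act p m (Gen_y, False) v = sigma p m v"

text \<open>As the action on \<open>(\<zeta> - 1)\<int>[\<zeta>]\<close> is on the right, the leftmost letter of a word acts first.\<close>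

definition word_act :: "nat \<Rightarrow> int \<Rightarrow> complex \<Rightarrow> gen word \<Rightarrow> complex" where
  "word_act p m v w = fold (letter_act p m) w v"

definition group_act :: "nat \<Rightarrow> int \<Rightarrow> complex \<Rightarrow> gen word set \<Rightarrow> complex" where
  "group_act p m v A = the_elem (word_act p m v ` A)"

definition Lam_act :: "nat \<Rightarrow> int \<Rightarrow> complex \<Rightarrow> (gen word set \<Rightarrow> int) \<Rightarrow> complex" where
  "Lam_act p m v a = (\<Sum>g | a g \<noteq> 0. of_int (a g) * group_act p m v g)"

text \<open>Coordinates with respect to the \<open>\<int>\<close>-basis \<open>(\<zeta> - 1)\<^sup>j\<close>, \<open>1 \<le> j \<le> p - 1\<close>, of \<open>(\<zeta> - 1)\<int>[\<zeta>]\<close>.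
  Vectors and matrices are indexed from \<open>1\<close> and vanish outside \<open>{1..p - 1}\<close>.\<close>

definition zeta_coords :: "nat \<Rightarrow> complex \<Rightarrow> nat \<Rightarrow> int" where
  "zeta_coords p v = (THE c. (\<forall>j. j \<notin> {1..p - 1} \<longrightarrow> c j = 0) \<and>
     v = (\<Sum>j\<in>{1..p - 1}. of_int (c j) * (zeta p - 1) ^ j))"

definition lambda_tilde :: "nat \<Rightarrow> int \<Rightarrow> (gen word set \<Rightarrow> int) \<Rightarrow> nat \<Rightarrow> nat \<Rightarrow> int" where
  "lambda_tilde p m a i j =
    (if i \<in> {1..p - 1} then zeta_coords p (Lam_act p m ((zeta p - 1) ^ i) a) j else 0)"

text \<open>\<open>R(i)\<close> is the \<open>i\<close>-th row of the ring of integer matrices with entries below the diagonal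
  divisible by \<open>p\<close>; \<open>a\<close> acts on the row vector \<open>r\<close> by multiplication with the matrix of \<open>a\<close>.\<close>

definition Rmod :: "nat \<Rightarrow> int \<Rightarrow> nat \<Rightarrow> (gen word set \<Rightarrow> int, nat \<Rightarrow> int) rmodule" where
  "Rmod p m i =
    \<lparr>carrier = {r. (\<forall>j. j \<notin> {1..p - 1} \<longrightarrow> r j = 0) \<and> (\<forall>j<i. int p dvd r j)},
     monoid.mult = (\<lambda>r s. undefined), one = undefined,
     zero = (\<lambda>j. 0),
     add = (\<lambda>r s j. r j + s j),
     ract = (\<lambda>r a j. \<Sum>k\<in>{1..p - 1}. r k * lambda_tilde p m a k j)\<rparr>"

definition Rsum :: "nat \<Rightarrow> int \<Rightarrow> nat set \<Rightarrow> (gen word set \<Rightarrow> int, nat \<Rightarrow> nat \<Rightarrow> int) rmodule" where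
  "Rsum p m I = dsum_rmod I (Rmod p m)"

definition ZC_rmod :: "nat \<Rightarrow> (gen word set \<Rightarrow> int, int \<Rightarrow> int) rmodule" where
  "ZC_rmod p = restrict_rmod (ZC p) (eps p)"

text \<open>\<open>\<iota>\<close> is an injection of \<open>\<Oplus>\<^sub>i R(i)\<close> onto the kernel of \<open>\<Lambda> \<rightarrow> \<int>[C\<^bsub>p-1\<^esub>]\<close>, i.e. a choice of \<open>\<Psi>\<close>.\<close>

definition is_Psi :: "nat \<Rightarrow> int \<Rightarrow> ((nat \<Rightarrow> nat \<Rightarrow> int) \<Rightarrow> (gen word set \<Rightarrow> int)) \<Rightarrow> bool" where
  "is_Psi p m \<iota> \<longleftrightarrow>
    short_exact (Lam p m) (Rsum p m {1..p - 1}) \<iota> (regular_rmod (Lam p m)) (eps p) (ZC_rmod p)"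

text \<open>\<open>\<kappa>\<close> is the family of \<open>k\<close>-invariants of the extension \<open>0 \<rightarrow> \<Oplus>\<^bsub>i\<noteq>n\<^esub> R(i) \<rightarrow> K \<rightarrow> \<int>[C\<^bsub>p-1\<^esub>] \<rightarrow> 0\<close>
  with maps \<open>\<alpha>\<close>, \<open>\<beta>\<close>: the extension is congruent to the pushout of \<open>\<Psi>\<close> along some \<open>f\<close> whose component
  \<open>R(i) \<rightarrow> R(i)\<close> is multiplication by a representative of \<open>\<kappa> i\<close>. An element \<open>d + p\<int>\<close> of \<open>\<int>/p\<int>\<close> is represented by \<open>d mod p\<close>.\<close>

definition is_k_invariants ::
  "nat \<Rightarrow> int \<Rightarrow> nat \<Rightarrow> ((nat \<Rightarrow> nat \<Rightarrow> int) \<Rightarrow> (gen word set \<Rightarrow> int))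
    \<Rightarrow> ((nat \<Rightarrow> nat \<Rightarrow> int) \<Rightarrow> 'k) \<Rightarrow> (gen word set \<Rightarrow> int, 'k, 'z) rmodule_scheme \<Rightarrow> ('k \<Rightarrow> int \<Rightarrow> int)
    \<Rightarrow> (nat \<Rightarrow> int) \<Rightarrow> bool" where
  "is_k_invariants p m n \<iota> \<alpha> K \<beta> \<kappa> \<longleftrightarrow>
    (let A = Rsum p m {1..p - 1}; B = Rsum p m ({1..p - 1} - {n}); L = regular_rmod (Lam p m)
     in \<exists>f \<in> rmod_hom (Lam p m) A B.
          congruent_ext (Lam p m) B \<alpha> K \<beta>
            (pushout_in A \<iota> L f B) (pushout_rmod A \<iota> L f B) (pushout_out (eps p)) \<and>
          (\<forall>i \<in> {1..p - 1} - {n}. \<exists>d :: int.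
             (\<forall>r \<in> carrier (Rmod p m i).
                f (dsum_inj {1..p - 1} (Rmod p m) i r) i = (\<lambda>j. d * r j)) \<and>
             \<kappa> i = d mod int p))"

end

theory Submission
  imports Defs "Jordan_Normal_Form.Char_Poly"
begin

text \<open>The map \<open>r \<mapsto> \<Sum>k. r k * (\<zeta> - 1) ^ k\<close> identifies \<open>R(i)\<close> with the ideal \<open>(\<zeta> - 1) ^ i \<int>[\<zeta>]\<close>, so a
  homomorphism \<open>f\<close> between sums of modules \<open>R(i)\<close> is a matrix of integers \<open>M i j\<close>, divisible by \<open>p\<close> for
  \<open>j < i\<close>. Non-zero \<open>k\<close>-invariants mean that the diagonal entries of \<open>M\<close> (which has no row \<open>n\<close>) are
  prime to \<open>p\<close>. Elementary blocks yield an integer matrix \<open>F\<close>, diagonal modulo \<open>p\<close> and with an inverse of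
  the same kind, such that \<open>F i i = M i i\<close> modulo \<open>p\<close> for \<open>i \<noteq> n\<close>. Then each row of the difference
  \<open>M - F\<close> lies in the radical, so this difference factors through \<open>\<Lambda>\<close>, and the pushout along \<open>f\<close> is also
  the pushout along the split epimorphism given by the rows \<open>i \<noteq> n\<close> of \<open>F\<close>. The latter is the quotient of
  \<open>\<Lambda>\<close> by the image of the kernel of this epimorphism, which \<open>F\<close> identifies with \<open>R(n)\<close>.\<close>

subsection \<open>The ideals generated by the powers of \<open>\<zeta> - 1\<close>\<close>

text \<open>An integer matrix that is invertible over the integers and diagonal modulo
  \<open>p\<close> has diagonal entries whose product is 1 or -1 modulo \<open>p\<close>, so
  arbitrary non-zero classes cannot be prescribed on a full diagonal. The missing index
  \<open>n\<close> removes this obstacle: its diagonal entry is free and takes up the inverse of the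
  product of the others. The same index supplies the kernel \<open>R(n)\<close>.

  The injection \<iota> is an arbitrary choice, given by no formula. It is controlled through one
  element: \<open>x - 1\<close> lies in its image and acts on \<int>[\<zeta>] as multiplication by
  \<open>t = \<zeta> - 1\<close>.

  The arithmetic of \<int>[\<zeta>] rests on the relation \<open>(1 + t)^p = 1\<close> and on
  \<open>1/p\<close> not being an algebraic integer. Hence \<open>t\<close> is not a unit, the
  powers of \<open>t\<close> below \<open>t^(p-1)\<close> are independent, and only then are the
  conjugations and the row vectors of the modules \<open>R(i)\<close> well defined. That
  homomorphisms \<open>R(j) \<rightarrow> R(i)\<close> are integers is proved here as well, by way
  of the trace.\<close>

lemma algebraic_int_if_eigenvalue:
  fixes x :: complex and v :: "nat \<Rightarrow> complex" and M :: "nat \<Rightarrow> nat \<Rightarrow> int"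
  assumes eq: "\<And>i. i < n \<Longrightarrow> x * v i = (\<Sum>j<n. of_int (M i j) * v j)"
    and nz: "i0 < n" "v i0 \<noteq> 0"
  shows "algebraic_int x"
proof -
  define A :: "int mat" where "A = mat n n (\<lambda>(i,j). M i j)"
  define B :: "complex mat" where "B = map_mat of_int A"
  have A: "A \<in> carrier_mat n n" by (simp add: A_def)
  have B: "B \<in> carrier_mat n n" using A by (simp add: B_def)
  have "eigenvector B (vec n v) x"
    unfolding eigenvector_def
  proof (intro conjI)
    show "vec n v \<in> carrier_vec (dim_row B)" using B by auto
    show "vec n v \<noteq> 0\<^sub>v (dim_row B)"
    proof
      assume "vec n v = 0\<^sub>v (dim_row B)"
      then have "vec n v $ i0 = 0\<^sub>v n $ i0" using B by auto
      with nz show False by simp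
    qed
    show "B *\<^sub>v vec n v = x \<cdot>\<^sub>v vec n v"
      by (rule eq_vecI)
        (auto simp: B_def A_def eq scalar_prod_def atLeast0LessThan)
  qed
  then have "eigenvalue B x" by (auto simp: eigenvalue_def)
  then have root: "poly (char_poly B) x = 0"
    using eigenvalue_root_char_poly[OF B] by simp
  \<comment> \<open>The characteristic polynomial has integer coefficients and is monic, because it
    comes from the integer matrix \<open>A\<close>.\<close>
  have "char_poly B = map_poly of_int (char_poly A)"
    unfolding B_def by (rule of_int_hom.char_poly_hom[OF A])
  moreover have "lead_coeff (char_poly A) = 1"
    using degree_monic_char_poly[OF A] by simp
  ultimately show ?thesis
    using root by (auto simp: algebraic_int_altdef_ipoly)
qed

section \<open>The ring \<int>[\<zeta>] and the Eisenstein relation of t\<close>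

locale prime_cyclotomic =
  fixes p :: nat
  assumes prime_p: "prime p" and odd_p: "odd p"
begin

abbreviation \<zeta> :: complex where "\<zeta> \<equiv> zeta p"
definition t :: complex where "t = zeta p - 1"
abbreviation \<O> :: "complex set" where "\<O> \<equiv> Z_zeta p"
abbreviation ev :: "int poly \<Rightarrow> complex \<Rightarrow> complex" where "ev f z \<equiv> poly (map_poly of_int f) z"

lemma p_ge_3: "p \<ge> 3"
  using prime_ge_2_nat[OF prime_p] odd_p by (cases "p = 2") auto

lemma zeta_pow_p [simp]: "\<zeta> ^ p = 1"
proof -
  have "\<zeta> ^ p = exp (of_nat p * (2 * of_real pi * \<i> / of_nat p))"
    by (simp only: zeta_def exp_of_nat_mult)
  also have "of_nat p * (2 * of_real pi * \<i> / of_nat p) = 2 * of_real pi * \<i>"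
    using p_ge_3 by simp
  also have "exp \<dots> = 1" by simp
  finally show ?thesis .
qed

lemma zeta_nonzero [simp]: "\<zeta> \<noteq> 0" by (simp add: zeta_def)

lemma zeta_ne_1: "\<zeta> \<noteq> 1"
proof
  assume *: "\<zeta> = 1"
  have "\<zeta> = cis (2 * pi / p)" by (simp add: zeta_def cis_conv_exp mult_ac)
  then have "sin (2 * pi / p) = 0" using * by (metis cis.simps(2) one_complex.simps(2))
  moreover have "sin (2 * pi / p) > 0"
    using p_ge_3 by (intro sin_gt_zero) (auto simp: field_simps)
  ultimately show False by simp
qed

lemma t_nonzero [simp]: "t \<noteq> 0" using zeta_ne_1 by (simp add: t_def)

lemma zeta_eq: "\<zeta> = 1 + t" by (simp add: t_def)

lemma zeta_pow_mod: "\<zeta> ^ (k mod p) = \<zeta> ^ k"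
proof -
  have "\<zeta> ^ k = \<zeta> ^ (p * (k div p) + k mod p)" by simp
  also have "\<dots> = \<zeta> ^ (k mod p)" by (simp only: power_add power_mult zeta_pow_p) simp
  finally show ?thesis by simp
qed

lemma zeta_pow_cong: "[k = l] (mod p) \<Longrightarrow> \<zeta> ^ k = \<zeta> ^ l"
  by (metis cong_def zeta_pow_mod)

lemma ev_pCons [simp]: "ev (pCons a f) z = of_int a + z * ev f z"
  by (cases "a = 0 \<and> f = 0") (auto simp: map_poly_pCons)

lemma ev_simps [simp]:
  "ev (f + g) z = ev f z + ev g z" "ev (f * g) z = ev f z * ev g z"
  "ev (f - g) z = ev f z - ev g z" "ev (- f) z = - ev f z"
proof -
  have "map_poly of_int (f + g) = (map_poly of_int f + map_poly of_int g :: complex poly)"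
    by (rule poly_eqI) (simp add: coeff_map_poly)
  then show "ev (f + g) z = ev f z + ev g z" by simp
  have "map_poly of_int (f * g) = (map_poly of_int f * map_poly of_int g :: complex poly)"
    by (rule poly_eqI) (simp add: coeff_map_poly coeff_mult)
  then show "ev (f * g) z = ev f z * ev g z" by simp
  have "map_poly of_int (f - g) = (map_poly of_int f - map_poly of_int g :: complex poly)"
    by (rule poly_eqI) (simp add: coeff_map_poly)
  then show "ev (f - g) z = ev f z - ev g z" by simp
  have "map_poly of_int (- f) = (- map_poly of_int f :: complex poly)"
    by (rule poly_eqI) (simp add: coeff_map_poly)
  then show "ev (- f) z = - ev f z" by simp
qed

text \<open>Horner's scheme turns induction on a representing polynomial into a rule for the
  elements of \<int>[\<zeta>] themselves, so an additive statement only has to be checked for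
  integers and for multiplication by \<zeta>.\<close>

lemma O_induct [consumes 1, case_names zero step]:
  assumes "u \<in> \<O>" and "P 0" and "\<And>a u. u \<in> \<O> \<Longrightarrow> P u \<Longrightarrow> P (of_int a + \<zeta> * u)"
  shows "P u"
proof -
  obtain f where u: "u = ev f \<zeta>" using assms(1) by (auto simp: Z_zeta_def)
  have "P (ev f \<zeta>)"
    by (induction f) (auto simp: Z_zeta_def intro: assms(2,3))
  then show ?thesis by (simp add: u)
qed

lemma O_ev [intro, simp]: "ev f \<zeta> \<in> \<O>" by (auto simp: Z_zeta_def)
lemma O_E: assumes "u \<in> \<O>" obtains f where "u = ev f \<zeta>" using assms by (auto simp: Z_zeta_def)

lemma O_add [intro]: "u \<in> \<O> \<Longrightarrow> v \<in> \<O> \<Longrightarrow> u + v \<in> \<O>"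
  by (metis O_E O_ev ev_simps(1))
lemma O_mult [intro]: "u \<in> \<O> \<Longrightarrow> v \<in> \<O> \<Longrightarrow> u * v \<in> \<O>"
  by (metis O_E O_ev ev_simps(2))
lemma O_diff [intro]: "u \<in> \<O> \<Longrightarrow> v \<in> \<O> \<Longrightarrow> u - v \<in> \<O>"
  by (metis O_E O_ev ev_simps(3))
lemma O_uminus [intro]: "u \<in> \<O> \<Longrightarrow> - u \<in> \<O>"
  by (metis O_E O_ev ev_simps(4))
lemma O_int [intro, simp]: "of_int a \<in> \<O>"
  using O_ev[of "[:a:]"] by simp
lemma O_nat [intro, simp]: "of_nat a \<in> \<O>"
  by (metis O_int of_int_of_nat_eq)
lemma O_0 [intro, simp]: "0 \<in> \<O>" and O_1 [intro, simp]: "1 \<in> \<O>"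
  using O_int[of 0] O_int[of 1] by simp_all
lemma O_zeta [intro, simp]: "\<zeta> \<in> \<O>"
  using O_ev[of "[:0, 1:]"] by simp
lemma O_t [intro, simp]: "t \<in> \<O>" unfolding t_def by (intro O_diff) auto
lemma O_power [intro]: "u \<in> \<O> \<Longrightarrow> u ^ k \<in> \<O>"
  by (induction k) auto
lemma O_sum [intro]: "(\<And>i. i \<in> A \<Longrightarrow> f i \<in> \<O>) \<Longrightarrow> sum f A \<in> \<O>"
  by (induction A rule: infinite_finite_induct) auto

lemma inverse_zeta: "inverse \<zeta> = \<zeta> ^ (p - 1)"
proof (rule inverse_unique)
  have "\<zeta> * \<zeta> ^ (p - 1) = \<zeta> ^ Suc (p - 1)" by simp
  also have "Suc (p - 1) = p" using p_ge_3 by simp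
  finally show "\<zeta> * \<zeta> ^ (p - 1) = 1" by simp
qed

lemma O_div_zeta [intro]: "u \<in> \<O> \<Longrightarrow> u / \<zeta> \<in> \<O>"
  by (simp add: divide_inverse inverse_zeta O_mult O_power)

text \<open>Up to the factor \<open>p\<close>, these are the coefficients of
  \<open>((1 + t)^p - 1) / t\<close> below the leading one; the division is exact for
  \<open>k < p - 1\<close>.\<close>

definition binom_quot :: "nat \<Rightarrow> int" where "binom_quot k = int ((p choose (k + 1)) div p)"

lemma binomial_quot: assumes "k < p - 1" shows "int (p choose (k + 1)) = int p * binom_quot k"
proof -
  have "p dvd (p choose (k + 1))" using assms by (intro dvd_choose_prime prime_p) auto
  then show ?thesis by (simp add: binom_quot_def flip: of_nat_mult)
qed

lemma binom_quot_0: "binom_quot 0 = 1" using p_ge_3 by (simp add: binom_quot_def)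

text \<open>Expanding \<open>1 = (1 + t)^p\<close> and cancelling one factor \<open>t\<close> leaves
  \<open>t^(p-1)\<close> plus terms divisible by \<open>p\<close>, a relation of Eisenstein type. It
  is the source of every later exchange between the prime \<open>p\<close> and powers of
  \<open>t\<close>.\<close>

lemma t_pow_p_minus_1: "t ^ (p - 1) = - of_nat p * (\<Sum>k<p - 1. of_int (binom_quot k) * t ^ k)"
proof -
  have pp: "p = Suc (Suc (p - 2))" and pp': "p - 1 = Suc (p - 2)" using p_ge_3 by auto
  have "1 = (t + 1) ^ p" using zeta_pow_p by (simp add: zeta_eq add.commute)
  also have "\<dots> = (\<Sum>k\<le>p. of_nat (p choose k) * t ^ k)"
    by (subst binomial_ring) simp
  also have "\<dots> = 1 + (\<Sum>k<p. of_nat (p choose (k + 1)) * t ^ (k + 1))"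
    by (subst (1) pp, subst sum.atMost_Suc_shift) (use pp in \<open>simp add: lessThan_Suc_atMost[symmetric]\<close>)
  finally have "0 = t * (\<Sum>k<p. of_nat (p choose (k + 1)) * t ^ k)"
    by (simp add: sum_distrib_left mult_ac)
  then have "0 = (\<Sum>k<p. of_nat (p choose (k + 1)) * t ^ k)" by simp
  also have "\<dots> = (\<Sum>k<p - 1. of_nat (p choose (k + 1)) * t ^ k) + t ^ (p - 1)"
    by (subst (1) pp) (simp only: sum.lessThan_Suc pp', use pp in simp)
  also have "(\<Sum>k<p - 1. of_nat (p choose (k + 1)) * t ^ k) = (\<Sum>k<p - 1. of_nat p * of_int (binom_quot k) * t ^ k)"
  proof (rule sum.cong)
    fix k assume "k \<in> {..<p - 1}"
    then have "complex_of_int (int (p choose (k + 1))) = of_int (int p * binom_quot k)"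
      by (subst binomial_quot) auto
    then show "of_nat (p choose (k + 1)) * t ^ k = of_nat p * of_int (binom_quot k) * t ^ k" by simp
  qed simp
  also have "\<dots> = of_nat p * (\<Sum>k<p - 1. of_int (binom_quot k) * t ^ k)"
    by (simp add: sum_distrib_left mult_ac)
  finally show ?thesis by (simp add: add_eq_0_iff)
qed

lemma O_span:
  assumes "u \<in> \<O>"
  shows "\<exists>c :: nat \<Rightarrow> int. u = (\<Sum>j<p - 1. of_int (c j) * t ^ j)"
  using assms
proof (induction rule: O_induct)
  case zero
  show ?case by (rule exI[of _ "\<lambda>_. 0"]) simp
next
  case (step a u)
  then obtain c :: "nat \<Rightarrow> int" where u: "u = (\<Sum>j<p - 1. of_int (c j) * t ^ j)" by blast
  define q where "q = p - 2"
  have q: "p - 1 = Suc q" using p_ge_3 by (simp add: q_def)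
  \<comment> \<open>Coefficients of \<open>a + u + t * u\<close>: the shift of \<open>c\<close> with
    \<open>a\<close> in place 0, then \<open>c\<close> itself, then the overflow
    \<open>c q * t^(p-1)\<close> reduced by \<open>t_pow_p_minus_1\<close>.\<close>
  define d where "d j = (if j = 0 then a else c (j - 1)) + c j - int p * c q * binom_quot j" for j
  have "t * u = (\<Sum>j<Suc q. of_int (c j) * t ^ Suc j)"
    unfolding u q by (simp add: sum_distrib_left distrib_left mult_ac)
  also have "\<dots> = (\<Sum>j<q. of_int (c j) * t ^ Suc j) + of_int (c q) * t ^ (p - 1)"
    by (simp only: q sum.lessThan_Suc power_Suc)
  also have "(\<Sum>j<q. of_int (c j) * t ^ Suc j) + of_int a = (\<Sum>j<Suc q. of_int (if j = 0 then a else c (j - 1)) * t ^ j)"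
    by (subst sum.lessThan_Suc_shift) simp
  then have "(\<Sum>j<q. of_int (c j) * t ^ Suc j) = (\<Sum>j<Suc q. of_int (if j = 0 then a else c (j - 1)) * t ^ j) - of_int a"
    by (simp add: algebra_simps)
  also have "of_int (c q) * t ^ (p - 1) = - (\<Sum>j<Suc q. of_int (int p * c q * binom_quot j) * t ^ j)"
    unfolding t_pow_p_minus_1 unfolding q sum_distrib_left sum_negf[symmetric]
    by (rule sum.cong) (simp_all add: mult_ac)
  finally have "of_int a + \<zeta> * u = (\<Sum>j<Suc q. of_int (if j = 0 then a else c (j - 1)) * t ^ j)
      - (\<Sum>j<Suc q. of_int (int p * c q * binom_quot j) * t ^ j) + (\<Sum>j<Suc q. of_int (c j) * t ^ j)"
    using u q by (simp add: zeta_eq algebra_simps)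
  also have "\<dots> = (\<Sum>j<p - 1. of_int (d j) * t ^ j)"
    unfolding q d_def by (simp only: of_int_add of_int_diff distrib_right left_diff_distrib sum.distrib sum_subtractf)
       simp
  finally show ?case by blast
qed

text \<open>The powers \<open>t^i\<close> with \<open>i < p - 1\<close> span \<int>[\<zeta>], so
  multiplication by an element of the ring is given on them by an integer matrix, even before they
  are known to be independent. Thus \<open>1/p\<close> would be an eigenvalue of such a matrix, that
  is, a rational algebraic integer and therefore an integer.\<close>

lemma inverse_p_notin_O: "1 / of_nat p \<notin> \<O>"
proof
  assume *: "1 / of_nat p \<in> \<O>"
  have "\<exists>c :: nat \<Rightarrow> int. 1 / of_nat p * t ^ i = (\<Sum>j<p - 1. of_int (c j) * t ^ j)" for i
    by (intro O_span O_mult * O_power) auto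
  then obtain M :: "nat \<Rightarrow> nat \<Rightarrow> int" where
    M: "\<And>i. 1 / of_nat p * t ^ i = (\<Sum>j<p - 1. of_int (M i j) * t ^ j)" by metis
  have "algebraic_int (1 / of_nat p :: complex)"
    by (rule algebraic_int_if_eigenvalue[of "p - 1" _ "\<lambda>i. t ^ i" M 0]) (use M p_ge_3 in auto)
  then have "1 / of_nat p \<in> (\<int> :: complex set)"
    by (rule rational_algebraic_int_is_int) (auto)
  then obtain k :: int where "1 / of_nat p = (of_int k :: complex)" by (auto elim: Ints_cases)
  then have "(1 :: complex) = of_int (k * int p)" using p_ge_3 by (simp add: field_simps)
  then have "1 = k * int p" by (metis of_int_1 of_int_eq_iff)
  then show False using prime_p by (metis dvd_triv_right int_dvd_int_iff not_prime_unit of_nat_1)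
qed

section \<open>The filtration of \<int>[\<zeta>] by the powers of t\<close>

definition I :: "nat \<Rightarrow> complex set" where "I i = (\<lambda>u. t ^ i * u) ` \<O>"

lemma I_iff: "v \<in> I i \<longleftrightarrow> (\<exists>u\<in>\<O>. v = t ^ i * u)" by (auto simp: I_def)
lemma I_0 [simp]: "I 0 = \<O>" by (auto simp: I_def)
lemma I_add: "u \<in> I i \<Longrightarrow> v \<in> I i \<Longrightarrow> u + v \<in> I i"
  by (auto simp: I_iff simp flip: distrib_left)
lemma I_diff: "u \<in> I i \<Longrightarrow> v \<in> I i \<Longrightarrow> u - v \<in> I i"
  by (auto simp: I_iff simp flip: right_diff_distrib)
lemma I_mult: "u \<in> I i \<Longrightarrow> v \<in> \<O> \<Longrightarrow> u * v \<in> I i"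
  by (auto simp: I_iff mult.assoc)
lemma I_mult': "v \<in> \<O> \<Longrightarrow> u \<in> I i \<Longrightarrow> v * u \<in> I i"
  using I_mult by (simp add: mult.commute)
lemma I_uminus: "u \<in> I i \<Longrightarrow> - u \<in> I i"
  using I_mult'[of "-1" u i] by auto
lemma I_mult_I: "u \<in> I i \<Longrightarrow> v \<in> I j \<Longrightarrow> u * v \<in> I (i + j)"
proof -
  assume "u \<in> I i" "v \<in> I j"
  then obtain a b where ab: "a \<in> \<O>" "b \<in> \<O>" "u = t ^ i * a" "v = t ^ j * b" by (auto simp: I_iff)
  then have "u * v = t ^ (i + j) * (a * b)" by (simp add: power_add mult_ac)
  then show ?thesis using ab O_mult by (metis I_iff)
qed
lemma I_zero [simp]: "0 \<in> I i" by (auto simp: I_iff intro!: bexI[of _ 0])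
lemma I_sum: "(\<And>x. x \<in> A \<Longrightarrow> f x \<in> I i) \<Longrightarrow> sum f A \<in> I i"
  by (induction A rule: infinite_finite_induct) (auto intro: I_add)
lemma I_power: "t ^ i \<in> I i" by (auto simp: I_iff intro!: bexI[of _ 1])
lemma I_antimono: "i \<le> j \<Longrightarrow> I j \<subseteq> I i"
proof
  fix v assume "i \<le> j" "v \<in> I j"
  then obtain u where u: "u \<in> \<O>" "v = t ^ (i + (j - i)) * u" by (auto simp: I_iff)
  then show "v \<in> I i" by (auto simp: I_iff power_add mult.assoc intro!: bexI[of _ "t ^ (j - i) * u"])
qed
lemma I_subset_O: "I i \<subseteq> \<O>" using I_antimono[of 0 i] by simp

text \<open>The relation reads \<open>t^(p-1) = - p * (1 + t * u)\<close>, but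
  \<open>1 + t * u\<close> is not known to be a unit. Substituting
  \<open>p = - t^(p-1) - p * t * u\<close> into its own last term \<open>p - 1\<close> times gives
  the remaining term a factor \<open>t^(p-1)\<close> too.\<close>

lemma p_in_I: "of_nat p \<in> I (p - 1)"
proof -
  define u where "u = (\<Sum>k<p - 2. of_int (binom_quot (Suc k)) * t ^ k)"
  have u: "u \<in> \<O>" by (auto simp: u_def intro!: O_sum)
  have q: "p - 1 = Suc (p - 2)" using p_ge_3 by simp
  have "t ^ (p - 1) = - of_nat p * (1 + t * u)"
    unfolding t_pow_p_minus_1 unfolding q u_def
    by (subst sum.lessThan_Suc_shift) (simp add: binom_quot_0 sum_distrib_left mult_ac)
  then have eq: "of_nat p = - (t ^ (p - 1)) - of_nat p * t * u" by (simp only:) (simp add: algebra_simps)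
  have "\<exists>a\<in>\<O>. \<exists>b\<in>\<O>. of_nat p = t ^ (p - 1) * a + of_nat p * t ^ j * b" for j
  proof (induction j)
    case 0
    show ?case by (intro bexI[of _ 0] bexI[of _ 1]) auto
  next
    case (Suc j)
    then obtain a b where ab: "a \<in> \<O>" "b \<in> \<O>" and
      e: "of_nat p = t ^ (p - 1) * a + of_nat p * t ^ j * b" by blast
    have "t ^ (p - 1) * (a - t ^ j * b) + of_nat p * t ^ Suc j * (- (u * b))
        = t ^ (p - 1) * a + (- (t ^ (p - 1)) - of_nat p * t * u) * (t ^ j * b)"
      by (simp add: algebra_simps)
    also have "\<dots> = t ^ (p - 1) * a + of_nat p * t ^ j * b"
      by (subst eq[symmetric]) (simp add: mult_ac)
    also note e[symmetric]
    finally have "of_nat p = t ^ (p - 1) * (a - t ^ j * b) + of_nat p * t ^ Suc j * (- (u * b))" by simp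
    moreover have "a - t ^ j * b \<in> \<O>" "- (u * b) \<in> \<O>" using ab u by (auto intro!: O_diff O_mult O_power O_uminus O_t)
    ultimately show ?case by blast
  qed
  from this[of "p - 1"] obtain a b where ab: "a \<in> \<O>" "b \<in> \<O>" and
    "of_nat p = t ^ (p - 1) * a + of_nat p * t ^ (p - 1) * b" by blast
  then have "of_nat p = t ^ (p - 1) * (a + of_nat p * b)" by (simp add: algebra_simps)
  then show ?thesis using ab by (auto simp: I_iff)
qed

lemma t_pow_dvd_p: "j \<le> p - 1 \<Longrightarrow> of_nat p \<in> I j"
  using p_in_I I_antimono by blast

text \<open>Were \<open>g\<close> an inverse of \<open>t\<close>, then
  \<open>1 = (t * g)^(p-1)\<close> would be \<open>p\<close> times an element of the ring, since
  \<open>t^(p-1)\<close> is; this contradicts \<open>inverse_p_notin_O\<close>.\<close>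

lemma one_notin_I: "1 \<notin> I 1"
proof
  assume "1 \<in> I 1"
  then obtain g where g: "g \<in> \<O>" "1 = t * g" by (auto simp: I_iff)
  have "1 = (t * g) ^ (p - 1)" using g by simp
  also have "\<dots> = of_nat p * (- (\<Sum>k<p - 1. of_int (binom_quot k) * t ^ k) * g ^ (p - 1))"
    by (simp only: power_mult_distrib t_pow_p_minus_1) simp
  finally have "1 / of_nat p = - (\<Sum>k<p - 1. of_int (binom_quot k) * t ^ k) * g ^ (p - 1)"
    using p_ge_3 by (simp add: field_simps)
  moreover have "- (\<Sum>k<p - 1. of_int (binom_quot k) * t ^ k) * g ^ (p - 1) \<in> \<O>"
    using g by (intro O_mult O_uminus O_sum O_power) auto
  ultimately show False using inverse_p_notin_O by simp
qed

text \<open>Both \<open>p\<close> and \<open>c\<close> lie in \<open>I 1\<close>; if they were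
  coprime, Bezout's identity would put 1 into this ideal.\<close>

lemma int_in_I_1: assumes "of_int c \<in> I 1" shows "int p dvd c"
proof (rule ccontr)
  assume "\<not> int p dvd c"
  then have "coprime (int p) c" using prime_p by (simp add: prime_imp_coprime)
  then obtain x y where "x * int p + y * c = 1" using bezout_int[of "int p" c] by auto
  then have "complex_of_int (x * int p + y * c) = 1" by simp
  then have e: "1 = of_int x * of_nat p + of_int y * complex_of_int c" by simp
  have "of_int x * of_nat p + of_int y * complex_of_int c \<in> I 1"
    using assms p_ge_3 by (intro I_add I_mult' t_pow_dvd_p) auto
  then show False using one_notin_I e by simp
qed

text \<open>Compare modulo \<open>t^(j+1)\<close>: the terms after \<open>j\<close> vanish, and so
  do those before \<open>j\<close>, because their coefficients are already divisible by
  \<open>p\<close>, which lies in \<open>I (Suc j)\<close>. What remains shows that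
  \<open>c j\<close> lies in \<open>I 1\<close>.\<close>

lemma t_powers_independent_aux:
  assumes "(\<Sum>j<p - 1. of_int (c j) * t ^ j) = 0" "j < p - 1"
  shows "int p dvd c j"
  using assms(2)
proof (induction j rule: less_induct)
  case (less j)
  let ?f = "\<lambda>i. of_int (c i) * t ^ i"
  have "sum ?f ({..<j} \<union> insert j {j<..<p - 1}) = sum ?f {..<j} + sum ?f (insert j {j<..<p - 1})"
    by (rule sum.union_disjoint) auto
  also have "{..<j} \<union> insert j {j<..<p - 1} = {..<p - 1}" using less.prems by auto
  also have "sum ?f (insert j {j<..<p - 1}) = ?f j + sum ?f {j<..<p - 1}" by simp
  finally have "(\<Sum>i<p - 1. of_int (c i) * t ^ i)
     = (\<Sum>i<j. of_int (c i) * t ^ i) + (of_int (c j) * t ^ j + (\<Sum>i\<in>{j<..<p - 1}. of_int (c i) * t ^ i))" .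
  then have e: "of_int (c j) * t ^ j = - (\<Sum>i<j. of_int (c i) * t ^ i) - (\<Sum>i\<in>{j<..<p - 1}. of_int (c i) * t ^ i)"
    using assms(1) by (simp add: algebra_simps eq_neg_iff_add_eq_0)
  have "of_int (c i) * t ^ i \<in> I (Suc j)" if "i < j" for i
  proof -
    from less that obtain d where "c i = int p * d" by (meson dvdE less_trans)
    then have "of_int (c i) * t ^ i = of_nat p * (of_int d * t ^ i)" by simp
    then show ?thesis using less.prems by (auto intro!: I_mult t_pow_dvd_p O_mult O_power)
  qed
  moreover have "of_int (c i) * t ^ i \<in> I (Suc j)" if "i \<in> {j<..<p - 1}" for i
    using I_antimono[of "Suc j" i] that I_power[of i] by (auto intro!: I_mult')
  ultimately have "of_int (c j) * t ^ j \<in> I (Suc j)"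
    unfolding e by (intro I_diff I_uminus I_sum) auto
  then have "of_int (c j) \<in> I 1" by (auto simp: I_iff)
  then show ?case by (rule int_in_I_1)
qed

text \<open>Descent: a relation whose coefficients are all divisible by \<open>p\<close> can be
  divided by \<open>p\<close>, so every power of \<open>p\<close> divides every coefficient. The
  exponent \<open>\<bar>c j\<bar>\<close> already contradicts this unless
  \<open>c j = 0\<close>.\<close>

lemma t_powers_independent:
  assumes "(\<Sum>j<p - 1. of_int (c j) * t ^ j) = 0" "j < p - 1"
  shows "c j = 0"
proof -
  have *: "\<forall>c. (\<Sum>j<p - 1. of_int (c j) * t ^ j) = 0 \<longrightarrow> (\<forall>j<p - 1. int p ^ k dvd c j)" for k
  proof (induction k)
    case (Suc k)
    show ?case
    proof (intro allI impI)
      fix c j assume c: "(\<Sum>j<p - 1. of_int (c j) * t ^ j) = 0" and j: "j < p - 1"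
      define d where "d j = c j div int p" for j
      have cd: "c j = int p * d j" if "j < p - 1" for j
        using t_powers_independent_aux[OF c that] by (simp add: d_def)
      have "of_nat p * (\<Sum>j<p - 1. of_int (d j) * t ^ j) = (\<Sum>j<p - 1. of_int (c j) * t ^ j)"
        by (simp add: sum_distrib_left cd mult_ac)
      then have "(\<Sum>j<p - 1. of_int (d j) * t ^ j) = 0" using c p_ge_3 by simp
      then have "int p ^ k dvd d j" using Suc j by blast
      then show "int p ^ Suc k dvd c j" using cd[OF j] by simp
    qed
  qed auto
  show ?thesis
  proof (rule ccontr)
    assume "c j \<noteq> 0"
    moreover have "int p ^ nat \<bar>c j\<bar> dvd c j" using * assms by blast
    ultimately have "int p ^ nat \<bar>c j\<bar> \<le> \<bar>c j\<bar>" by (meson dvd_abs_iff zdvd_imp_le zero_less_abs_iff)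
    moreover have "nat \<bar>c j\<bar> < p ^ nat \<bar>c j\<bar>" using p_ge_3 by (intro power_gt_expt) auto
    then have "\<bar>c j\<bar> < int p ^ nat \<bar>c j\<bar>" by (metis nat_less_iff abs_ge_zero of_nat_power zless_nat_eq_int_zless)
    ultimately show False by simp
  qed
qed

section \<open>Row vectors as elements of the ideal generated by t\<close>

definition V :: "(nat \<Rightarrow> int) set" where "V = {r. \<forall>j. j \<notin> {1..p - 1} \<longrightarrow> r j = 0}"
definition val :: "(nat \<Rightarrow> int) \<Rightarrow> complex" where "val r = (\<Sum>k\<in>{1..p - 1}. of_int (r k) * t ^ k)"

lemma val_add: "val (\<lambda>j. r j + s j) = val r + val s"
  by (simp add: val_def distrib_right sum.distrib)
lemma val_scale: "val (\<lambda>j. d * r j) = of_int d * val r"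
  by (simp add: val_def sum_distrib_left mult.assoc)
lemma val_sum: "val (\<lambda>j. \<Sum>x\<in>A. f x j) = (\<Sum>x\<in>A. val (f x))"
proof -
  have "val (\<lambda>j. \<Sum>x\<in>A. f x j) = (\<Sum>k\<in>{1..p - 1}. \<Sum>x\<in>A. of_int (f x k) * t ^ k)"
    by (simp add: val_def sum_distrib_right)
  also have "\<dots> = (\<Sum>x\<in>A. val (f x))"
    unfolding val_def by (rule sum.swap)
  finally show ?thesis .
qed

lemma val_in_I_1: "val r \<in> I 1"
proof -
  have "t ^ k \<in> I 1" if "k \<ge> 1" for k using that I_antimono[of 1 k] I_power[of k] by auto
  then show ?thesis unfolding val_def by (intro I_sum I_mult') auto
qed

lemma ex_val: assumes "v \<in> I 1" shows "\<exists>r\<in>V. val r = v"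
proof -
  obtain u where u: "u \<in> \<O>" "v = t * u" using assms by (auto simp: I_iff)
  obtain c :: "nat \<Rightarrow> int" where c: "u = (\<Sum>j<p - 1. of_int (c j) * t ^ j)" using O_span[OF u(1)] by blast
  \<comment> \<open>Multiplication by \<open>t\<close> moves the exponents 0 to \<open>p - 2\<close>
    of \<open>O_span\<close> to the range 1 to \<open>p - 1\<close> that indexes rows.\<close>
  define r where "r k = (if k \<in> {1..p - 1} then c (k - 1) else 0)" for k
  have "val r = (\<Sum>j<p - 1. of_int (r (Suc j)) * t ^ Suc j)"
    unfolding val_def One_nat_def by (rule sum.atLeast1_atMost_eq)
  also have "\<dots> = (\<Sum>j<p - 1. of_int (c j) * t ^ Suc j)"
    by (rule sum.cong) (auto simp: r_def)
  also have "\<dots> = v" by (simp add: u c sum_distrib_left mult_ac)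
  finally have "val r = v" .
  moreover have "r \<in> V" by (auto simp: V_def r_def)
  ultimately show ?thesis by blast
qed

lemma val_inj: assumes "r \<in> V" "s \<in> V" "val r = val s" shows "r = s"
proof
  fix k
  have "val (\<lambda>j. r j + (- 1) * s j) = 0"
    using assms(3) by (simp only: val_add val_scale) simp
  then have "0 = (\<Sum>j<p - 1. of_int (r (Suc j) - s (Suc j)) * t ^ Suc j)"
    unfolding val_def One_nat_def by (subst (asm) sum.atLeast1_atMost_eq) simp
  also have "\<dots> = t * (\<Sum>j<p - 1. of_int (r (Suc j) - s (Suc j)) * t ^ j)"
    by (simp add: sum_distrib_left mult_ac)
  finally have *: "(\<Sum>j<p - 1. of_int (r (Suc j) - s (Suc j)) * t ^ j) = 0" by simp
  show "r k = s k"
  proof (cases "k \<in> {1..p - 1}")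
    case True
    then have "k = Suc (k - 1)" "k - 1 < p - 1" by auto
    then show ?thesis using t_powers_independent[OF *, of "k - 1"] by simp
  qed (use assms in \<open>auto simp: V_def\<close>)
qed

lemma zeta_coords_val: assumes "r \<in> V" shows "zeta_coords p (val r) = r"
  unfolding zeta_coords_def
proof (rule the_equality)
  show "(\<forall>j. j \<notin> {1..p - 1} \<longrightarrow> r j = 0) \<and> val r = (\<Sum>j\<in>{1..p - 1}. of_int (r j) * (zeta p - 1) ^ j)"
    using assms by (auto simp: V_def val_def t_def)
next
  fix c :: "nat \<Rightarrow> int"
  assume "(\<forall>j. j \<notin> {1..p - 1} \<longrightarrow> c j = 0) \<and> val r = (\<Sum>j\<in>{1..p - 1}. of_int (c j) * (zeta p - 1) ^ j)"
  then have "c \<in> V" "val c = val r" by (auto simp: V_def val_def t_def)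
  then show "c = r" using assms val_inj by blast
qed

lemma zeta_coords: assumes "v \<in> I 1" shows "zeta_coords p v \<in> V" "val (zeta_coords p v) = v"
  using ex_val[OF assms] zeta_coords_val by auto

text \<open>From right to left, \<open>p * t^k\<close> with \<open>k \<ge> 1\<close> lies in
  \<open>I p\<close>, whence the bound \<open>i \<le> p\<close>. For the converse, \<open>S\<close>
  collects the values of the rows with the required divisibility. It contains \<open>t^k\<close> for
  every \<open>k \<ge> i\<close>: up to \<open>p - 1\<close> as a unit row, and beyond because a
  factor \<open>t^(p-1)\<close> makes all coordinates divisible by \<open>p\<close>. Uniqueness of
  coordinates then transfers membership in \<open>S\<close> back to \<open>r\<close>.\<close>

lemma val_in_I_iff:
  assumes r: "r \<in> V" and i: "1 \<le> i" "i \<le> p"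
  shows "val r \<in> I i \<longleftrightarrow> (\<forall>j<i. int p dvd r j)"
proof
  assume *: "\<forall>j<i. int p dvd r j"
  have "of_int (r k) * t ^ k \<in> I i" if k: "k \<in> {1..p - 1}" for k
  proof (cases "k < i")
    case True
    then obtain d where "r k = int p * d" using * by (auto simp: dvd_def)
    then have "of_int (r k) * t ^ k = of_int d * (of_nat p * t ^ k)" by simp
    moreover have "of_nat p * t ^ k \<in> I (p - 1 + 1)"
      using k I_power[of k] I_antimono[of 1 k] by (intro I_mult_I p_in_I) auto
    moreover have "I (p - 1 + 1) \<subseteq> I i" using i by (intro I_antimono) auto
    ultimately show ?thesis by (metis I_mult' O_int subsetD)
  next
    case False
    then show ?thesis using I_antimono[of i k] I_power[of k] by (auto intro!: I_mult')
  qed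
  then show "val r \<in> I i" unfolding val_def by (rule I_sum)
next
  assume *: "val r \<in> I i"
  define S where "S = {val c | c. c \<in> V \<and> (\<forall>j<i. int p dvd c j)}"
  have S_add: "u + v \<in> S" if "u \<in> S" "v \<in> S" for u v
  proof -
    from that obtain c d where "c \<in> V" "d \<in> V" "\<forall>j<i. int p dvd c j" "\<forall>j<i. int p dvd d j" "u = val c" "v = val d"
      by (auto simp: S_def)
    then show ?thesis unfolding S_def
      by (auto intro!: exI[of _ "\<lambda>j. c j + d j"] simp: val_add V_def)
  qed
  have S_scale: "of_int a * u \<in> S" if "u \<in> S" for u a
  proof -
    from that obtain c where "c \<in> V" "\<forall>j<i. int p dvd c j" "u = val c"
      by (auto simp: S_def)
    then show ?thesis unfolding S_def
      by (auto intro!: exI[of _ "\<lambda>j. a * c j"] simp: val_scale V_def)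
  qed
  have S_0: "0 \<in> S" unfolding S_def by (auto intro!: exI[of _ "\<lambda>_. 0"] simp: val_def V_def)
  have S_sum: "sum f A \<in> S" if "\<And>x. x \<in> A \<Longrightarrow> f x \<in> S" for f and A :: "nat set"
    using that by (induction A rule: infinite_finite_induct) (auto intro: S_add S_0)
  have S_power: "t ^ k \<in> S" if "k \<ge> i" for k
  proof (cases "k \<le> p - 1")
    case True
    have "val (\<lambda>j. if j = k then 1 else 0) = (\<Sum>j\<in>{1..p - 1}. if j = k then t ^ k else 0)"
      unfolding val_def by (rule sum.cong) auto
    also have "\<dots> = t ^ k" using True that i by simp
    finally show ?thesis unfolding S_def using True that i
      by (auto intro!: exI[of _ "\<lambda>j. if j = k then 1 else 0"] simp: V_def)
  next
    case False
    then have k: "k = p - 1 + (k - (p - 1))" by simp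
    define w where "w = t ^ (k - (p - 1)) * (- (\<Sum>k<p - 1. of_int (binom_quot k) * t ^ k))"
    have "1 \<le> k - (p - 1)" using False by linarith
    then have "t ^ (k - (p - 1)) \<in> I 1" using I_antimono[of 1 "k - (p - 1)"] I_power[of "k - (p - 1)"] by blast
    then have "w \<in> I 1" unfolding w_def by (intro I_mult O_uminus O_sum O_mult O_power) auto
    then obtain c where c: "c \<in> V" "val c = w" using ex_val by blast
    have "t ^ k = t ^ (p - 1) * t ^ (k - (p - 1))" by (subst k) (simp only: power_add)
    also have "\<dots> = of_int (int p) * w" unfolding t_pow_p_minus_1 w_def by simp
    also have "\<dots> = val (\<lambda>j. int p * c j)" by (simp only: c val_scale)
    finally show ?thesis using c unfolding S_def
      by (auto intro!: exI[of _ "\<lambda>j. int p * c j"] simp: V_def)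
  qed
  obtain u where u: "u \<in> \<O>" "val r = t ^ i * u" using * by (auto simp: I_iff)
  obtain c :: "nat \<Rightarrow> int" where c: "u = (\<Sum>j<p - 1. of_int (c j) * t ^ j)" using O_span[OF u(1)] by blast
  have "val r = (\<Sum>j<p - 1. of_int (c j) * t ^ (i + j))"
    by (simp add: u c sum_distrib_left power_add mult_ac)
  also have "\<dots> \<in> S" by (intro S_sum S_scale S_power) auto
  finally show "\<forall>j<i. int p dvd r j" using val_inj[OF r] by (auto simp: S_def)
qed

lemma ev_pcompose: "ev (pcompose f g) z = ev f (ev g z)"
  by (induction f) (simp_all add: pcompose_pCons)

lemma zeta_pow_ne_1: "coprime k p \<Longrightarrow> \<zeta> ^ k \<noteq> 1"
proof
  assume k: "coprime k p" and 1: "\<zeta> ^ k = 1"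
  obtain x where "[k * x = 1] (mod p)" using cong_solve_coprime_nat[OF k] by auto
  then have "\<zeta> ^ (k * x) = \<zeta> ^ 1" by (rule zeta_pow_cong)
  then show False using 1 zeta_ne_1 by (simp add: power_mult)
qed

text \<open>This is what makes conjugation well defined. Dividing \<open>f\<close> by the monic
  polynomial \<open>1 + X + ... + X^(p-1)\<close> leaves a remainder of smaller degree that vanishes
  at \<zeta>. Independence of the powers of \<open>t\<close> forces it to be zero, so
  \<open>f\<close> is a multiple of a polynomial that also vanishes at
  \<open>\<zeta>^k\<close>.\<close>

lemma ev_zeta_zero:
  assumes f: "ev f \<zeta> = 0" and k: "coprime k p"
  shows "ev f (\<zeta> ^ k) = 0"
proof -
  define \<Phi> :: "int poly" where "\<Phi> = (\<Sum>i<p. Polynomial.monom 1 i)"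
  have coeff: "Polynomial.coeff \<Phi> i = (if i < p then 1 else 0)" for i
    by (auto simp: \<Phi>_def coeff_sum)
  have "degree \<Phi> = p - 1"
    by (rule antisym, rule degree_le) (use p_ge_3 in \<open>auto simp: coeff intro: le_degree\<close>)
  then have lc: "lead_coeff \<Phi> = 1" and deg: "degree \<Phi> = p - 1" using p_ge_3 by (simp_all add: coeff)
  then have nz: "\<Phi> \<noteq> 0" by auto
  have root: "ev \<Phi> w = 0" if "w ^ p = 1" "w \<noteq> 1" for w
  proof -
    have "ev \<Phi> w = (\<Sum>i\<le>p - 1. of_int (Polynomial.coeff \<Phi> i) * w ^ i)"
      unfolding poly_altdef by (simp add: deg coeff_map_poly)
    also have "\<dots> = (\<Sum>i\<le>p - 1. w ^ i)"
      by (rule sum.cong) (use p_ge_3 in \<open>auto simp: coeff\<close>)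
    also have "{..p - 1} = {..<p}" using p_ge_3 by auto
    also have "(\<Sum>i<p. w ^ i) = (w ^ p - 1) / (w - 1)" using that by (rule_tac geometric_sum) simp
    finally show ?thesis using that by simp
  qed
  obtain q r where qr: "pseudo_divmod f \<Phi> = (q, r)" by force
  from pseudo_divmod[OF nz qr] have eq: "f = \<Phi> * q + r" and r: "r = 0 \<or> degree r < p - 1"
    unfolding lc unfolding deg by auto
  have "ev r \<zeta> = 0" using f root[of \<zeta>] zeta_ne_1 by (simp add: eq)
  have "r = 0"
  proof (rule ccontr)
    assume "r \<noteq> 0"
    then have dr: "degree r < p - 1" using r by simp
    \<comment> \<open>Replacing the variable by \<open>1 + X\<close> rewrites the remainder in
      powers of \<open>t\<close>, where independence is available.\<close>
    define s where "s = pcompose r [:1, 1:]"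
    have "degree s = degree r" by (simp add: s_def degree_pcompose)
    then have ds: "degree s < p - 1" using dr by simp
    have "0 = ev s t" using \<open>ev r \<zeta> = 0\<close> by (simp add: s_def ev_pcompose zeta_eq)
    also have "\<dots> = (\<Sum>i\<le>degree s. of_int (Polynomial.coeff s i) * t ^ i)"
      unfolding poly_altdef by (simp add: coeff_map_poly)
    also have "\<dots> = (\<Sum>i<p - 1. of_int (Polynomial.coeff s i) * t ^ i)"
      using ds by (intro sum.mono_neutral_left) (auto intro: coeff_eq_0)
    finally have "\<And>i. i < p - 1 \<Longrightarrow> Polynomial.coeff s i = 0" by (intro t_powers_independent) auto
    then have "s = 0" using ds by (metis leading_coeff_0_iff)
    then show False using \<open>r \<noteq> 0\<close> by (simp add: s_def pcompose_eq_0_iff)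
  qed
  moreover have "\<zeta> ^ k \<noteq> 1" using k by (rule zeta_pow_ne_1)
  moreover have "(\<zeta> ^ k) ^ p = 1" by (metis power_mult mult.commute zeta_pow_p power_one)
  ultimately show ?thesis using root by (simp add: eq)
qed

subsection \<open>Galois automorphisms\<close>

text \<open>The conjugation \<zeta> \<mapsto> \<open>\<zeta>^k\<close>, defined by a choice of
  representing polynomial. For \<open>k\<close> prime to \<open>p\<close> the choice does not
  matter, by \<open>ev_zeta_zero\<close>.\<close>

definition aut :: "nat \<Rightarrow> complex \<Rightarrow> complex" where
  "aut k v = ev (SOME f. v = ev f \<zeta>) (\<zeta> ^ k)"

lemma aut_ev: assumes "coprime k p" shows "aut k (ev f \<zeta>) = ev f (\<zeta> ^ k)"
proof -
  define g where "g = (SOME g. ev f \<zeta> = ev g \<zeta>)"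
  have "ev f \<zeta> = ev g \<zeta>" unfolding g_def by (rule someI) (rule refl)
  then have "ev (f - g) \<zeta> = 0" by simp
  then have "ev (f - g) (\<zeta> ^ k) = 0" using assms by (rule ev_zeta_zero)
  then show ?thesis by (simp add: aut_def g_def)
qed

lemma ev_in_O: "u \<in> \<O> \<Longrightarrow> ev f u \<in> \<O>"
  by (induction f) (auto intro!: O_add O_mult)

context
  fixes k assumes k: "coprime k p"
begin

lemma aut_O [intro]: "v \<in> \<O> \<Longrightarrow> aut k v \<in> \<O>"
  by (elim O_E) (auto simp: aut_ev[OF k] intro!: ev_in_O)

lemma aut_add: "u \<in> \<O> \<Longrightarrow> v \<in> \<O> \<Longrightarrow> aut k (u + v) = aut k u + aut k v"
  by (elim O_E) (simp add: aut_ev[OF k] flip: ev_simps)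
lemma aut_mult: "u \<in> \<O> \<Longrightarrow> v \<in> \<O> \<Longrightarrow> aut k (u * v) = aut k u * aut k v"
  by (elim O_E) (simp add: aut_ev[OF k] flip: ev_simps)
lemma aut_int: "aut k (of_int a) = of_int a"
  using aut_ev[OF k, of "[:a:]"] by simp
lemma aut_zeta: "aut k \<zeta> = \<zeta> ^ k"
  using aut_ev[OF k, of "[:0, 1:]"] by simp
lemma aut_power: "u \<in> \<O> \<Longrightarrow> aut k (u ^ j) = aut k u ^ j"
  by (induction j) (use aut_int[of 1] in \<open>auto simp: aut_mult O_power\<close>)

lemma aut_aut: assumes l: "coprime l p" and "v \<in> \<O>" shows "aut k (aut l v) = aut (k * l) v"
proof -
  obtain f where v: "v = ev f \<zeta>" using assms O_E by blast
  have X: "ev (Polynomial.monom 1 l) z = z ^ l" for z by (simp add: map_poly_monom poly_monom)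
  have al: "aut l v = ev (pcompose f (Polynomial.monom 1 l)) \<zeta>" by (simp only: v aut_ev[OF l] ev_pcompose X)
  have "aut k (aut l v) = ev (pcompose f (Polynomial.monom 1 l)) (\<zeta> ^ k)"
    unfolding al by (rule aut_ev[OF k])
  then have "aut k (aut l v) = ev f ((\<zeta> ^ k) ^ l)" by (simp only: ev_pcompose X)
  moreover have "coprime (k * l) p" using k l by simp
  ultimately show ?thesis by (simp add: v aut_ev power_mult)
qed

lemma aut_t: "\<exists>u\<in>\<O>. aut k t = t * u"
proof -
  have "aut k t = ev [:-1, 1:] (\<zeta> ^ k)"
    using aut_ev[OF k, of "[:-1, 1:]"] by (simp add: t_def)
  also have "\<dots> = \<zeta> ^ k - 1" by simp
  also have "\<dots> = t * (\<Sum>i<k. \<zeta> ^ i)" unfolding t_def by (rule power_diff_1_eq)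
  finally show ?thesis by (auto intro!: O_sum O_power)
qed

lemma aut_I [intro]: assumes "v \<in> I i" shows "aut k v \<in> I i"
proof -
  obtain u where u: "u \<in> \<O>" "v = t ^ i * u" using assms by (auto simp: I_iff)
  obtain w where w: "w \<in> \<O>" "aut k t = t * w" using aut_t by blast
  have "aut k v = t ^ i * (w ^ i * aut k u)"
    using u w by (simp add: aut_mult aut_power O_power power_mult_distrib)
  then show ?thesis using u w by (auto simp: I_iff intro!: O_mult O_power)
qed

end

lemma aut_cong: assumes "[k = l] (mod p)" "coprime k p" "v \<in> \<O>" shows "aut k v = aut l v"
proof -
  have "coprime l p" using assms(1,2) cong_imp_coprime by blast
  then show ?thesis using assms zeta_pow_cong[OF assms(1)] by (elim O_E) (simp add: aut_ev)
qed

lemma aut_1: "v \<in> \<O> \<Longrightarrow> aut 1 v = v"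
  by (elim O_E) (use aut_ev[of 1] in simp)

text \<open>By linearity only the sums of \<open>\<zeta>^(a * j)\<close> over the non-zero residues
  \<open>a\<close> count: they are \<open>p - 1\<close> if \<open>p\<close> divides
  \<open>j\<close>, and -1 otherwise, as part of a geometric sum over all residues.\<close>

lemma trace_in_Ints:
  assumes "v \<in> \<O>"
  shows "(\<Sum>a\<in>{1..p - 1}. aut a v) \<in> \<int>"
proof -
  obtain f where v: "v = ev f \<zeta>" using assms O_E by blast
  have cop: "coprime a p" if "a \<in> {1..p - 1}" for a
  proof -
    have "\<not> p dvd a" using that p_ge_3 by (auto dest: dvd_imp_le)
    then show ?thesis using prime_p prime_imp_coprime coprime_commute by blast
  qed
  have *: "(\<Sum>a\<in>{1..p - 1}. (\<zeta> ^ a) ^ j) \<in> \<int>" for j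
  proof (cases "p dvd j")
    case True
    then have "\<zeta> ^ j = 1" using zeta_pow_cong[of j 0] by (simp add: cong_0_iff)
    then have "(\<zeta> ^ a) ^ j = 1" for a by (metis power_mult mult.commute power_one)
    then show ?thesis by simp
  next
    case False
    then have "coprime j p" using prime_p prime_imp_coprime coprime_commute by blast
    then have ne: "\<zeta> ^ j \<noteq> 1" by (rule zeta_pow_ne_1)
    have "(\<Sum>a<p. (\<zeta> ^ j) ^ a) = ((\<zeta> ^ j) ^ p - 1) / (\<zeta> ^ j - 1)" using ne by (rule geometric_sum)
    also have "(\<zeta> ^ j) ^ p = 1" by (metis power_mult mult.commute zeta_pow_p power_one)
    finally have "(\<Sum>a<p. (\<zeta> ^ j) ^ a) = 0" by simp
    moreover have "{..<p} = insert 0 {1..p - 1}" using p_ge_3 by auto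
    ultimately have "1 + (\<Sum>a\<in>{1..p - 1}. (\<zeta> ^ j) ^ a) = 0" by simp
    then have "(\<Sum>a\<in>{1..p - 1}. (\<zeta> ^ a) ^ j) = - 1"
      by (simp add: power_mult[symmetric] mult.commute add_eq_0_iff)
    then show ?thesis by simp
  qed
  have "(\<Sum>a\<in>{1..p - 1}. aut a v) = (\<Sum>a\<in>{1..p - 1}. \<Sum>j\<le>degree f. of_int (Polynomial.coeff f j) * (\<zeta> ^ a) ^ j)"
  proof (rule sum.cong)
    fix a assume "a \<in> {1..p - 1}"
    then have "aut a v = ev f (\<zeta> ^ a)" unfolding v by (intro aut_ev cop)
    then show "aut a v = (\<Sum>j\<le>degree f. of_int (Polynomial.coeff f j) * (\<zeta> ^ a) ^ j)"
      by (simp add: poly_altdef coeff_map_poly)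
  qed simp
  also have "\<dots> = (\<Sum>j\<le>degree f. of_int (Polynomial.coeff f j) * (\<Sum>a\<in>{1..p - 1}. (\<zeta> ^ a) ^ j))"
    by (subst sum.swap) (simp add: sum_distrib_left)
  also have "\<dots> \<in> \<int>" by (intro Ints_sum Ints_mult *) auto
  finally show ?thesis .
qed

end

section \<open>The primitive root m and the automorphism \<sigma>\<close>

locale metacyclic = prime_cyclotomic +
  fixes m :: int
  assumes ord_m: "ord p (nat (m mod int p)) = p - 1"
begin

definition m' :: nat where "m' = nat (m mod int p)"
text \<open>The inverse of \<open>m'\<close> modulo \<open>p\<close>, by its order
  \<open>p - 1\<close>; conjugation by it is \<sigma> inverse, the action of
  \<open>y\<close>.\<close>

definition mi :: nat where "mi = m' ^ (p - 2)"

lemma ord_m': "ord p m' = p - 1" using ord_m by (simp add: m'_def)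

lemma coprime_m': "coprime m' p"
  using ord_m' ord_eq_0[of p m'] p_ge_3 by (auto simp: coprime_commute)

lemma coprime_mi: "coprime mi p" using coprime_m' by (simp add: mi_def)

lemma m'_pow: "[m' ^ (p - 1) = 1] (mod p)" using ord[of m' p] by (simp add: ord_m')

lemma m'_mi: "[m' * mi = 1] (mod p)"
proof -
  have "m' * mi = m' ^ Suc (p - 2)" by (simp add: mi_def)
  also have "Suc (p - 2) = p - 1" using p_ge_3 by simp
  finally show ?thesis using m'_pow by simp
qed

lemma aut_m'_mi: "v \<in> \<O> \<Longrightarrow> aut m' (aut mi v) = v" "v \<in> \<O> \<Longrightarrow> aut mi (aut m' v) = v"
  using aut_aut[OF coprime_m' coprime_mi, of v] aut_aut[OF coprime_mi coprime_m', of v]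
    aut_cong[OF m'_mi _ , of v] coprime_m' coprime_mi aut_1[of v] by (auto simp: mult.commute)

lemma m'_powers: "bij_betw (\<lambda>k. m' ^ k mod p) {..<p - 1} {1..p - 1}"
proof -
  have inj: "inj_on (\<lambda>k. m' ^ k mod p) {..<p - 1}"
  proof (rule inj_onI)
    fix j k assume "j \<in> {..<p - 1}" "k \<in> {..<p - 1}" "m' ^ j mod p = m' ^ k mod p"
    then have "[m' ^ j = m' ^ k] (mod p)" by (simp add: cong_def)
    then have "[j = k] (mod (p - 1))"
      using order_divides_expdiff[of p m' j k] coprime_m' by (simp add: ord_m' coprime_commute)
    then show "j = k" using \<open>j \<in> _\<close> \<open>k \<in> _\<close> by (simp add: cong_def)
  qed
  have sub: "(\<lambda>k. m' ^ k mod p) ` {..<p - 1} \<subseteq> {1..p - 1}"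
  proof safe
    fix k
    have "coprime (m' ^ k) p" using coprime_m' by simp
    then have "\<not> p dvd m' ^ k" using prime_p by (metis coprime_absorb_right not_prime_unit)
    then have "m' ^ k mod p \<noteq> 0" by (simp only: mod_eq_0_iff_dvd not_False_eq_True)
    moreover have "m' ^ k mod p < p" using p_ge_3 by simp
    ultimately show "m' ^ k mod p \<in> {1..p - 1}" by auto
  qed
  have "(\<lambda>k. m' ^ k mod p) ` {..<p - 1} = {1..p - 1}"
    by (rule card_subset_eq) (use inj sub in \<open>auto simp: card_image\<close>)
  with inj show ?thesis by (simp add: bij_betw_def)
qed

text \<open>Since \<open>m'\<close> is a primitive root, its powers run through all conjugations.
  Adding up the \<open>p - 1\<close> equations \<open>\<sigma>^k v = v\<close> therefore turns
  \<open>(p - 1) * v\<close> into the trace of \<open>v\<close>.\<close>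

lemma fixed_by_aut:
  assumes v: "v \<in> \<O>" and fixed: "aut m' v = v"
  shows "of_nat (p - 1) * v \<in> \<int>"
proof -
  have pow: "aut (m' ^ k) v = v" for k
  proof (induction k)
    case 0 then show ?case using v aut_1 by simp
  next
    case (Suc k)
    have "aut (m' ^ Suc k) v = aut m' (aut (m' ^ k) v)"
      using aut_aut[OF coprime_m', of "m' ^ k" v] coprime_m' v by simp
    then show ?case using Suc fixed by simp
  qed
  have "of_nat (p - 1) * v = (\<Sum>k<p - 1. v)" by simp
  also have "\<dots> = (\<Sum>k<p - 1. aut (m' ^ k mod p) v)"
  proof (rule sum.cong)
    fix k
    have "aut (m' ^ k) v = aut (m' ^ k mod p) v"
      by (rule aut_cong) (use coprime_m' v in \<open>auto simp: cong_def\<close>)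
    then show "v = aut (m' ^ k mod p) v" using pow by simp
  qed simp
  also have "\<dots> = (\<Sum>a\<in>{1..p - 1}. aut a v)"
    by (rule sum.reindex_bij_betw[OF m'_powers])
  finally show ?thesis using trace_in_Ints[OF v] by simp
qed

lemma zeta_powi_m: "\<zeta> powi m = \<zeta> ^ m'"
proof -
  have "m = int p * (m div int p) + int m'" using p_ge_3 by (simp add: m'_def)
  then have "\<zeta> powi m = \<zeta> powi (int p * (m div int p) + int m')" by simp
  also have "\<dots> = (\<zeta> powi int p) powi (m div int p) * \<zeta> powi int m'"
    by (subst power_int_add) (simp_all add: power_int_mult)
  finally show ?thesis by (simp add: power_int_of_nat)
qed

text \<open>The description in \<open>sigma\<close> requires existence and uniqueness. A competitor
  \<open>b\<close> sends 1 to an idempotent that is non-zero by injectivity, hence fixes 1 and all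
  integers; Horner's induction then determines it from the image of \<zeta>.\<close>

lemma sigma_eq_aut:
  assumes "v \<in> \<O>"
  shows "sigma p m v = aut m' v"
proof -
  define a where "a = restrict (aut m') \<O>"
  have "sigma p m = a"
    unfolding sigma_def
  proof (rule the_equality)
    have "bij_betw a \<O> \<O>"
      unfolding a_def
      by (rule bij_betwI[where g = "aut mi"]) (use aut_m'_mi coprime_m' coprime_mi in auto)
    then show "a \<in> extensional \<O> \<and> bij_betw a \<O> \<O> \<and>
      (\<forall>u\<in>\<O>. \<forall>v\<in>\<O>. a (u + v) = a u + a v \<and> a (u * v) = a u * a v) \<and> a \<zeta> = \<zeta> powi m"
      by (auto simp: a_def aut_add aut_mult coprime_m' aut_zeta zeta_powi_m O_add O_mult)
  next
    fix b
    assume b: "b \<in> extensional \<O> \<and> bij_betw b \<O> \<O> \<and>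
      (\<forall>u\<in>\<O>. \<forall>v\<in>\<O>. b (u + v) = b u + b v \<and> b (u * v) = b u * b v) \<and> b \<zeta> = \<zeta> powi m"
    have b_add: "b (u + v) = b u + b v" and b_mult: "b (u * v) = b u * b v" if "u \<in> \<O>" "v \<in> \<O>" for u v
      using b that by auto
    have b0: "b 0 = 0" using b_add[of 0 0] by simp
    have "b 1 \<noteq> 0"
      using b b0 by (metis O_0 O_1 bij_betw_def inj_onD one_neq_zero)
    then have b1: "b 1 = 1" using b_mult[of 1 1] by simp
    have b_nat: "b (of_nat n) = of_nat n" for n
      by (induction n) (simp_all add: b0 b1 b_add)
    have b_int: "b (of_int n) = of_int n" for n
    proof (cases "n \<ge> 0")
      case True then show ?thesis using b_nat[of "nat n"] by simp
    next
      case False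
      have "b (of_int n + of_nat (nat (- n))) = b (of_int n) + of_nat (nat (- n))"
        by (subst b_add) (simp_all add: b_nat del: of_nat_nat)
      then show ?thesis using False b0 by simp
    qed
    have "b v = aut m' v" if "v \<in> \<O>" for v
      using that
    proof (induction rule: O_induct)
      case zero then show ?case using aut_int[OF coprime_m', of 0] b0 by simp
    next
      case (step c u)
      then show ?case using b zeta_powi_m
        by (simp add: b_add b_mult b_int O_mult aut_add aut_mult coprime_m' aut_int aut_zeta)
    qed
    then show "b = a" using b by (intro extensionalityI[of _ \<O>]) (auto simp: a_def)
  qed
  then show ?thesis using assms by (simp add: a_def)
qed

lemma inv_sigma: assumes "v \<in> \<O>" shows "inv_into \<O> (sigma p m) v = aut mi v"
proof (rule inv_into_f_eq)
  show "inj_on (sigma p m) \<O>"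
    by (rule inj_onI) (metis sigma_eq_aut aut_m'_mi(2))
  show "aut mi v \<in> \<O>" using assms coprime_mi by auto
  then show "sigma p m (aut mi v) = v" using assms by (simp add: sigma_eq_aut aut_m'_mi)
qed

subsection \<open>The action of the group ring\<close>

abbreviation letter where "letter \<equiv> letter_act p m"

lemma letter_I: assumes "v \<in> I i" shows "letter l v \<in> I i"
proof -
  have "v \<in> \<O>" using assms I_subset_O by blast
  moreover have "v / \<zeta> \<in> I i" using assms O_div_zeta[of 1] I_mult[of v i "1 / \<zeta>"] by simp
  ultimately show ?thesis
    using assms coprime_m' coprime_mi
    by (cases "(p, m, l, v)" rule: letter_act.cases)
      (auto simp: inv_sigma sigma_eq_aut intro: I_mult)
qed

lemma letter_O [intro]: "v \<in> \<O> \<Longrightarrow> letter l v \<in> \<O>"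
  using letter_I[of v 0] by simp

lemma letter_add: assumes "u \<in> \<O>" "v \<in> \<O>" shows "letter l (u + v) = letter l u + letter l v"
proof (cases l)
  case (Pair s b)
  then show ?thesis using assms coprime_m' coprime_mi
    by (cases s; cases b)
      (simp_all add: inv_sigma sigma_eq_aut O_add aut_add add_divide_distrib distrib_right)
qed

lemma letter_cancel: assumes "v \<in> \<O>" shows "letter (s, \<not> b) (letter (s, b) v) = v"
proof -
  have "aut m' v \<in> \<O>" "aut mi v \<in> \<O>" using assms coprime_m' coprime_mi by auto
  then show ?thesis
    using assms by (cases s; cases b) (simp_all add: inv_sigma sigma_eq_aut aut_m'_mi)
qed

section \<open>Words and group elements as operators on \<int>[\<zeta>]\<close>

abbreviation wact where "wact \<equiv> word_act p m"

lemma wact_Nil [simp]: "wact v [] = v" and wact_Cons [simp]: "wact v (l # w) = wact (letter l v) w"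
  by (simp_all add: word_act_def)

lemma wact_append: "wact v (u @ w) = wact (wact v u) w"
  by (simp add: word_act_def)

lemma wact_I: "v \<in> I i \<Longrightarrow> wact v w \<in> I i"
  by (induction w arbitrary: v) (auto intro: letter_I)

lemma wact_O [intro]: "v \<in> \<O> \<Longrightarrow> wact v w \<in> \<O>"
  using wact_I[of v 0] by simp

lemma wact_add: "u \<in> \<O> \<Longrightarrow> v \<in> \<O> \<Longrightarrow> wact (u + v) w = wact u w + wact v w"
  by (induction w arbitrary: u v) (auto simp: letter_add letter_O)

lemma wact_zero: "wact 0 w = 0"
  using wact_add[of 0 0 w] by simp

lemma wact_sum: "(\<And>x. x \<in> A \<Longrightarrow> f x \<in> \<O>) \<Longrightarrow> wact (sum f A) w = (\<Sum>x\<in>A. wact (f x) w)"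
  by (induction A rule: infinite_finite_induct) (auto simp: wact_add wact_zero O_sum)

lemma wact_nat: "v \<in> \<O> \<Longrightarrow> wact (of_nat n * v) w = of_nat n * wact v w"
  by (induction n) (simp_all add: wact_zero wact_add distrib_right O_mult)

lemma wact_int: assumes "v \<in> \<O>" shows "wact (of_int n * v) w = of_int n * wact v w"
proof (cases "n \<ge> 0")
  case True
  then show ?thesis using wact_nat[of v "nat n" w] assms by simp
next
  case False
  have "wact (of_int n * v + of_nat (nat (- n)) * v) w = wact (of_int n * v) w + of_nat (nat (- n)) * wact v w"
    using assms by (simp add: wact_add wact_nat O_mult del: of_nat_nat)
  then show ?thesis using False wact_zero by simp
qed

lemma wact_x: "wact v (replicate k (Gen_x, True)) = v * \<zeta> ^ k"
  "wact v (replicate k (Gen_x, False)) = v / \<zeta> ^ k"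
  by (induction k arbitrary: v) simp_all

lemma wact_y: "v \<in> \<O> \<Longrightarrow> wact v (replicate k (Gen_y, True)) = aut (mi ^ k) v"
proof (induction k arbitrary: v)
  case 0 then show ?case by (simp add: aut_1[simplified])
next
  case (Suc k)
  have "aut mi v \<in> \<O>" using Suc coprime_mi by auto
  then show ?case using Suc coprime_mi
    by (simp add: inv_sigma aut_aut mult.commute)
qed

lemma mi_pow: "[mi ^ (p - 1) = 1] (mod p)"
proof -
  have "[(m' ^ (p - 1)) ^ (p - 2) = 1 ^ (p - 2)] (mod p)" by (intro cong_pow m'_pow)
  then show ?thesis by (simp add: mi_def flip: power_mult) (simp add: mult.commute)
qed

text \<open>This makes the action of the group well defined. The relations for \<open>x\<close> and
  \<open>y\<close> alone express \<open>\<zeta>^p = 1\<close> and \<open>mi^(p-1) = 1\<close> modulo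
  \<open>p\<close>. The mixed one, read from left to right, says that multiplying by
  \<open>\<zeta>^m\<close> before \<sigma> inverse equals multiplying by \<zeta> after it, which is
  why \<open>y\<close> acts by the inverse of \<sigma>.\<close>

lemma wact_word_eq:
  "word_eq (G_rels p m) u w \<Longrightarrow> v \<in> \<O> \<Longrightarrow> wact v u = wact v w"
proof (induction arbitrary: v rule: word_eq.induct)
  case (word_eq_append u u' w w')
  then show ?case by (simp add: wact_append wact_O)
next
  case (word_eq_cancel s b)
  then show ?case using letter_cancel by simp
next
  case (word_eq_rel u w)
  then consider "u = replicate p (Gen_x, True)" "w = []"
    | "u = replicate (p - 1) (Gen_y, True)" "w = []"
    | "u = [(Gen_y, True), (Gen_x, True)]" "w = power_word Gen_x m @ [(Gen_y, True)]"
    by (auto simp: G_rels_def power_word_def)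
  then show ?case
  proof cases
    case 1
    then show ?thesis by (simp add: wact_x)
  next
    case 2
    have "aut (mi ^ (p - 1)) v = aut 1 v"
      using word_eq_rel mi_pow coprime_mi by (intro aut_cong) auto
    then show ?thesis using 2 word_eq_rel aut_1[of v] by (simp add: wact_y)
  next
    case 3
    have "wact v (power_word Gen_x m) = v * \<zeta> powi m"
      by (cases "m \<ge> 0")
        (simp_all add: power_word_def wact_x power_int_def field_simps)
    then have *: "wact v (power_word Gen_x m) = v * \<zeta> ^ m'" by (simp add: zeta_powi_m)
    have "aut mi (\<zeta> ^ m') = \<zeta> ^ (mi * m')"
      by (simp add: aut_power aut_zeta coprime_mi power_mult)
    also have "\<dots> = \<zeta> ^ 1" using m'_mi by (intro zeta_pow_cong) (simp add: mult.commute)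
    finally have "aut mi (v * \<zeta> ^ m') = aut mi v * \<zeta>"
      using word_eq_rel by (simp add: aut_mult coprime_mi O_power)
    then show ?thesis using 3 * word_eq_rel
      by (simp add: wact_append inv_sigma O_mult O_power)
  qed
qed auto

definition cls :: "gen word \<Rightarrow> gen word set" where "cls w = {v. word_eq (G_rels p m) w v}"

lemma carrier_G: "carrier (G_grp p m) = range cls"
  by (auto simp: G_grp_def presented_group_def quotient_def cls_def Image_def)

lemma one_G: "\<one>\<^bsub>G_grp p m\<^esub> = cls []"
  by (simp add: G_grp_def presented_group_def cls_def)

lemma mult_G: "cls u \<otimes>\<^bsub>G_grp p m\<^esub> cls w = cls (u @ w)"
  unfolding G_grp_def presented_group_def cls_def
  by (auto intro: word_eq_append word_eq_trans word_eq_refl)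

abbreviation gact where "gact \<equiv> group_act p m"

lemma gact_cls: assumes "v \<in> \<O>" shows "gact v (cls w) = wact v w"
proof -
  have "wact v ` cls w = {wact v w}"
    using wact_word_eq assms by (force simp: cls_def intro: word_eq_refl)
  then show ?thesis by (simp add: group_act_def)
qed

lemma gact_mult:
  "v \<in> \<O> \<Longrightarrow> g \<in> carrier (G_grp p m) \<Longrightarrow> h \<in> carrier (G_grp p m) \<Longrightarrow>
    gact v (g \<otimes>\<^bsub>G_grp p m\<^esub> h) = gact (gact v g) h"
  by (auto simp: carrier_G mult_G gact_cls wact_append wact_O)

section \<open>The exponent of y and the map onto the cyclic quotient\<close>

fun yexp :: "gen word \<Rightarrow> int" where
  "yexp [] = 0"
| "yexp ((Gen_x, b) # w) = yexp w"
| "yexp ((Gen_y, b) # w) = (if b then 1 else - 1) + yexp w"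

abbreviation gen_eps :: "gen \<Rightarrow> int" where "gen_eps \<equiv> \<lambda>s. case s of Gen_x \<Rightarrow> 0 | Gen_y \<Rightarrow> 1"

lemma eval_word_yexp: "eval_word (integer_mod_group (p - 1)) gen_eps w = yexp w mod int (p - 1)"
proof -
  have "p - 1 \<noteq> 1" "p - 1 > 0" using p_ge_3 by auto
  then show ?thesis
    by (induction w rule: yexp.induct) (simp_all add: mod_simps del: of_nat_diff)
qed

lemma yexp_append: "yexp (u @ w) = yexp u + yexp w"
  by (induction u rule: yexp.induct) auto

lemma yexp_replicate: "yexp (replicate k (Gen_x, b)) = 0" "yexp (replicate k (Gen_y, True)) = int k"
  by (induction k) auto

text \<open>The mixed relation has a single \<open>y\<close> on either side, and the relation
  \<open>y^(p-1) = 1\<close> changes the exponent sum by \<open>p - 1\<close>.\<close>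

lemma yexp_word_eq:
  "word_eq (G_rels p m) u w \<Longrightarrow> yexp u mod int (p - 1) = yexp w mod int (p - 1)"
proof (induction rule: word_eq.induct)
  case (word_eq_append u u' v v')
  then show ?case unfolding yexp_append by (intro mod_add_cong)
next
  case (word_eq_cancel s b)
  then show ?case by (cases s) auto
next
  case (word_eq_rel u v)
  then show ?case by (auto simp: G_rels_def power_word_def yexp_append yexp_replicate)
qed auto

definition geps :: "gen word set \<Rightarrow> int" where
  "geps = presented_hom (integer_mod_group (p - 1)) gen_eps"

lemma geps_cls: "geps (cls w) = yexp w mod int (p - 1)"
proof -
  have "eval_word (integer_mod_group (p - 1)) gen_eps ` cls w = {yexp w mod int (p - 1)}"
  proof safe
    fix u assume "u \<in> cls w"
    then show "eval_word (integer_mod_group (p - 1)) gen_eps u = yexp w mod int (p - 1)"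
      using yexp_word_eq[of w u] by (simp add: cls_def eval_word_yexp del: One_nat_def)
  next
    have "w \<in> cls w" by (simp add: cls_def word_eq_refl)
    then show "yexp w mod int (p - 1) \<in> eval_word (integer_mod_group (p - 1)) gen_eps ` cls w"
      using eval_word_yexp[of w] by (metis imageI)
  qed
  then show ?thesis by (simp add: geps_def presented_hom_def)
qed

section \<open>The group ring as a ring of operators on \<int>[\<zeta>]\<close>

abbreviation \<Lambda> where "\<Lambda> \<equiv> Lam p m"
abbreviation lact where "lact \<equiv> Lam_act p m"

lemma carrier_Lam: "a \<in> carrier \<Lambda> \<longleftrightarrow> finite {g. a g \<noteq> 0} \<and> {g. a g \<noteq> 0} \<subseteq> carrier (G_grp p m)"
  by (simp add: Lam_def int_group_ring_def)

lemma add_Lam: "a \<oplus>\<^bsub>\<Lambda>\<^esub> b = (\<lambda>k. a k + b k)"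
  and one_Lam: "\<one>\<^bsub>\<Lambda>\<^esub> = (\<lambda>k. if k = cls [] then 1 else 0)"
  and mult_Lam: "a \<otimes>\<^bsub>\<Lambda>\<^esub> b = (\<lambda>k. \<Sum>(g, h) \<in> {(g, h). a g \<noteq> 0 \<and> b h \<noteq> 0 \<and> g \<otimes>\<^bsub>G_grp p m\<^esub> h = k}. a g * b h)"
  by (simp_all add: Lam_def int_group_ring_def one_G)

lemma gact_I: "v \<in> I i \<Longrightarrow> g \<in> carrier (G_grp p m) \<Longrightarrow> gact v g \<in> I i"
  using subsetD[OF I_subset_O] wact_I by (auto simp: carrier_G gact_cls)

lemma gact_add: "u \<in> \<O> \<Longrightarrow> v \<in> \<O> \<Longrightarrow> g \<in> carrier (G_grp p m) \<Longrightarrow> gact (u + v) g = gact u g + gact v g"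
  by (auto simp: carrier_G gact_cls O_add wact_add)

lemma gact_int: "v \<in> \<O> \<Longrightarrow> g \<in> carrier (G_grp p m) \<Longrightarrow> gact (of_int n * v) g = of_int n * gact v g"
  by (auto simp: carrier_G gact_cls O_mult wact_int)

lemma gact_sum: "(\<And>x. x \<in> A \<Longrightarrow> f x \<in> \<O>) \<Longrightarrow> g \<in> carrier (G_grp p m) \<Longrightarrow> gact (sum f A) g = (\<Sum>x\<in>A. gact (f x) g)"
  by (auto simp: carrier_G gact_cls O_sum wact_sum)

lemma lact_I: "v \<in> I i \<Longrightarrow> a \<in> carrier \<Lambda> \<Longrightarrow> lact v a \<in> I i"
  unfolding Lam_act_def by (intro I_sum I_mult' gact_I) (auto simp: carrier_Lam)

lemma lact_add_left: "u \<in> \<O> \<Longrightarrow> v \<in> \<O> \<Longrightarrow> a \<in> carrier \<Lambda> \<Longrightarrow> lact (u + v) a = lact u a + lact v a"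
  unfolding Lam_act_def sum.distrib[symmetric]
  by (rule sum.cong) (auto simp: carrier_Lam gact_add distrib_left)

lemma lact_int: "v \<in> \<O> \<Longrightarrow> a \<in> carrier \<Lambda> \<Longrightarrow> lact (of_int n * v) a = of_int n * lact v a"
  unfolding Lam_act_def sum_distrib_left
  by (rule sum.cong) (auto simp: carrier_Lam gact_int subset_iff mult.left_commute)

lemma lact_zero: "a \<in> carrier \<Lambda> \<Longrightarrow> lact 0 a = 0"
  using lact_add_left[of 0 0 a] by simp

lemma lact_sum: "(\<And>x. x \<in> A \<Longrightarrow> f x \<in> \<O>) \<Longrightarrow> a \<in> carrier \<Lambda> \<Longrightarrow> lact (sum f A) a = (\<Sum>x\<in>A. lact (f x) a)"
  by (induction A rule: infinite_finite_induct) (auto simp: lact_add_left lact_zero O_sum)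

lemma lact_superset:
  assumes "finite S" "{g. a g \<noteq> 0} \<subseteq> S"
  shows "lact v a = (\<Sum>g\<in>S. of_int (a g) * gact v g)"
  unfolding Lam_act_def using assms by (intro sum.mono_neutral_left) auto

lemma lact_add_right:
  assumes "a \<in> carrier \<Lambda>" "b \<in> carrier \<Lambda>"
  shows "lact v (a \<oplus>\<^bsub>\<Lambda>\<^esub> b) = lact v a + lact v b"
proof -
  define S where "S = {g. a g \<noteq> 0} \<union> {g. b g \<noteq> 0}"
  have S: "finite S" using assms by (auto simp: S_def carrier_Lam)
  have "lact v (a \<oplus>\<^bsub>\<Lambda>\<^esub> b) = (\<Sum>g\<in>S. of_int (a g + b g) * gact v g)"
    unfolding add_Lam by (rule lact_superset) (use S in \<open>auto simp: S_def\<close>)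
  also have "\<dots> = (\<Sum>g\<in>S. of_int (a g) * gact v g) + (\<Sum>g\<in>S. of_int (b g) * gact v g)"
    by (simp add: distrib_right sum.distrib)
  also have "(\<Sum>g\<in>S. of_int (a g) * gact v g) = lact v a"
    by (rule lact_superset[symmetric]) (use S in \<open>auto simp: S_def\<close>)
  also have "(\<Sum>g\<in>S. of_int (b g) * gact v g) = lact v b"
    by (rule lact_superset[symmetric]) (use S in \<open>auto simp: S_def\<close>)
  finally show ?thesis .
qed

text \<open>The convolution product collects the pairs \<open>(g, h)\<close> by their product.
  Undoing this grouping gives a double sum over the two supports, in which \<open>g\<close> acts
  before \<open>h\<close>.\<close>

lemma lact_mult:
  assumes v: "v \<in> \<O>" and a: "a \<in> carrier \<Lambda>" and b: "b \<in> carrier \<Lambda>"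
  shows "lact v (a \<otimes>\<^bsub>\<Lambda>\<^esub> b) = lact (lact v a) b"
proof -
  let ?A = "{g. a g \<noteq> 0}" and ?B = "{h. b h \<noteq> 0}" and ?m = "\<lambda>(g, h). g \<otimes>\<^bsub>G_grp p m\<^esub> h"
  have A: "finite ?A" "?A \<subseteq> carrier (G_grp p m)" and B: "finite ?B" "?B \<subseteq> carrier (G_grp p m)"
    using a b by (auto simp: carrier_Lam)
  define S where "S = ?A \<times> ?B"
  have S: "finite S" using A B by (simp add: S_def)
  have mult: "(a \<otimes>\<^bsub>\<Lambda>\<^esub> b) k = (\<Sum>x | x \<in> S \<and> ?m x = k. a (fst x) * b (snd x))" for k
    unfolding mult_Lam by (rule sum.cong) (auto simp: S_def)
  have "lact v (a \<otimes>\<^bsub>\<Lambda>\<^esub> b) = (\<Sum>k\<in>?m ` S. of_int ((a \<otimes>\<^bsub>\<Lambda>\<^esub> b) k) * gact v k)"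
  proof (rule lact_superset)
    show "finite (?m ` S)" using S by simp
    show "{k. (a \<otimes>\<^bsub>\<Lambda>\<^esub> b) k \<noteq> 0} \<subseteq> ?m ` S"
    proof
      fix k assume "k \<in> {k. (a \<otimes>\<^bsub>\<Lambda>\<^esub> b) k \<noteq> 0}"
      then have "{x. x \<in> S \<and> ?m x = k} \<noteq> {}" unfolding mult by force
      then show "k \<in> ?m ` S" by force
    qed
  qed
  also have "\<dots> = (\<Sum>k\<in>?m ` S. \<Sum>x | x \<in> S \<and> ?m x = k. of_int (a (fst x) * b (snd x)) * gact v (?m x))"
    unfolding mult of_int_sum sum_distrib_right by (intro sum.cong) auto
  also have "\<dots> = (\<Sum>x\<in>S. of_int (a (fst x) * b (snd x)) * gact v (?m x))"
    by (rule sum.group) (use S in auto)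
  also have "\<dots> = (\<Sum>(g, h)\<in>?A \<times> ?B. of_int (b h) * (of_int (a g) * gact (gact v g) h))"
    unfolding S_def using A B v by (intro sum.cong) (auto simp: gact_mult mult_ac subset_iff)
  also have "\<dots> = (\<Sum>g\<in>?A. \<Sum>h\<in>?B. of_int (b h) * (of_int (a g) * gact (gact v g) h))"
    by (rule sum.cartesian_product[symmetric])
  also have "\<dots> = (\<Sum>h\<in>?B. \<Sum>g\<in>?A. of_int (b h) * (of_int (a g) * gact (gact v g) h))"
    by (rule sum.swap)
  also have "\<dots> = (\<Sum>h\<in>?B. of_int (b h) * gact (\<Sum>g\<in>?A. of_int (a g) * gact v g) h)"
  proof (rule sum.cong)
    fix h assume "h \<in> ?B"
    then have h: "h \<in> carrier (G_grp p m)" using B by auto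
    have gO: "gact v g \<in> \<O>" if "g \<in> ?A" for g using gact_I[of v 0 g] v A that by auto
    have "gact (\<Sum>g\<in>?A. of_int (a g) * gact v g) h = (\<Sum>g\<in>?A. of_int (a g) * gact (gact v g) h)"
      using gO h by (subst gact_sum) (auto intro!: O_mult simp: gact_int)
    then show "(\<Sum>g\<in>?A. of_int (b h) * (of_int (a g) * gact (gact v g) h))
        = of_int (b h) * gact (\<Sum>g\<in>?A. of_int (a g) * gact v g) h"
      by (simp add: sum_distrib_left)
  qed simp
  also have "\<dots> = lact (lact v a) b" by (simp add: Lam_act_def)
  finally show ?thesis .
qed

definition delta :: "gen word \<Rightarrow> gen word set \<Rightarrow> int" where
  "delta w = (\<lambda>g. if g = cls w then 1 else 0)"

lemma delta_carrier [simp]: "delta w \<in> carrier \<Lambda>"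
  by (auto simp: carrier_Lam delta_def carrier_G)

lemma lact_delta: "v \<in> \<O> \<Longrightarrow> lact v (delta w) = wact v w"
  by (simp add: Lam_act_def delta_def gact_cls)

lemma lact_one: "v \<in> \<O> \<Longrightarrow> lact v \<one>\<^bsub>\<Lambda>\<^esub> = v"
  using lact_delta[of v "[]"] by (simp add: one_Lam delta_def)

text \<open>By exactness \<open>x - 1\<close> then has a preimage under any choice of \<iota>; this
  gives access to a map that is otherwise unknown.\<close>

lemma eps_x_minus_1: "eps p (\<lambda>g. delta [(Gen_x, True)] g - delta [] g) = (\<lambda>_. 0)"
proof
  fix k
  let ?d = "\<lambda>g. delta [(Gen_x, True)] g - delta [] g"
  have "eps p ?d k = (\<Sum>g | ?d g \<noteq> 0 \<and> geps g = k. ?d g)"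
    by (simp add: eps_def geps_def group_ring_map_def)
  also have "\<dots> = (\<Sum>g | g \<in> {cls [(Gen_x, True)], cls []} \<and> geps g = k. ?d g)"
    by (rule sum.mono_neutral_left) (auto simp: delta_def)
  also have "\<dots> = 0"
  proof (cases "k = 0")
    case True
    then have "{g. g \<in> {cls [(Gen_x, True)], cls []} \<and> geps g = k} = {cls [(Gen_x, True)], cls []}"
      by (auto simp: geps_cls)
    then show ?thesis
      by (cases "cls [(Gen_x, True)] = cls []") (auto simp: delta_def)
  next
    case False
    then have "{g. g \<in> {cls [(Gen_x, True)], cls []} \<and> geps g = k} = {}"
      by (auto simp: geps_cls)
    then show ?thesis by (simp only: sum.empty)
  qed
  finally show "eps p ?d k = 0" .
qed

end

subsection \<open>Right modules and pushouts\<close>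

lemma rmod_homD:
  assumes "f \<in> rmod_hom R M N"
  shows "v \<in> carrier M \<Longrightarrow> f v \<in> carrier N"
    and "v \<in> carrier M \<Longrightarrow> w \<in> carrier M \<Longrightarrow> f (v \<oplus>\<^bsub>M\<^esub> w) = f v \<oplus>\<^bsub>N\<^esub> f w"
    and "v \<in> carrier M \<Longrightarrow> a \<in> carrier R \<Longrightarrow> f (v \<cdot>\<^bsub>M\<^esub> a) = f v \<cdot>\<^bsub>N\<^esub> a"
  using assms by (auto simp: rmod_hom_def)

lemma rmod_homI:
  assumes "\<And>v. v \<in> carrier M \<Longrightarrow> f v \<in> carrier N"
    and "\<And>v w. v \<in> carrier M \<Longrightarrow> w \<in> carrier M \<Longrightarrow> f (v \<oplus>\<^bsub>M\<^esub> w) = f v \<oplus>\<^bsub>N\<^esub> f w"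
    and "\<And>v a. v \<in> carrier M \<Longrightarrow> a \<in> carrier R \<Longrightarrow> f (v \<cdot>\<^bsub>M\<^esub> a) = f v \<cdot>\<^bsub>N\<^esub> a"
  shows "f \<in> rmod_hom R M N"
  using assms by (auto simp: rmod_hom_def)

lemma rmod_hom_compose:
  assumes "f \<in> rmod_hom R M N" "g \<in> rmod_hom R N L"
  shows "(\<lambda>v. g (f v)) \<in> rmod_hom R M L"
  by (rule rmod_homI) (simp_all add: rmod_homD[OF assms(1)] rmod_homD[OF assms(2)])

lemma (in abelian_group) add_idem_zero:
  assumes "x \<in> carrier G" "x \<oplus> x = x" shows "x = \<zero>"
proof -
  have "x = (\<ominus> x \<oplus> x) \<oplus> x" using assms(1) by (simp add: l_neg)
  also have "\<dots> = \<ominus> x \<oplus> (x \<oplus> x)" using assms(1) by (intro a_assoc) auto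
  also have "\<dots> = \<zero>" unfolding assms(2) using assms(1) by (rule l_neg)
  finally show ?thesis .
qed

lemma (in right_module) zero_ract: "a \<in> carrier R \<Longrightarrow> \<zero>\<^bsub>M\<^esub> \<cdot>\<^bsub>M\<^esub> a = \<zero>\<^bsub>M\<^esub>"
  using ract_add_left[of "\<zero>\<^bsub>M\<^esub>" "\<zero>\<^bsub>M\<^esub>" a] ract_closed[of "\<zero>\<^bsub>M\<^esub>" a]
  by (intro M.add_idem_zero) simp_all

lemma rmod_hom_zero:
  assumes "abelian_group M" "abelian_group N" "f \<in> rmod_hom R M N"
  shows "f \<zero>\<^bsub>M\<^esub> = \<zero>\<^bsub>N\<^esub>"
proof -
  interpret M: abelian_group M by fact
  interpret N: abelian_group N by fact
  have "f \<zero>\<^bsub>M\<^esub> \<oplus>\<^bsub>N\<^esub> f \<zero>\<^bsub>M\<^esub> = f \<zero>\<^bsub>M\<^esub>"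
    using rmod_homD(2)[OF assms(3), of "\<zero>\<^bsub>M\<^esub>" "\<zero>\<^bsub>M\<^esub>"] by simp
  then show ?thesis using rmod_homD(1)[OF assms(3)] by (intro N.add_idem_zero) simp_all
qed

lemma rmod_hom_uminus:
  assumes "abelian_group M" "abelian_group N" "f \<in> rmod_hom R M N" "v \<in> carrier M"
  shows "f (\<ominus>\<^bsub>M\<^esub> v) = \<ominus>\<^bsub>N\<^esub> f v"
proof -
  interpret M: abelian_group M by fact
  interpret N: abelian_group N by fact
  have "f (\<ominus>\<^bsub>M\<^esub> v) \<oplus>\<^bsub>N\<^esub> f v = \<zero>\<^bsub>N\<^esub>"
    using rmod_homD(2)[OF assms(3), of "\<ominus>\<^bsub>M\<^esub> v" v] assms(4) rmod_hom_zero[OF assms(1-3)]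
    by (simp add: M.l_neg)
  then show ?thesis using rmod_homD(1)[OF assms(3)] assms(4) by (simp add: N.minus_equality)
qed

lemma regular_rmod_sel [simp]:
  "carrier (regular_rmod R) = carrier R" "add (regular_rmod R) = add R"
  "zero (regular_rmod R) = zero R" "ract (regular_rmod R) = monoid.mult R"
  by (simp_all add: regular_rmod_def restrict_rmod_def)

lemma right_module_regular: assumes "ring R" shows "right_module R (regular_rmod R)"
proof -
  interpret ring R by fact
  have "abelian_group (regular_rmod R)"
  proof (rule abelian_groupI)
    fix x assume "x \<in> carrier (regular_rmod R)"
    then show "\<exists>y\<in>carrier (regular_rmod R). y \<oplus>\<^bsub>regular_rmod R\<^esub> x = \<zero>\<^bsub>regular_rmod R\<^esub>"
      by (intro bexI[of _ "\<ominus>\<^bsub>R\<^esub> x"]) (auto simp: l_neg)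
  qed (auto simp: a_ac)
  then interpret L: abelian_group "regular_rmod R" .
  show ?thesis
    by unfold_locales (auto simp: l_distr r_distr m_assoc)
qed

lemma right_module_dsum:
  assumes "ring R" and M: "\<And>i. i \<in> I \<Longrightarrow> right_module R (M i)"
  shows "right_module R (dsum_rmod I M)"
proof -
  interpret ring R by fact
  have ag: "abelian_group (M i)" if "i \<in> I" for i
    using M[OF that] by (simp add: right_module_def)
  have "abelian_group (dsum_rmod I M)"
  proof (rule abelian_groupI)
    fix x assume "x \<in> carrier (dsum_rmod I M)"
    then show "\<exists>y\<in>carrier (dsum_rmod I M). y \<oplus>\<^bsub>dsum_rmod I M\<^esub> x = \<zero>\<^bsub>dsum_rmod I M\<^esub>"
      using ag
      by (intro bexI[of _ "\<lambda>i\<in>I. \<ominus>\<^bsub>M i\<^esub> x i"])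
        (auto simp: dsum_rmod_def PiE_iff abelian_group.l_neg intro!: restrict_ext abelian_group.a_inv_closed)
  qed (use ag in \<open>auto simp: dsum_rmod_def PiE_iff extensional_def fun_eq_iff
        intro!: abelian_monoid.a_closed abelian_monoid.a_assoc abelian_monoid.a_comm
          abelian_monoid.zero_closed abelian_monoid.l_zero abelian_group.axioms(1)\<close>)
  then interpret L: abelian_group "dsum_rmod I M" .
  show ?thesis
    by unfold_locales
      (use M in \<open>auto simp: dsum_rmod_def PiE_iff extensional_def fun_eq_iff
        intro!: right_module.ract_closed right_module.ract_add_left right_module.ract_add_right
          right_module.ract_mult right_module.ract_one\<close>)
qed

lemma dsum_inj_hom:
  assumes "\<And>i. i \<in> I \<Longrightarrow> right_module R (M i)" and "j \<in> I"
  shows "dsum_inj I M j \<in> rmod_hom R (M j) (dsum_rmod I M)"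
proof (rule rmod_homI)
  have ag: "abelian_group (M i)" if "i \<in> I" for i
    using assms(1)[OF that] by (simp add: right_module_def)
  then have am: "abelian_monoid (M i)" if "i \<in> I" for i
    using that abelian_group.axioms(1) by blast
  fix v w assume v: "v \<in> carrier (M j)" and w: "w \<in> carrier (M j)"
  show "dsum_inj I M j v \<in> carrier (dsum_rmod I M)"
    using v am assms by (auto simp: dsum_inj_def dsum_rmod_def abelian_monoid.zero_closed)
  show "dsum_inj I M j (v \<oplus>\<^bsub>M j\<^esub> w) = dsum_inj I M j v \<oplus>\<^bsub>dsum_rmod I M\<^esub> dsum_inj I M j w"
    using am by (auto simp: dsum_inj_def dsum_rmod_def fun_eq_iff abelian_monoid.l_zero abelian_monoid.zero_closed)
next
  fix v a assume v: "v \<in> carrier (M j)" and a: "a \<in> carrier R"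
  have "\<zero>\<^bsub>M i\<^esub> \<cdot>\<^bsub>M i\<^esub> a = \<zero>\<^bsub>M i\<^esub>" if "i \<in> I" for i
  proof -
    interpret right_module R "M i" using assms that by blast
    show ?thesis using a by (rule zero_ract)
  qed
  then show "dsum_inj I M j (v \<cdot>\<^bsub>M j\<^esub> a) = dsum_inj I M j v \<cdot>\<^bsub>dsum_rmod I M\<^esub> a"
    by (auto simp: dsum_inj_def dsum_rmod_def fun_eq_iff)
qed

lemma a_rcos_self_mem: assumes "abelian_subgroup J L" "x \<in> carrier L" shows "x \<in> J +>\<^bsub>L\<^esub> x"
proof -
  interpret abelian_subgroup J L by fact
  show ?thesis using a_rcos_self assms by simp
qed

text \<open>The isomorphism is induced by \<open>(b, l) \<mapsto> \<iota> (s (b + g l)) + l\<close>.\<close>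

lemma pushout_isomorphic_quotient:
  assumes RM: "right_module R K" "right_module R L" "right_module R A" "right_module R B" "abelian_group C"
    and exL: "short_exact R A \<iota> L \<epsilon> C"
    and exK: "short_exact R B \<alpha> K \<beta> C"
    and cong: "congruent_ext R B \<alpha> K \<beta>
      (pushout_in A \<iota> L f B) (pushout_rmod A \<iota> L f B) (pushout_out \<epsilon>)"
    and f: "f \<in> rmod_hom R A B" and f': "f' \<in> rmod_hom R A B" and s: "s \<in> rmod_hom R B A"
    and g: "g \<in> rmod_hom R L B"
    and f_eq: "\<And>a. a \<in> carrier A \<Longrightarrow> f a = f' a \<oplus>\<^bsub>B\<^esub> g (\<iota> a)"
    and split: "\<And>b. b \<in> carrier B \<Longrightarrow> f' (s b) = b"
  shows "rmod_isomorphic R K (quot_rmod L (\<iota> ` {a \<in> carrier A. f' a = \<zero>\<^bsub>B\<^esub>}))"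
proof -
  interpret K: right_module R K by fact
  interpret L: right_module R L by fact
  interpret A: right_module R A by fact
  interpret B: right_module R B by fact
  interpret C: abelian_group C by fact
  note ag = K.M.abelian_group_axioms L.M.abelian_group_axioms A.M.abelian_group_axioms
    B.M.abelian_group_axioms C.abelian_group_axioms
  from exL have \<iota>: "\<iota> \<in> rmod_hom R A L" and \<epsilon>: "\<epsilon> \<in> rmod_hom R L C" and inj: "inj_on \<iota> (carrier A)"
    and ker: "\<iota> ` carrier A = {l \<in> carrier L. \<epsilon> l = \<zero>\<^bsub>C\<^esub>}"
    by (auto simp: short_exact_def)
  from exK have \<alpha>: "\<alpha> \<in> rmod_hom R B K" and \<beta>: "\<beta> \<in> rmod_hom R K C"
    and kerK: "\<alpha> ` carrier B = {k \<in> carrier K. \<beta> k = \<zero>\<^bsub>C\<^esub>}" and surK: "\<beta> ` carrier K = carrier C"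
    by (auto simp: short_exact_def)
  note hom = rmod_homD[OF \<iota>] rmod_homD[OF \<epsilon>] rmod_homD[OF \<alpha>] rmod_homD[OF \<beta>]
    rmod_homD[OF f] rmod_homD[OF f'] rmod_homD[OF s] rmod_homD[OF g]
  note hom0 = rmod_hom_zero[OF ag(3,2) \<iota>] rmod_hom_zero[OF ag(2,5) \<epsilon>] rmod_hom_zero[OF ag(4,1) \<alpha>]
    rmod_hom_zero[OF ag(3,4) f'] rmod_hom_zero[OF ag(4,3) s] rmod_hom_zero[OF ag(2,4) g]
    rmod_hom_zero[OF ag(3,4) f]
  have \<epsilon>\<iota>: "\<epsilon> (\<iota> a) = \<zero>\<^bsub>C\<^esub>" if "a \<in> carrier A" for a using ker that by blast
  define J where "J = \<iota> ` {a \<in> carrier A. f' a = \<zero>\<^bsub>B\<^esub>}"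
  define P where "P = pushout_rel A \<iota> L f"
  let ?BL = "prod_rmod B L"
  define \<theta> where "\<theta> = (\<lambda>x. \<iota> (s (fst x \<oplus>\<^bsub>B\<^esub> g (snd x))) \<oplus>\<^bsub>L\<^esub> snd x)"

  have JI: "\<iota> a \<in> J" if "a \<in> carrier A" "f' a = \<zero>\<^bsub>B\<^esub>" for a using that by (auto simp: J_def)
  have JL: "J \<subseteq> carrier L" by (auto simp: J_def hom)
  have "subgroup J (add_monoid L)"
  proof (rule group.subgroupI[OF L.M.a_group], goal_cases)
    case 1 then show ?case using JL by simp
  next
    case 2 then show ?case using JI[of "\<zero>\<^bsub>A\<^esub>"] hom0 by auto
  next
    case (3 x)
    then obtain a where a: "a \<in> carrier A" "f' a = \<zero>\<^bsub>B\<^esub>" "x = \<iota> a" by (auto simp: J_def)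
    have "\<ominus>\<^bsub>L\<^esub> x = \<iota> (\<ominus>\<^bsub>A\<^esub> a)" using rmod_hom_uminus[OF ag(3,2) \<iota>] a by simp
    moreover have "f' (\<ominus>\<^bsub>A\<^esub> a) = \<zero>\<^bsub>B\<^esub>" using rmod_hom_uminus[OF ag(3,4) f'] a by simp
    ultimately show ?case using JI[of "\<ominus>\<^bsub>A\<^esub> a"] a by (simp add: a_inv_def)
  next
    case (4 x y)
    then obtain a b where "a \<in> carrier A" "f' a = \<zero>\<^bsub>B\<^esub>" "x = \<iota> a" "b \<in> carrier A" "f' b = \<zero>\<^bsub>B\<^esub>" "y = \<iota> b"
      by (auto simp: J_def)
    then show ?case using JI[of "a \<oplus>\<^bsub>A\<^esub> b"] by (simp add: hom)
  qed
  then have Jsub: "abelian_subgroup J L"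
    by (intro abelian_subgroupI3 additive_subgroup.intro ag)
  interpret J: abelian_subgroup J L by fact
  have J_act: "x \<cdot>\<^bsub>L\<^esub> a \<in> J" if "x \<in> J" "a \<in> carrier R" for x a
  proof -
    from that obtain b where b: "b \<in> carrier A" "f' b = \<zero>\<^bsub>B\<^esub>" "x = \<iota> b" by (auto simp: J_def)
    have "\<zero>\<^bsub>B\<^esub> \<cdot>\<^bsub>B\<^esub> a = \<zero>\<^bsub>B\<^esub>" using that by (intro B.zero_ract)
    then show ?thesis using JI[of "b \<cdot>\<^bsub>A\<^esub> a"] b that by (simp add: hom A.ract_closed)
  qed
  have coset_eqI: "J +>\<^bsub>L\<^esub> x = J +>\<^bsub>L\<^esub> y" if "x \<in> J +>\<^bsub>L\<^esub> y" "y \<in> carrier L" for x y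
    using J.a_repr_independence'[OF that] by simp
  have coset_shift: "J +>\<^bsub>L\<^esub> (j \<oplus>\<^bsub>L\<^esub> x) = J +>\<^bsub>L\<^esub> x" if "j \<in> J" "x \<in> carrier L" for j x
    by (rule coset_eqI) (use that in \<open>auto simp: a_r_coset_def r_coset_def\<close>)

  have BL: "carrier ?BL = carrier B \<times> carrier L"
    "x \<oplus>\<^bsub>?BL\<^esub> y = (fst x \<oplus>\<^bsub>B\<^esub> fst y, snd x \<oplus>\<^bsub>L\<^esub> snd y)"
    "x \<cdot>\<^bsub>?BL\<^esub> a = (fst x \<cdot>\<^bsub>B\<^esub> a, snd x \<cdot>\<^bsub>L\<^esub> a)" for x y a
    by (simp_all add: prod_rmod_def case_prod_beta)
  have \<theta>_closed: "\<theta> x \<in> carrier L" if "x \<in> carrier ?BL" for x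
    using that by (auto simp: \<theta>_def BL hom)
  have \<theta>_add: "\<theta> (x \<oplus>\<^bsub>?BL\<^esub> y) = \<theta> x \<oplus>\<^bsub>L\<^esub> \<theta> y" if "x \<in> carrier ?BL" "y \<in> carrier ?BL" for x y
  proof -
    obtain b l b' l' where xy: "x = (b, l)" "y = (b', l')" by fastforce
    have "s ((b \<oplus>\<^bsub>B\<^esub> b') \<oplus>\<^bsub>B\<^esub> (g l \<oplus>\<^bsub>B\<^esub> g l')) = s (b \<oplus>\<^bsub>B\<^esub> g l) \<oplus>\<^bsub>A\<^esub> s (b' \<oplus>\<^bsub>B\<^esub> g l')"
    proof -
      have "(b \<oplus>\<^bsub>B\<^esub> b') \<oplus>\<^bsub>B\<^esub> (g l \<oplus>\<^bsub>B\<^esub> g l') = (b \<oplus>\<^bsub>B\<^esub> g l) \<oplus>\<^bsub>B\<^esub> (b' \<oplus>\<^bsub>B\<^esub> g l')"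
        using that by (simp add: xy BL hom B.M.add.m_ac)
      then show ?thesis using that by (simp add: xy BL hom)
    qed
    then show ?thesis using that by (simp add: \<theta>_def xy BL hom L.M.add.m_ac)
  qed
  have \<theta>_act: "\<theta> (x \<cdot>\<^bsub>?BL\<^esub> a) = \<theta> x \<cdot>\<^bsub>L\<^esub> a" if "x \<in> carrier ?BL" "a \<in> carrier R" for x a
  proof -
    obtain b l where x: "x = (b, l)" by fastforce
    have "b \<cdot>\<^bsub>B\<^esub> a \<oplus>\<^bsub>B\<^esub> g l \<cdot>\<^bsub>B\<^esub> a = (b \<oplus>\<^bsub>B\<^esub> g l) \<cdot>\<^bsub>B\<^esub> a"
      using that by (simp add: x BL hom B.ract_add_left)
    then show ?thesis using that by (simp add: \<theta>_def x BL hom L.ract_add_left)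
  qed
  have P_BL: "P \<subseteq> carrier ?BL" by (auto simp: P_def pushout_rel_def BL hom)
  \<comment> \<open>On a relation \<open>(f a, - \<iota> a)\<close> the argument of \<open>s\<close>
    becomes \<open>f a - g (\<iota> a) = f' a\<close>, so \<theta> gives the image under \<iota> of
    \<open>s (f' a) - a\<close>, which \<open>f'\<close> annihilates because \<open>f' s\<close> is
    the identity.\<close>
  have \<theta>_P: "\<theta> x \<in> J" if "x \<in> P" for x
  proof -
    from that obtain a where a: "a \<in> carrier A" "x = (f a, \<ominus>\<^bsub>L\<^esub> \<iota> a)"
       unfolding P_def pushout_rel_def by blast
    have "g (\<ominus>\<^bsub>L\<^esub> \<iota> a) = \<ominus>\<^bsub>B\<^esub> g (\<iota> a)" using rmod_hom_uminus[OF ag(2,4) g] a by (simp add: hom)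
    then have "f a \<oplus>\<^bsub>B\<^esub> g (\<ominus>\<^bsub>L\<^esub> \<iota> a) = f' a"
      using a by (simp add: f_eq hom B.M.a_assoc B.M.r_neg)
    then have "\<theta> x = \<iota> (s (f' a)) \<oplus>\<^bsub>L\<^esub> \<ominus>\<^bsub>L\<^esub> \<iota> a" by (simp add: \<theta>_def a)
    also have "\<dots> = \<iota> (s (f' a) \<oplus>\<^bsub>A\<^esub> \<ominus>\<^bsub>A\<^esub> a)"
      using a rmod_hom_uminus[OF ag(3,2) \<iota>] by (simp add: hom)
    also have "\<dots> \<in> J"
    proof (rule JI)
      show "f' (s (f' a) \<oplus>\<^bsub>A\<^esub> \<ominus>\<^bsub>A\<^esub> a) = \<zero>\<^bsub>B\<^esub>"
        using a rmod_hom_uminus[OF ag(3,4) f'] by (simp add: hom split B.M.r_neg)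
    qed (use a in \<open>simp add: hom\<close>)
    finally show ?thesis .
  qed

  obtain \<phi> where \<phi>: "\<phi> \<in> rmod_hom R K (pushout_rmod A \<iota> L f B)"
    and \<phi>\<alpha>: "\<And>b. b \<in> carrier B \<Longrightarrow> \<phi> (\<alpha> b) = pushout_in A \<iota> L f B b"
    and \<phi>\<beta>: "\<And>k. k \<in> carrier K \<Longrightarrow> pushout_out \<epsilon> (\<phi> k) = \<beta> k"
    using cong by (auto simp: congruent_ext_def)
  have PO: "carrier (pushout_rmod A \<iota> L f B) = a_rcosets\<^bsub>?BL\<^esub> P"
    "X \<oplus>\<^bsub>pushout_rmod A \<iota> L f B\<^esub> Y = X <+>\<^bsub>?BL\<^esub> Y"
    "X \<cdot>\<^bsub>pushout_rmod A \<iota> L f B\<^esub> a = (\<Union>v\<in>X. P +>\<^bsub>?BL\<^esub> (v \<cdot>\<^bsub>?BL\<^esub> a))" for X Y a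
    by (simp_all add: pushout_rmod_def quot_rmod_def P_def)
  have cosetP: "P +>\<^bsub>?BL\<^esub> x = {p \<oplus>\<^bsub>?BL\<^esub> x | p. p \<in> P}" for x
    by (auto simp: a_r_coset_def r_coset_def)
  have zero_P: "(\<zero>\<^bsub>B\<^esub>, \<zero>\<^bsub>L\<^esub>) \<in> P"
  proof -
    have "\<ominus>\<^bsub>L\<^esub> \<zero>\<^bsub>L\<^esub> = \<zero>\<^bsub>L\<^esub>" by (rule L.M.minus_equality) simp_all
    then have "(\<zero>\<^bsub>B\<^esub>, \<zero>\<^bsub>L\<^esub>) = (f \<zero>\<^bsub>A\<^esub>, \<ominus>\<^bsub>L\<^esub> \<iota> \<zero>\<^bsub>A\<^esub>)"
      by (simp only: hom0)
    then show ?thesis unfolding P_def pushout_rel_def using A.M.zero_closed by (rule image_eqI)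
  qed
  have selfP: "x \<in> P +>\<^bsub>?BL\<^esub> x" if "x \<in> carrier ?BL" for x
    unfolding cosetP using zero_P that
    by (auto simp: BL intro!: exI[of _ "\<zero>\<^bsub>B\<^esub>"] exI[of _ "\<zero>\<^bsub>L\<^esub>"])
  have \<phi>E: "\<exists>x\<in>carrier ?BL. \<phi> k = P +>\<^bsub>?BL\<^esub> x" if "k \<in> carrier K" for k
    using rmod_homD(1)[OF \<phi> that] by (auto simp: PO A_RCOSETS_def RCOSETS_def a_r_coset_def)
  have \<phi>_BL: "x \<in> carrier ?BL" if "x \<in> \<phi> k" "k \<in> carrier K" for x k
    using \<phi>E[OF that(2)] that(1) subsetD[OF P_BL] by (auto simp: cosetP BL)
  have \<theta>_\<phi>: "J +>\<^bsub>L\<^esub> \<theta> x = J +>\<^bsub>L\<^esub> \<theta> y" if "x \<in> \<phi> k" "y \<in> \<phi> k" "k \<in> carrier K" for x y k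
  proof -
    from \<phi>E[OF that(3)] obtain z where z: "z \<in> carrier ?BL" "\<phi> k = P +>\<^bsub>?BL\<^esub> z" by blast
    have "J +>\<^bsub>L\<^esub> \<theta> x = J +>\<^bsub>L\<^esub> \<theta> z" if x: "x \<in> \<phi> k" for x
    proof -
      obtain q where q: "q \<in> P" "x = q \<oplus>\<^bsub>?BL\<^esub> z" using x z by (auto simp: cosetP)
      then have "\<theta> x = \<theta> q \<oplus>\<^bsub>L\<^esub> \<theta> z" using z P_BL by (auto intro: \<theta>_add)
      then show ?thesis using coset_shift[OF \<theta>_P[OF q(1)]] \<theta>_closed z by simp
    qed
    then show ?thesis using that by metis
  qed
  have \<epsilon>_\<phi>: "\<epsilon> (snd x) = \<beta> k" if x: "x \<in> \<phi> k" and k: "k \<in> carrier K" for x k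
  proof -
    obtain z where z: "z \<in> carrier ?BL" "\<phi> k = P +>\<^bsub>?BL\<^esub> z" using \<phi>E k by blast
    have e: "\<epsilon> (snd x) = \<epsilon> (snd z)" if "x \<in> \<phi> k" for x
    proof -
      from that z obtain q where q: "q \<in> P" "x = q \<oplus>\<^bsub>?BL\<^esub> z" by (auto simp: cosetP)
      then obtain a where a: "a \<in> carrier A" "q = (f a, \<ominus>\<^bsub>L\<^esub> \<iota> a)"
        unfolding P_def pushout_rel_def by blast
      then have a: "a \<in> carrier A" "snd x = \<ominus>\<^bsub>L\<^esub> \<iota> a \<oplus>\<^bsub>L\<^esub> snd z"
        using q by (simp_all add: BL)
      have "\<epsilon> (\<ominus>\<^bsub>L\<^esub> \<iota> a) = \<zero>\<^bsub>C\<^esub>" using rmod_hom_uminus[OF ag(2,5) \<epsilon>] a \<epsilon>\<iota> by (simp add: hom)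
      then show ?thesis using a z by (auto simp: hom BL)
    qed
    then have "(\<lambda>(b, l). \<epsilon> l) ` \<phi> k = {\<epsilon> (snd z)}"
      using selfP[OF z(1)] z(2) by (force simp: case_prod_beta)
    then have "pushout_out \<epsilon> (\<phi> k) = \<epsilon> (snd z)" by (simp add: pushout_out_def)
    then show ?thesis using \<phi>\<beta>[OF k] e[OF x] by simp
  qed

  \<comment> \<open>The composite of \<phi> with the map induced by \<theta>. Elements of the
    pushout are cosets, so a representative is chosen; by \<open>\<theta>_\<phi>\<close> the result
    does not depend on it.\<close>
  define \<chi> where "\<chi> k = J +>\<^bsub>L\<^esub> \<theta> (SOME x. x \<in> \<phi> k)" for k
  have \<chi>: "\<chi> k = J +>\<^bsub>L\<^esub> \<theta> x" if "x \<in> \<phi> k" "k \<in> carrier K" for x k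
    unfolding \<chi>_def using that by (intro \<theta>_\<phi>[of _ k]) (auto intro: someI)
  have \<phi>_ex: "\<exists>x. x \<in> \<phi> k" if "k \<in> carrier K" for k
    using \<phi>E[OF that] selfP by blast
  let ?Q = "quot_rmod L J"
  have Q: "carrier ?Q = a_rcosets\<^bsub>L\<^esub> J" "X \<oplus>\<^bsub>?Q\<^esub> Y = X <+>\<^bsub>L\<^esub> Y"
    "X \<cdot>\<^bsub>?Q\<^esub> a = (\<Union>v\<in>X. J +>\<^bsub>L\<^esub> (v \<cdot>\<^bsub>L\<^esub> a))" for X Y a
    by (simp_all add: quot_rmod_def)
  have Q_carrier: "X \<in> carrier ?Q \<longleftrightarrow> (\<exists>l\<in>carrier L. X = J +>\<^bsub>L\<^esub> l)" for X
    by (auto simp: Q A_RCOSETS_def RCOSETS_def a_r_coset_def)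
  have \<chi>_hom: "\<chi> \<in> rmod_hom R K ?Q"
  proof (rule rmod_homI)
    fix k assume k: "k \<in> carrier K"
    then obtain x where x: "x \<in> \<phi> k" using \<phi>_ex by blast
    show "\<chi> k \<in> carrier ?Q"
      using \<chi>[OF x k] \<theta>_closed[OF \<phi>_BL[OF x k]] by (auto simp: Q_carrier)
    fix k' assume k': "k' \<in> carrier K"
    then obtain y where y: "y \<in> \<phi> k'" using \<phi>_ex by blast
    have "\<phi> (k \<oplus>\<^bsub>K\<^esub> k') = \<phi> k <+>\<^bsub>?BL\<^esub> \<phi> k'"
      using rmod_homD(2)[OF \<phi> k k'] by (simp add: PO)
    then have "x \<oplus>\<^bsub>?BL\<^esub> y \<in> \<phi> (k \<oplus>\<^bsub>K\<^esub> k')" using x y by (auto simp: set_add_def set_mult_def)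
    then have "\<chi> (k \<oplus>\<^bsub>K\<^esub> k') = J +>\<^bsub>L\<^esub> (\<theta> x \<oplus>\<^bsub>L\<^esub> \<theta> y)"
      using \<chi>[of "x \<oplus>\<^bsub>?BL\<^esub> y"] \<theta>_add[OF \<phi>_BL[OF x k] \<phi>_BL[OF y k']] k k' by simp
    also have "\<dots> = (J +>\<^bsub>L\<^esub> \<theta> x) <+>\<^bsub>L\<^esub> (J +>\<^bsub>L\<^esub> \<theta> y)"
      using J.a_rcos_sum \<theta>_closed \<phi>_BL x y k k' by simp
    finally show "\<chi> (k \<oplus>\<^bsub>K\<^esub> k') = \<chi> k \<oplus>\<^bsub>?Q\<^esub> \<chi> k'"
      using \<chi>[OF x k] \<chi>[OF y k'] by (simp add: Q)
  next
    fix k a assume k: "k \<in> carrier K" and a: "a \<in> carrier R"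
    obtain x where x: "x \<in> \<phi> k" using \<phi>_ex k by blast
    note xBL = \<phi>_BL[OF x k]
    have "x \<cdot>\<^bsub>?BL\<^esub> a \<in> carrier ?BL" using xBL a by (auto simp: BL B.ract_closed L.ract_closed)
    then have "x \<cdot>\<^bsub>?BL\<^esub> a \<in> (\<Union>v\<in>\<phi> k. P +>\<^bsub>?BL\<^esub> (v \<cdot>\<^bsub>?BL\<^esub> a))"
      using x selfP by blast
    then have "x \<cdot>\<^bsub>?BL\<^esub> a \<in> \<phi> (k \<cdot>\<^bsub>K\<^esub> a)"
      using rmod_homD(3)[OF \<phi> k a] by (simp add: PO)
    then have "\<chi> (k \<cdot>\<^bsub>K\<^esub> a) = J +>\<^bsub>L\<^esub> (\<theta> x \<cdot>\<^bsub>L\<^esub> a)"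
      using \<chi> \<theta>_act[OF xBL a] K.ract_closed[OF k a] by metis
    also have "\<dots> = (\<Union>v\<in>J +>\<^bsub>L\<^esub> \<theta> x. J +>\<^bsub>L\<^esub> (v \<cdot>\<^bsub>L\<^esub> a))"
    proof -
      have "J +>\<^bsub>L\<^esub> (v \<cdot>\<^bsub>L\<^esub> a) = J +>\<^bsub>L\<^esub> (\<theta> x \<cdot>\<^bsub>L\<^esub> a)" if "v \<in> J +>\<^bsub>L\<^esub> \<theta> x" for v
      proof -
        from that obtain j where j: "j \<in> J" "v = j \<oplus>\<^bsub>L\<^esub> \<theta> x"  by (auto simp: a_r_coset_def r_coset_def)
        then have "v \<cdot>\<^bsub>L\<^esub> a = j \<cdot>\<^bsub>L\<^esub> a \<oplus>\<^bsub>L\<^esub> \<theta> x \<cdot>\<^bsub>L\<^esub> a"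
          using JL \<theta>_closed[OF xBL] a by (auto intro: L.ract_add_left)
        then show ?thesis
          using coset_shift[OF J_act[OF j(1) a]] L.ract_closed[OF \<theta>_closed[OF xBL] a] by simp
      qed
      moreover have "\<theta> x \<in> J +>\<^bsub>L\<^esub> \<theta> x" using a_rcos_self_mem[OF Jsub] \<theta>_closed[OF xBL] by simp
      ultimately show ?thesis by blast
    qed
    finally show "\<chi> (k \<cdot>\<^bsub>K\<^esub> a) = \<chi> k \<cdot>\<^bsub>?Q\<^esub> a" using \<chi>[OF x k] by (simp add: Q)
  qed
  have \<chi>\<alpha>: "\<chi> (\<alpha> b) = J +>\<^bsub>L\<^esub> \<iota> (s b)" if b: "b \<in> carrier B" for b
  proof -
    have "(b, \<zero>\<^bsub>L\<^esub>) \<in> \<phi> (\<alpha> b)"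
      using \<phi>\<alpha>[OF b] selfP[of "(b, \<zero>\<^bsub>L\<^esub>)"] b by (simp add: pushout_in_def P_def BL)
    then have "\<chi> (\<alpha> b) = J +>\<^bsub>L\<^esub> \<theta> (b, \<zero>\<^bsub>L\<^esub>)" using b by (intro \<chi>) (simp_all add: hom)
    also have "\<theta> (b, \<zero>\<^bsub>L\<^esub>) = \<iota> (s b)" using b hom0 by (simp add: \<theta>_def hom)
    finally show ?thesis .
  qed
  have Qzero: "J +>\<^bsub>L\<^esub> \<zero>\<^bsub>L\<^esub> = J" using JL by (rule L.M.a_coset_add_zero)
  \<comment> \<open>Applying \<epsilon> to a representative shows that \<open>k\<close> maps to zero
    in \<open>C\<close>, so it comes from some \<open>b\<close>. There \<chi> is the class of
    \<open>\<iota> (s b)\<close>, and membership of this element in \<open>J\<close> forces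
    \<open>b = f' (s b)\<close> to vanish.\<close>
  have \<chi>_ker: "k = \<zero>\<^bsub>K\<^esub>" if k: "k \<in> carrier K" and "\<chi> k = J" for k
  proof -
    obtain x where x: "x \<in> \<phi> k" using \<phi>_ex k by blast
    note xBL = \<phi>_BL[OF x k]
    then have x': "fst x \<in> carrier B" "snd x \<in> carrier L" by (auto simp: BL)
    have "\<theta> x \<in> J"
      using \<chi>[OF x k] \<open>\<chi> k = J\<close> a_rcos_self_mem[OF Jsub \<theta>_closed[OF xBL]] by simp
    then have "\<epsilon> (\<theta> x) = \<zero>\<^bsub>C\<^esub>" using \<epsilon>\<iota> by (auto simp: J_def)
    then have "\<epsilon> (snd x) = \<zero>\<^bsub>C\<^esub>" using x' by (simp add: \<theta>_def hom \<epsilon>\<iota>)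
    then have "\<beta> k = \<zero>\<^bsub>C\<^esub>" using \<epsilon>_\<phi>[OF x k] by simp
    then obtain b where b: "b \<in> carrier B" "k = \<alpha> b" using kerK k by blast
    then have "J +>\<^bsub>L\<^esub> \<iota> (s b) = J" using \<chi>\<alpha> \<open>\<chi> k = J\<close> by simp
    then have "\<iota> (s b) \<in> J" using a_rcos_self_mem[OF Jsub, of "\<iota> (s b)"] b by (simp add: hom)
    then obtain a where "a \<in> carrier A" "f' a = \<zero>\<^bsub>B\<^esub>" "\<iota> (s b) = \<iota> a" by (auto simp: J_def)
    then have "f' (s b) = \<zero>\<^bsub>B\<^esub>" using inj b by (metis inj_onD hom(19))
    then show ?thesis using b split hom0 by simp
  qed
  have "inj_on \<chi> (carrier K)"
  proof (rule inj_onI)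
    fix k k' assume k: "k \<in> carrier K" and k': "k' \<in> carrier K" and eq: "\<chi> k = \<chi> k'"
    \<comment> \<open>Passing to the difference reduces injectivity to \<open>\<chi>_ker\<close>;
      the cosets are compared through representatives in \<open>L\<close>, where cancellation is at
      hand.\<close>
    define d where "d = k \<oplus>\<^bsub>K\<^esub> \<ominus>\<^bsub>K\<^esub> k'"
    have d: "d \<in> carrier K" using k k' by (simp add: d_def)
    then have dk: "d \<oplus>\<^bsub>K\<^esub> k' = k" using k k' by (simp add: d_def K.M.a_assoc K.M.l_neg)
    obtain l where l: "l \<in> carrier L" "\<chi> d = J +>\<^bsub>L\<^esub> l"
      using rmod_homD(1)[OF \<chi>_hom d] by (auto simp: Q_carrier)
    obtain l' where l': "l' \<in> carrier L" "\<chi> k' = J +>\<^bsub>L\<^esub> l'"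
      using rmod_homD(1)[OF \<chi>_hom k'] by (auto simp: Q_carrier)
    have "J +>\<^bsub>L\<^esub> (l \<oplus>\<^bsub>L\<^esub> l') = J +>\<^bsub>L\<^esub> l'"
      using rmod_homD(2)[OF \<chi>_hom d k'] l l' eq dk J.a_rcos_sum by (simp add: Q)
    then have "l \<oplus>\<^bsub>L\<^esub> l' \<in> J +>\<^bsub>L\<^esub> l'"
      using a_rcos_self_mem[OF Jsub, of "l \<oplus>\<^bsub>L\<^esub> l'"] l l' by simp
    then obtain j where "j \<in> J" "l \<oplus>\<^bsub>L\<^esub> l' = j \<oplus>\<^bsub>L\<^esub> l'" by (auto simp: a_r_coset_def r_coset_def)
    then have "l \<in> J" using l l' subsetD[OF JL] L.M.add.right_cancel[of l' l j] by auto
    then have "\<chi> d = J" using coset_shift[of l "\<zero>\<^bsub>L\<^esub>"] l Qzero by simp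
    then have "d = \<zero>\<^bsub>K\<^esub>" using \<chi>_ker d by blast
    then show "k = k'" using dk k' by simp
  qed
  moreover have "\<chi> ` carrier K = carrier ?Q"
  proof
    show "\<chi> ` carrier K \<subseteq> carrier ?Q" using rmod_homD(1)[OF \<chi>_hom] by blast
    show "carrier ?Q \<subseteq> \<chi> ` carrier K"
    proof
      fix X assume "X \<in> carrier ?Q"
      then obtain l where l: "l \<in> carrier L" "X = J +>\<^bsub>L\<^esub> l" by (auto simp: Q_carrier)
      have "\<epsilon> l \<in> \<beta> ` carrier K" using l surK by (simp add: hom)
      then obtain k where k: "k \<in> carrier K" "\<beta> k = \<epsilon> l" by auto
      then obtain x where x: "x \<in> \<phi> k" using \<phi>_ex by blast
      note xBL = \<phi>_BL[OF x k(1)]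
      then have x': "fst x \<in> carrier B" "snd x \<in> carrier L" by (auto simp: BL)
      have "\<epsilon> (l \<oplus>\<^bsub>L\<^esub> \<ominus>\<^bsub>L\<^esub> \<theta> x) = \<epsilon> l \<oplus>\<^bsub>C\<^esub> \<ominus>\<^bsub>C\<^esub> \<epsilon> (\<theta> x)"
        using l \<theta>_closed[OF xBL] rmod_hom_uminus[OF ag(2,5) \<epsilon>] by (simp add: hom)
      also have "\<epsilon> (\<theta> x) = \<epsilon> l" using x' \<epsilon>_\<phi>[OF x k(1)] k l(1) by (simp add: \<theta>_def hom \<epsilon>\<iota>)
      finally have "\<epsilon> (l \<oplus>\<^bsub>L\<^esub> \<ominus>\<^bsub>L\<^esub> \<theta> x) = \<zero>\<^bsub>C\<^esub>" using l by (simp add: hom C.r_neg)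
      then have "l \<oplus>\<^bsub>L\<^esub> \<ominus>\<^bsub>L\<^esub> \<theta> x \<in> \<iota> ` carrier A" using ker l \<theta>_closed[OF xBL] by simp
      then obtain a where a: "a \<in> carrier A" "l \<oplus>\<^bsub>L\<^esub> \<ominus>\<^bsub>L\<^esub> \<theta> x = \<iota> a" by blast
      have la: "l = \<iota> a \<oplus>\<^bsub>L\<^esub> \<theta> x"
        using a(2)[symmetric] l \<theta>_closed[OF xBL] by (simp add: L.M.a_assoc L.M.l_neg)
      \<comment> \<open>The splitting decomposes \<open>a\<close> into \<open>c\<close>, which
        \<open>f'\<close> annihilates and which disappears modulo \<open>J\<close>, and
        \<open>s (f' a)\<close>, which is reached from \<open>\<alpha> (f' a)\<close>. So
        \<open>l\<close> is hit by correcting \<open>k\<close> with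
        \<open>\<alpha> (f' a)\<close>.\<close>
      define c where "c = a \<oplus>\<^bsub>A\<^esub> \<ominus>\<^bsub>A\<^esub> s (f' a)"
      have c: "c \<in> carrier A" using a by (simp add: c_def hom)
      have "f' c = \<zero>\<^bsub>B\<^esub>"
        using a rmod_hom_uminus[OF ag(3,4) f'] by (simp add: c_def hom split B.M.r_neg)
      then have cJ: "\<iota> c \<in> J" using c by (rule_tac JI)
      have "a = c \<oplus>\<^bsub>A\<^esub> s (f' a)" using a by (simp add: c_def hom A.M.a_assoc A.M.l_neg)
      then have \<iota>a: "\<iota> a = \<iota> c \<oplus>\<^bsub>L\<^esub> \<iota> (s (f' a))" using c a hom(2) by (metis hom(16) hom(19))
      have "\<chi> (\<alpha> (f' a) \<oplus>\<^bsub>K\<^esub> k) = (J +>\<^bsub>L\<^esub> \<iota> (s (f' a))) <+>\<^bsub>L\<^esub> (J +>\<^bsub>L\<^esub> \<theta> x)"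
        using rmod_homD(2)[OF \<chi>_hom] a k \<chi>\<alpha> \<chi>[OF x k(1)] by (simp add: hom Q)
      also have "\<dots> = J +>\<^bsub>L\<^esub> (\<iota> (s (f' a)) \<oplus>\<^bsub>L\<^esub> \<theta> x)"
        using J.a_rcos_sum a \<theta>_closed[OF xBL] by (simp add: hom)
      also have "\<dots> = J +>\<^bsub>L\<^esub> (\<iota> c \<oplus>\<^bsub>L\<^esub> (\<iota> (s (f' a)) \<oplus>\<^bsub>L\<^esub> \<theta> x))"
        using coset_shift[OF cJ] a \<theta>_closed[OF xBL] by (simp add: hom)
      also have "\<iota> c \<oplus>\<^bsub>L\<^esub> (\<iota> (s (f' a)) \<oplus>\<^bsub>L\<^esub> \<theta> x) = l"
        unfolding la \<iota>a using a c \<theta>_closed[OF xBL] by (simp add: hom L.M.a_assoc)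
      finally have "\<chi> (\<alpha> (f' a) \<oplus>\<^bsub>K\<^esub> k) = X" using l by simp
      moreover have "\<alpha> (f' a) \<oplus>\<^bsub>K\<^esub> k \<in> carrier K" using a k by (simp add: hom)
      ultimately show "X \<in> \<chi> ` carrier K" by blast
    qed
  qed
  ultimately have "bij_betw \<chi> (carrier K) (carrier ?Q)" by (simp add: bij_betw_def)
  with \<chi>_hom show ?thesis unfolding rmod_isomorphic_def J_def by blast
qed

subsection \<open>Integer matrices\<close>

definition mat_prod :: "'i set \<Rightarrow> ('i \<Rightarrow> 'i \<Rightarrow> int) \<Rightarrow> ('i \<Rightarrow> 'i \<Rightarrow> int) \<Rightarrow> 'i \<Rightarrow> 'i \<Rightarrow> int" where
  "mat_prod P M N i j = (\<Sum>k\<in>P. M i k * N k j)"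

definition mat_one :: "'i \<Rightarrow> 'i \<Rightarrow> int" where
  "mat_one i j = (if i = j then 1 else 0)"

lemma mat_prod_assoc: "mat_prod P (mat_prod P L M) N = mat_prod P L (mat_prod P M N)"
proof (intro ext)
  fix i j
  have "mat_prod P (mat_prod P L M) N i j = (\<Sum>k\<in>P. \<Sum>l\<in>P. L i l * M l k * N k j)"
    by (simp add: mat_prod_def sum_distrib_right)
  also have "\<dots> = (\<Sum>l\<in>P. \<Sum>k\<in>P. L i l * M l k * N k j)" by (rule sum.swap)
  also have "\<dots> = mat_prod P L (mat_prod P M N) i j"
    by (simp add: mat_prod_def sum_distrib_left mult.assoc)
  finally show "mat_prod P (mat_prod P L M) N i j = mat_prod P L (mat_prod P M N) i j" .
qed

lemma mat_prod_cong:
  "(\<And>k. k \<in> P \<Longrightarrow> M i k = M' i k) \<Longrightarrow> (\<And>k. k \<in> P \<Longrightarrow> N k j = N' k j) \<Longrightarrow> mat_prod P M N i j = mat_prod P M' N' i j"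
  unfolding mat_prod_def by (rule sum.cong) auto

lemma mat_one_left: assumes "finite P" "i \<in> P" shows "mat_prod P mat_one M i j = M i j"
proof -
  have "mat_prod P mat_one M i j = (\<Sum>k\<in>P. if i = k then M k j else 0)"
    unfolding mat_prod_def by (rule sum.cong) (auto simp: mat_one_def)
  then show ?thesis using assms by simp
qed

definition inverse_mats :: "'i set \<Rightarrow> ('i \<Rightarrow> 'i \<Rightarrow> int) \<Rightarrow> ('i \<Rightarrow> 'i \<Rightarrow> int) \<Rightarrow> bool" where
  "inverse_mats P M N \<longleftrightarrow> (\<forall>i\<in>P. \<forall>j\<in>P. mat_prod P M N i j = mat_one i j \<and> mat_prod P N M i j = mat_one i j)"

text \<open>Homomorphisms between sums of the \<open>R(i)\<close> need divisibility only below the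
  diagonal. The symmetric condition treats \<open>i < n\<close> and \<open>n < i\<close> alike, and
  under it diagonals multiply modulo \<open>q\<close>.\<close>

definition diagonal_mod :: "int \<Rightarrow> 'i set \<Rightarrow> ('i \<Rightarrow> 'i \<Rightarrow> int) \<Rightarrow> bool" where
  "diagonal_mod q P M \<longleftrightarrow> (\<forall>i\<in>P. \<forall>j\<in>P. i \<noteq> j \<longrightarrow> q dvd M i j)"

lemma inverse_mats_prod:
  assumes P: "finite P" and 1: "inverse_mats P M M'" and 2: "inverse_mats P N N'"
  shows "inverse_mats P (mat_prod P M N) (mat_prod P N' M')"
proof -
  have *: "mat_prod P (mat_prod P M N) (mat_prod P N' M') i j = mat_one i j"
    if "inverse_mats P M M'" "inverse_mats P N N'" "i \<in> P" "j \<in> P" for M M' N N' i j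
  proof -
    have "mat_prod P (mat_prod P M N) (mat_prod P N' M') i j
        = mat_prod P M (mat_prod P (mat_prod P N N') M') i j"
      by (simp only: mat_prod_assoc)
    also have "\<dots> = mat_prod P M M' i j"
    proof (rule mat_prod_cong)
      fix k assume k: "k \<in> P"
      have "mat_prod P (mat_prod P N N') M' k j = mat_prod P mat_one M' k j"
        using that k by (intro mat_prod_cong) (auto simp: inverse_mats_def)
      then show "mat_prod P (mat_prod P N N') M' k j = M' k j" using P k by (simp add: mat_one_left)
    qed simp
    finally show ?thesis using that by (simp add: inverse_mats_def)
  qed
  have sym: "inverse_mats P M' M" "inverse_mats P N' N" using 1 2 by (auto simp: inverse_mats_def)
  show ?thesis unfolding inverse_mats_def using *[OF 1 2] *[OF sym(2) sym(1)] by blast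
qed

lemma diagonal_mod_prod:
  assumes P: "finite P" and M: "diagonal_mod q P M" and N: "diagonal_mod q P N"
  shows "diagonal_mod q P (mat_prod P M N)"
    and "i \<in> P \<Longrightarrow> [mat_prod P M N i i = M i i * N i i] (mod q)"
proof -
  show "diagonal_mod q P (mat_prod P M N)"
    unfolding diagonal_mod_def mat_prod_def
  proof (intro ballI impI dvd_sum)
    fix i j k assume "i \<in> P" "j \<in> P" "i \<noteq> j" "k \<in> P"
    then show "q dvd M i k * N k j"
      using M N by (cases "i = k") (auto simp: diagonal_mod_def)
  qed
  assume i: "i \<in> P"
  have "mat_prod P M N i i = M i i * N i i + (\<Sum>k\<in>P - {i}. M i k * N k i)"
    unfolding mat_prod_def using P i by (rule sum.remove)
  moreover have "q dvd (\<Sum>k\<in>P - {i}. M i k * N k i)"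
    using M i by (intro dvd_sum) (auto simp: diagonal_mod_def)
  ultimately show "[mat_prod P M N i i = M i i * N i i] (mod q)"
    by (simp add: cong_iff_dvd_diff)
qed

text \<open>\<open>F\<close> is the identity except for the block \<open>(d, q; q c, e)\<close> in rows and columns \<open>i, n\<close>, where
  \<open>d e - q\<^sup>2 c = 1\<close>.\<close>

lemma elementary_block:
  fixes d q :: int
  assumes P: "finite P" "i \<in> P" "n \<in> P" "i \<noteq> n" and d: "coprime d q"
  obtains F G where "inverse_mats P F G" "diagonal_mod q P F" "diagonal_mod q P G" "F i i = d"
    "\<And>j. j \<noteq> i \<Longrightarrow> j \<noteq> n \<Longrightarrow> F j j = 1"
proof -
  \<comment> \<open>The modulus is squared because both off-diagonal entries of the block are to
    carry a factor \<open>q\<close>.\<close>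
  have "coprime d (q * q)" using d by simp
  then obtain e c' where "e * d + c' * (q * q) = 1" using bezout_int[of d "q * q"] by auto
  then obtain c where det: "d * e - q * q * c = 1" by (metis add_uminus_conv_diff minus_mult_right mult.commute minus_minus)
  define B where "B a b u v = (\<lambda>j k :: 'a. if j = i \<and> k = i then a else if j = i \<and> k = n then b
    else if j = n \<and> k = i then u else if j = n \<and> k = n then v else mat_one j k)" for a b u v :: int
  have prod: "mat_prod P (B a b u v) (B a' b' u' v') j k = mat_one j k"
    if eq: "a * a' + b * u' = 1" "a * b' + b * v' = 0" "u * a' + v * u' = 0" "u * b' + v * v' = 1"
      and jk: "j \<in> P" "k \<in> P" for a b u v a' b' u' v' j k
  proof (cases "j = i \<or> j = n")
    case True
    have "mat_prod P (B a b u v) (B a' b' u' v') j k = (\<Sum>l\<in>{i, n}. B a b u v j l * B a' b' u' v' l k)"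
      unfolding mat_prod_def
      by (rule sum.mono_neutral_right) (use P True in \<open>auto simp: B_def mat_one_def\<close>)
    also have "\<dots> = B a b u v j i * B a' b' u' v' i k + B a b u v j n * B a' b' u' v' n k"
      using P by simp
    also have "\<dots> = mat_one j k"
      using P True eq by (auto simp: B_def mat_one_def)
    finally show ?thesis .
  next
    case False
    have "mat_prod P (B a b u v) (B a' b' u' v') j k = mat_prod P mat_one (B a' b' u' v') j k"
      using False by (intro mat_prod_cong) (auto simp: B_def)
    then show ?thesis using P jk False by (simp add: mat_one_left) (auto simp: B_def mat_one_def)
  qed
  define F where "F = B d q (q * c) e"
  \<comment> \<open>The adjugate of the block of \<open>F\<close>, hence its inverse since the
    determinant is 1.\<close>
  define G where "G = B e (- q) (- (q * c)) d"
  have "inverse_mats P F G"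
    unfolding inverse_mats_def F_def G_def using det
    by (intro ballI conjI prod) (simp_all add: algebra_simps)
  moreover have "diagonal_mod q P F" "diagonal_mod q P G" "F i i = d"
    by (auto simp: diagonal_mod_def F_def G_def B_def mat_one_def)
  moreover have "F j j = 1" if "j \<noteq> i" "j \<noteq> n" for j
    using that by (simp add: F_def B_def mat_one_def)
  ultimately show ?thesis using that by blast
qed

text \<open>One elementary block for each index \<open>s\<close> in place of a simultaneous
  construction: the block for \<open>s\<close> has diagonal entry \<open>d s\<close> at
  \<open>s\<close> and 1 at every other index except \<open>n\<close>, so multiplying by it corrects
  exactly one prescribed entry modulo \<open>q\<close>. All changes at \<open>n\<close> accumulate
  in the one entry that is not prescribed.\<close>

lemma ex_inverse_mats_with_diagonal:
  fixes d :: "'i \<Rightarrow> int"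
  assumes P: "finite P" "n \<in> P" and d: "\<And>i. i \<in> P - {n} \<Longrightarrow> coprime (d i) q"
  obtains F G where "inverse_mats P F G" "diagonal_mod q P F" "diagonal_mod q P G"
    "\<And>i. i \<in> P - {n} \<Longrightarrow> [F i i = d i] (mod q)"
proof -
  have "\<exists>F G. inverse_mats P F G \<and> diagonal_mod q P F \<and> diagonal_mod q P G \<and>
      (\<forall>i\<in>P - {n}. [F i i = (if i \<in> S then d i else 1)] (mod q))"
    if "finite S" "S \<subseteq> P - {n}" for S
    using that
  proof (induction S)
    case empty
    have "inverse_mats P mat_one mat_one" using P by (auto simp: inverse_mats_def mat_one_left)
    moreover have "diagonal_mod q P mat_one" by (auto simp: diagonal_mod_def mat_one_def)
    moreover have "\<forall>i\<in>P - {n}. [mat_one i i = (if i \<in> {} then d i else 1)] (mod q)"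
      by (simp add: mat_one_def)
    ultimately show ?case by blast
  next
    case (insert s S)
    then obtain F G where FG: "inverse_mats P F G" "diagonal_mod q P F" "diagonal_mod q P G"
      and diag: "\<And>i. i \<in> P - {n} \<Longrightarrow> [F i i = (if i \<in> S then d i else 1)] (mod q)" by blast
    have "s \<in> P" "s \<noteq> n" "coprime (d s) q" using insert d by auto
    then obtain E E' where E: "inverse_mats P E E'" "diagonal_mod q P E" "diagonal_mod q P E'"
      "E s s = d s" "\<And>j. j \<noteq> s \<Longrightarrow> j \<noteq> n \<Longrightarrow> E j j = 1"
      using elementary_block[OF P(1) _ P(2)] by metis
    have "[mat_prod P F E i i = (if i \<in> insert s S then d i else 1)] (mod q)" if i: "i \<in> P - {n}" for i
    proof -
      have "[mat_prod P F E i i = F i i * E i i] (mod q)"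
        using i diagonal_mod_prod(2)[OF P(1) FG(2) E(2)] by blast
      also have "[F i i * E i i = (if i \<in> S then d i else 1) * E i i] (mod q)"
        using diag[OF i] by (rule cong_scalar_right)
      also have "(if i \<in> S then d i else 1) * E i i = (if i \<in> insert s S then d i else 1)"
        using E(4) E(5)[of i] i insert.hyps by auto
      finally show ?thesis .
    qed
    moreover have "inverse_mats P (mat_prod P F E) (mat_prod P E' G)"
      by (rule inverse_mats_prod) (use P FG E in auto)
    moreover have "diagonal_mod q P (mat_prod P F E)" "diagonal_mod q P (mat_prod P E' G)"
      using diagonal_mod_prod(1)[OF P(1)] FG E by blast+
    ultimately show ?case by blast
  qed
  from this[of "P - {n}"] P that show ?thesis by auto
qed

text \<open>Determinants are multiplicative: a non-zero left kernel vector of \<open>W\<close> makes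
  the determinant of the product vanish, and then the product has a non-zero integral kernel vector
  as well.\<close>

lemma left_kernel_trivial_of_factor:
  fixes U W :: "nat \<Rightarrow> nat \<Rightarrow> int"
  assumes UW: "\<And>v k. (\<And>l. l \<in> {1..n} \<Longrightarrow> (\<Sum>k\<in>{1..n}. v k * (\<Sum>j\<in>{1..n}. U k j * W j l)) = 0)
      \<Longrightarrow> k \<in> {1..n} \<Longrightarrow> v k = 0"
    and c: "\<And>l. l \<in> {1..n} \<Longrightarrow> (\<Sum>j\<in>{1..n}. c j * W j l) = 0" and j: "j \<in> {1..n}"
  shows "c j = 0"
proof (rule ccontr)
  assume "c j \<noteq> 0"
  \<comment> \<open>Transposes with indices from 0, since the criterion for a vanishing determinant
    speaks of right kernels.\<close>
  define A where "A = mat n n (\<lambda>(l, j). W (Suc j) (Suc l))"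
  define B where "B = mat n n (\<lambda>(j, k). U (Suc k) (Suc j))"
  have A: "A \<in> carrier_mat n n" and B: "B \<in> carrier_mat n n" by (simp_all add: A_def B_def)
  have shift: "(\<Sum>j\<in>{1..n}. f j) = (\<Sum>j<n. f (Suc j))" for f :: "nat \<Rightarrow> int"
    unfolding One_nat_def by (rule sum.atLeast1_atMost_eq)
  define x where "x = vec n (\<lambda>j. c (Suc j))"
  have "A *\<^sub>v x = 0\<^sub>v n"
  proof (rule eq_vecI)
    fix l assume l: "l < dim_vec (0\<^sub>v n)"
    then have "(A *\<^sub>v x) $ l = (\<Sum>j<n. c (Suc j) * W (Suc j) (Suc l))"
      by (simp add: A_def x_def scalar_prod_def atLeast0LessThan mult.commute)
    then show "(A *\<^sub>v x) $ l = 0\<^sub>v n $ l" using c[of "Suc l", unfolded shift] l by simp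
  qed (simp add: A_def)
  moreover have "x \<noteq> 0\<^sub>v n"
  proof
    assume "x = 0\<^sub>v n"
    moreover have "j - 1 < n" using j by auto
    ultimately have "x $ (j - 1) = 0" by simp
    then show False using j \<open>c j \<noteq> 0\<close> by (auto simp: x_def)
  qed
  moreover have "x \<in> carrier_vec n" by (simp add: x_def)
  ultimately have "\<exists>v. v \<in> carrier_vec n \<and> v \<noteq> 0\<^sub>v n \<and> A *\<^sub>v v = 0\<^sub>v n" by blast
  then have "Determinant.det A = 0"
    using det_0_iff_vec_prod_zero[OF A] by simp
  then have "Determinant.det (A * B) = 0" using det_mult[OF A B] by simp
  then obtain y where y: "y \<in> carrier_vec n" "y \<noteq> 0\<^sub>v n" "(A * B) *\<^sub>v y = 0\<^sub>v n"
    using det_0_iff_vec_prod_zero[of "A * B" n] A B by auto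
  define v where "v k = y $ (k - 1)" for k
  have "v k = 0" if "k \<in> {1..n}" for k
  proof (rule UW[OF _ that])
    fix l assume l: "l \<in> {1..n}"
    then have l': "l - 1 < n" "Suc (l - 1) = l" by auto
    have "0 = ((A * B) *\<^sub>v y) $ (l - 1)" using y l' by simp
    also have "\<dots> = (\<Sum>k<n. (A * B) $$ (l - 1, k) * y $ k)"
      using l' y(1) A B by (simp add: scalar_prod_def atLeast0LessThan del: assoc_mult_mat_vec)
    also have "\<dots> = (\<Sum>k<n. (\<Sum>j<n. W (Suc j) l * U (Suc k) (Suc j)) * y $ k)"
      using l' by (intro sum.cong) (auto simp: A_def B_def scalar_prod_def atLeast0LessThan)
    finally show "(\<Sum>k\<in>{1..n}. v k * (\<Sum>j\<in>{1..n}. U k j * W j l)) = 0"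
      unfolding shift by (simp add: v_def mult.commute)
  qed
  from this[of "Suc _"] have "y = 0\<^sub>v n"
    using y(1) by (intro eq_vecI) (auto simp: v_def)
  then show False using y by simp
qed

context metacyclic
begin

subsection \<open>The modules \<open>R(i)\<close>\<close>

text \<open>The formula for the action does not mention \<open>i\<close>, so one operation serves
  all the modules \<open>R(i)\<close>.\<close>

definition vact :: "(nat \<Rightarrow> int) \<Rightarrow> (gen word set \<Rightarrow> int) \<Rightarrow> nat \<Rightarrow> int" where
  "vact r a = (\<lambda>j. \<Sum>k\<in>{1..p - 1}. r k * lambda_tilde p m a k j)"

abbreviation Ps :: "nat set" where "Ps \<equiv> {1..p - 1}"
abbreviation Rm where "Rm \<equiv> Rmod p m"
abbreviation Rs where "Rs \<equiv> Rsum p m"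

lemma Rmod_sel [simp]:
  "add (Rm i) = (\<lambda>r s j. r j + s j)" "zero (Rm i) = (\<lambda>_. 0)" "ract (Rm i) = vact"
  by (simp_all add: Rmod_def vact_def fun_eq_iff)

lemma carrier_Rmod: "r \<in> carrier (Rm i) \<longleftrightarrow> r \<in> V \<and> (\<forall>j<i. int p dvd r j)"
  by (simp add: Rmod_def V_def)

lemma carrier_Rmod_val: "i \<in> Ps \<Longrightarrow> r \<in> carrier (Rm i) \<longleftrightarrow> r \<in> V \<and> val r \<in> I i"
  using val_in_I_iff[of r i] by (auto simp: carrier_Rmod)

lemma lambda_tilde_row:
  assumes "a \<in> carrier \<Lambda>" "k \<in> Ps"
  shows "lambda_tilde p m a k \<in> V" "val (lambda_tilde p m a k) = lact (t ^ k) a"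
proof -
  have "t ^ k \<in> I 1" using assms I_antimono[of 1 k] I_power[of k] by auto
  then have "lact (t ^ k) a \<in> I 1" using assms(1) by (intro lact_I)
  moreover have "lambda_tilde p m a k = zeta_coords p (lact (t ^ k) a)"
    using assms(2) by (auto simp: lambda_tilde_def t_def fun_eq_iff)
  ultimately show "lambda_tilde p m a k \<in> V" "val (lambda_tilde p m a k) = lact (t ^ k) a"
    using zeta_coords by auto
qed

lemma vact_V: "a \<in> carrier \<Lambda> \<Longrightarrow> vact r a \<in> V"
  unfolding vact_def V_def using lambda_tilde_row(1)[of a] by (auto simp: V_def)

text \<open>Together with \<open>val_inj\<close> this reduces the module laws of \<open>R(i)\<close>
  to those of the action on \<int>[\<zeta>]; the matrices are not multiplied.\<close>

lemma val_vact: assumes "a \<in> carrier \<Lambda>" shows "val (vact r a) = lact (val r) a"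
proof -
  have "val (vact r a) = (\<Sum>k\<in>Ps. of_int (r k) * lact (t ^ k) a)"
    unfolding vact_def val_sum val_scale
    by (rule sum.cong) (simp_all add: lambda_tilde_row(2)[OF assms])
  also have "\<dots> = (\<Sum>k\<in>Ps. lact (of_int (r k) * t ^ k) a)"
    by (rule sum.cong) (use assms in \<open>simp_all add: lact_int O_power\<close>)
  also have "\<dots> = lact (\<Sum>k\<in>Ps. of_int (r k) * t ^ k) a"
    by (rule lact_sum[symmetric]) (use assms in \<open>auto intro!: O_mult O_power\<close>)
  finally show ?thesis by (simp add: val_def)
qed

lemma vact_Rmod: "r \<in> carrier (Rm i) \<Longrightarrow> i \<in> Ps \<Longrightarrow> a \<in> carrier \<Lambda> \<Longrightarrow> vact r a \<in> carrier (Rm i)"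
  by (simp add: carrier_Rmod_val vact_V val_vact lact_I)

lemma V_add: "r \<in> V \<Longrightarrow> s \<in> V \<Longrightarrow> (\<lambda>j. r j + s j) \<in> V"
  by (simp add: V_def)

lemma val_O: "val r \<in> \<O>"
  using val_in_I_1 I_subset_O by blast

lemma right_module_Rmod:
  assumes "ring \<Lambda>" and i: "i \<in> Ps"
  shows "right_module \<Lambda> (Rm i)"
proof -
  interpret ring \<Lambda> by fact
  have "abelian_group (Rm i)"
  proof (rule abelian_groupI)
    fix r assume "r \<in> carrier (Rm i)"
    then show "\<exists>s\<in>carrier (Rm i). s \<oplus>\<^bsub>Rm i\<^esub> r = \<zero>\<^bsub>Rm i\<^esub>"
      by (intro bexI[of _ "\<lambda>j. - r j"]) (auto simp: carrier_Rmod V_def)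
  qed (auto simp: carrier_Rmod V_def add_ac)
  then interpret M: abelian_group "Rm i" .
  have "vact r (a \<oplus>\<^bsub>\<Lambda>\<^esub> b) = (\<lambda>j. vact r a j + vact r b j)"
    if "a \<in> carrier \<Lambda>" "b \<in> carrier \<Lambda>" for r a b
    using that by (intro val_inj V_add) (auto simp: vact_V val_vact val_add lact_add_right)
  moreover have "vact r (a \<otimes>\<^bsub>\<Lambda>\<^esub> b) = vact (vact r a) b"
    if "a \<in> carrier \<Lambda>" "b \<in> carrier \<Lambda>" for r a b
    using that by (intro val_inj) (auto simp: vact_V val_vact lact_mult val_O)
  moreover have "vact r \<one>\<^bsub>\<Lambda>\<^esub> = r" if "r \<in> carrier (Rm i)" for r
    using that by (intro val_inj) (auto simp: vact_V val_vact lact_one val_O carrier_Rmod)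
  moreover have "vact (\<lambda>j. r j + s j) a = (\<lambda>j. vact r a j + vact s a j)" for r s a
    by (simp add: vact_def distrib_right sum.distrib)
  ultimately show ?thesis
    by unfold_locales (use i in \<open>auto simp: vact_Rmod\<close>)
qed

definition unit_row :: "nat \<Rightarrow> nat \<Rightarrow> int" where "unit_row k = (\<lambda>j. if j = k then 1 else 0)"

lemma unit_row_Rmod: "k \<in> Ps \<Longrightarrow> unit_row k \<in> carrier (Rm k)"
  by (auto simp: carrier_Rmod V_def unit_row_def)

lemma val_unit_row: assumes "k \<in> Ps" shows "val (unit_row k) = t ^ k"
proof -
  have "val (unit_row k) = (\<Sum>j\<in>Ps. if j = k then t ^ k else 0)"
    unfolding val_def by (rule sum.cong) (auto simp: unit_row_def)
  then show ?thesis using assms by simp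
qed

text \<open>Viewed as a map of ideals, \<open>\<psi>\<close> commutes with \<open>\<zeta>\<close>, so \<open>p \<psi>(v) = v \<psi>(p)\<close>; and \<open>\<psi>(p)\<close> is fixed by \<open>\<sigma>\<close>, so
  it is rational by a trace argument.\<close>

lemma hom_Rmod_scalar:
  assumes \<psi>: "\<psi> \<in> rmod_hom \<Lambda> (Rm j) (Rm i)" and i: "i \<in> Ps" and j: "j \<in> Ps"
  shows "\<exists>d. (\<forall>r\<in>carrier (Rm j). \<psi> r = (\<lambda>k. d * r k)) \<and> (j < i \<longrightarrow> int p dvd d)"
proof -
  define \<Psi> where "\<Psi> v = val (\<psi> (zeta_coords p v))" for v
  have I1: "I j \<subseteq> I 1" using j by (intro I_antimono) auto
  have coords: "zeta_coords p v \<in> carrier (Rm j)" "val (zeta_coords p v) = v" if "v \<in> I j" for v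
    using zeta_coords[of v] that I1 j by (auto simp: carrier_Rmod_val)
  have coords_eq: "zeta_coords p v = r" if "r \<in> V" "val r = v" for v r
    using zeta_coords_val that by auto
  have \<Psi>_O: "\<Psi> v \<in> \<O>" for v by (simp add: \<Psi>_def val_O)
  have \<Psi>_add: "\<Psi> (u + v) = \<Psi> u + \<Psi> v" if "u \<in> I j" "v \<in> I j" for u v
  proof -
    have "zeta_coords p (u + v) = (\<lambda>k. zeta_coords p u k + zeta_coords p v k)"
      using coords[of u] coords[of v] that
      by (intro coords_eq) (auto simp: val_add carrier_Rmod V_def)
    then show ?thesis
      using rmod_homD(2)[OF \<psi>] coords that by (simp add: \<Psi>_def val_add)
  qed
  have \<Psi>_act: "\<Psi> (lact v a) = lact (\<Psi> v) a" if "v \<in> I j" "a \<in> carrier \<Lambda>" for v a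
  proof -
    have "zeta_coords p (lact v a) = vact (zeta_coords p v) a"
      using coords[of v] that by (intro coords_eq) (auto simp: vact_V val_vact)
    then show ?thesis
      using rmod_homD(3)[OF \<psi>] coords that by (simp add: \<Psi>_def val_vact)
  qed
  have \<Psi>_zeta: "\<Psi> (v * \<zeta>) = \<Psi> v * \<zeta>" if "v \<in> I j" for v
    using \<Psi>_act[OF that, of "delta [(Gen_x, True)]"] that subsetD[OF I_subset_O] \<Psi>_O
    by (simp add: lact_delta)
  have \<Psi>_aut: "\<Psi> (aut mi v) = aut mi (\<Psi> v)" if "v \<in> I j" for v
    using \<Psi>_act[OF that, of "delta [(Gen_y, True)]"] that subsetD[OF I_subset_O] \<Psi>_O
    by (simp add: lact_delta inv_sigma)
  have \<Psi>_0: "\<Psi> 0 = 0" using \<Psi>_add[of 0 0] by simp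
  have \<Psi>_nat: "\<Psi> (of_nat n * v) = of_nat n * \<Psi> v" if "v \<in> I j" for n v
    by (induction n) (use that in \<open>simp_all add: \<Psi>_0 \<Psi>_add distrib_right I_mult'\<close>)
  have \<Psi>_int: "\<Psi> (of_int n * v) = of_int n * \<Psi> v" if v: "v \<in> I j" for n v
  proof (cases "n \<ge> 0")
    case True
    then show ?thesis using \<Psi>_nat[OF v, of "nat n"] by simp
  next
    case False
    have "\<Psi> (of_int n * v + of_nat (nat (- n)) * v) = \<Psi> (of_int n * v) + of_nat (nat (- n)) * \<Psi> v"
      using v by (simp add: \<Psi>_add \<Psi>_nat I_mult' del: of_nat_nat)
    then show ?thesis using False \<Psi>_0 by simp
  qed
  have \<Psi>_mult: "\<Psi> (v * u) = \<Psi> v * u" if "u \<in> \<O>" "v \<in> I j" for u v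
    using that
  proof (induction rule: O_induct)
    case zero then show ?case by (simp add: \<Psi>_0)
  next
    case (step a u)
    have "v * (of_int a + \<zeta> * u) = of_int a * v + v * u * \<zeta>" by (simp add: algebra_simps)
    then show ?case using step
      by (simp add: \<Psi>_add \<Psi>_int \<Psi>_zeta I_mult I_mult') (simp add: algebra_simps)
  qed
  \<comment> \<open>A rational integer that lies in \<open>I j\<close>: the conjugations fix it, and
    hence also its image.\<close>
  have p: "of_nat p \<in> I j" using j by (intro t_pow_dvd_p) auto
  have "\<Psi> (of_nat p) = aut mi (\<Psi> (of_nat p))"
    using \<Psi>_aut[OF p] aut_int[OF coprime_mi, of "int p"] by simp
  then have "aut m' (\<Psi> (of_nat p)) = \<Psi> (of_nat p)"
    using aut_m'_mi(1)[OF \<Psi>_O] by metis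
  from fixed_by_aut[OF \<Psi>_O this] obtain z :: int where
    z: "of_nat (p - 1) * \<Psi> (of_nat p) = of_int z" by (auto elim: Ints_cases)
  \<comment> \<open>The factor \<open>p\<close> stems from evaluating at \<open>p\<close>, the
    factor \<open>p - 1\<close> from the trace in \<open>fixed_by_aut\<close>.\<close>
  define q where "q = int (p - 1) * int p"
  have q: "q \<noteq> 0" using p_ge_3 by (simp add: q_def)
  have main: "of_int q * \<Psi> v = of_int z * v" if v: "v \<in> I j" for v
  proof -
    have "\<Psi> v * of_nat p = \<Psi> (of_nat p) * v"
      using \<Psi>_mult[of "of_nat p" v] \<Psi>_mult[of v "of_nat p"] p v I_subset_O by (auto simp: mult.commute)
    then have "of_nat (p - 1) * (\<Psi> v * of_nat p) = of_int z * v"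
      by (simp only: z[symmetric] mult.assoc)
    then show ?thesis by (simp add: q_def mult_ac)
  qed
  define d where "d = \<psi> (unit_row j) j"
  have coords_val: "q * \<psi> r k = z * r k" if r: "r \<in> carrier (Rm j)" for r k
  proof -
    have rj: "val r \<in> I j" "r \<in> V" using r j by (simp_all add: carrier_Rmod_val)
    have \<psi>r: "\<psi> r \<in> V" using rmod_homD(1)[OF \<psi> r] by (simp add: carrier_Rmod)
    have "\<Psi> (val r) = val (\<psi> r)" using rj by (simp add: \<Psi>_def zeta_coords_val)
    then have "val (\<lambda>k. q * \<psi> r k) = val (\<lambda>k. z * r k)"
      using main[OF rj(1)] by (simp only: val_scale)
    then have "(\<lambda>k. q * \<psi> r k) = (\<lambda>k. z * r k)"
      using rj \<psi>r by (intro val_inj) (auto simp: V_def)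
    then show ?thesis by (rule fun_cong)
  qed
  \<comment> \<open>Coordinate \<open>j\<close> of the image of the unit row shows that the scalar
    \<open>z / q\<close>, so far only rational, is the integer \<open>d\<close>.\<close>
  have "q * d = z" using coords_val[OF unit_row_Rmod[OF j], of j] by (simp add: d_def unit_row_def)
  then have d: "\<psi> r = (\<lambda>k. d * r k)" if "r \<in> carrier (Rm j)" for r
    using coords_val[OF that] q by (intro ext) (metis mult.assoc mult_left_cancel)
  \<comment> \<open>The unit row has image in \<open>R(i)\<close>, whose entries in places before
    \<open>i\<close> are divisible by \<open>p\<close>; the entry in place \<open>j\<close> is
    \<open>d\<close>.\<close>
  have "int p dvd d" if "j < i"
    using rmod_homD(1)[OF \<psi> unit_row_Rmod[OF j]] that by (simp add: carrier_Rmod d_def)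
  with d show ?thesis by blast
qed

section \<open>Homomorphisms between direct sums as integer matrices\<close>

lemma Rsum_sel:
  "carrier (Rs S) = (\<Pi>\<^sub>E i\<in>S. carrier (Rm i))" "zero (Rs S) = (\<lambda>i\<in>S. \<lambda>_. 0)"
  "add (Rs S) = (\<lambda>s t. \<lambda>i\<in>S. \<lambda>j. s i j + t i j)" "ract (Rs S) = (\<lambda>s a. \<lambda>i\<in>S. vact (s i) a)"
  by (simp_all add: Rsum_def dsum_rmod_def)

lemma right_module_Rsum: "ring \<Lambda> \<Longrightarrow> S \<subseteq> Ps \<Longrightarrow> right_module \<Lambda> (Rs S)"
  unfolding Rsum_def by (intro right_module_dsum right_module_Rmod) auto

lemma Rsum_inj_hom: "ring \<Lambda> \<Longrightarrow> S \<subseteq> Ps \<Longrightarrow> j \<in> S \<Longrightarrow> dsum_inj S Rm j \<in> rmod_hom \<Lambda> (Rm j) (Rs S)"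
  unfolding Rsum_def by (intro dsum_inj_hom right_module_Rmod) auto

lemma Rsum_proj_hom: "j \<in> S \<Longrightarrow> (\<lambda>s. s j) \<in> rmod_hom \<Lambda> (Rs S) (Rm j)"
  by (rule rmod_homI) (auto simp: Rsum_sel)

text \<open>On each summand the homomorphism is an integer by \<open>hom_Rmod_scalar\<close>. The
  truncations \<open>cut T\<close> assemble these integers by adding one summand at a time.\<close>

lemma hom_Rsum_row:
  assumes ring: "ring \<Lambda>" and f: "f \<in> rmod_hom \<Lambda> (Rs S) (Rm i)" and S: "S \<subseteq> Ps" and i: "i \<in> Ps"
  shows "\<exists>M. (\<forall>s\<in>carrier (Rs S). f s = (\<lambda>k. \<Sum>j\<in>S. M j * s j k)) \<and>
    (\<forall>j\<in>S. j < i \<longrightarrow> int p dvd M j)"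
proof -
  have "\<forall>j\<in>S. \<exists>d. (\<forall>r\<in>carrier (Rm j). f (dsum_inj S Rm j r) = (\<lambda>k. d * r k)) \<and> (j < i \<longrightarrow> int p dvd d)"
  proof
    fix j assume j: "j \<in> S"
    have "(\<lambda>r. f (dsum_inj S Rm j r)) \<in> rmod_hom \<Lambda> (Rm j) (Rm i)"
      by (rule rmod_hom_compose[OF Rsum_inj_hom[OF ring S j] f])
    then show "\<exists>d. (\<forall>r\<in>carrier (Rm j). f (dsum_inj S Rm j r) = (\<lambda>k. d * r k)) \<and> (j < i \<longrightarrow> int p dvd d)"
      by (rule hom_Rmod_scalar[OF _ i subsetD[OF S j]])
  qed
  from bchoice[OF this] obtain M where M: "\<And>j r. j \<in> S \<Longrightarrow> r \<in> carrier (Rm j) \<Longrightarrow> f (dsum_inj S Rm j r) = (\<lambda>k. M j * r k)"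
    "\<And>j. j \<in> S \<Longrightarrow> j < i \<Longrightarrow> int p dvd M j" by blast
  have "finite S" using S finite_subset by blast
  interpret A: right_module \<Lambda> "Rs S" by (rule right_module_Rsum[OF ring S])
  interpret B: right_module \<Lambda> "Rm i" by (rule right_module_Rmod[OF ring i])
  have zero_mem: "(\<lambda>_. 0) \<in> carrier (Rm j)" for j by (simp add: carrier_Rmod V_def)
  have f_eq: "f s = (\<lambda>k. \<Sum>j\<in>S. M j * s j k)" if s: "s \<in> carrier (Rs S)" for s
  proof -
    define cut where "cut T = (\<lambda>l\<in>S. if l \<in> T then s l else (\<lambda>_. 0))" for T
    have "f (cut T) = (\<lambda>k. \<Sum>j\<in>T. M j * s j k)" if "finite T" "T \<subseteq> S" for T
      using that
    proof (induction T)
      case empty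
      have "cut {} = \<zero>\<^bsub>Rs S\<^esub>" by (simp add: cut_def Rsum_sel)
      then show ?case
        using rmod_hom_zero[OF A.M.abelian_group_axioms B.M.abelian_group_axioms f] by simp
    next
      case (insert j T)
      have j: "j \<in> S" "s j \<in> carrier (Rm j)" using insert s by (auto simp: Rsum_sel)
      have T: "cut T \<in> carrier (Rs S)" using s zero_mem by (auto simp: Rsum_sel cut_def)
      have "dsum_inj S Rm j (s j) \<in> carrier (Rs S)"
        using rmod_homD(1)[OF Rsum_inj_hom[OF ring S j(1)] j(2)] .
      moreover have "cut (insert j T) = dsum_inj S Rm j (s j) \<oplus>\<^bsub>Rs S\<^esub> cut T"
        using insert by (auto simp: Rsum_sel dsum_inj_def fun_eq_iff cut_def)
      ultimately have "f (cut (insert j T)) = (\<lambda>k. M j * s j k + (\<Sum>j\<in>T. M j * s j k))"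
        using rmod_homD(2)[OF f _ T] M(1)[OF j] insert by simp
      then show ?case using insert by simp
    qed
    from this[OF \<open>finite S\<close> subset_refl]
    have "f (cut S) = (\<lambda>k. \<Sum>j\<in>S. M j * s j k)" .
    moreover have "cut S = s"
      using s by (auto simp: Rsum_sel fun_eq_iff PiE_iff extensional_def cut_def)
    ultimately show ?thesis by simp
  qed
  then show ?thesis using M(2) by blast
qed

definition mat_map :: "nat set \<Rightarrow> nat set \<Rightarrow> (nat \<Rightarrow> nat \<Rightarrow> int) \<Rightarrow> (nat \<Rightarrow> nat \<Rightarrow> int) \<Rightarrow> nat \<Rightarrow> nat \<Rightarrow> int" where
  "mat_map S T M s = (\<lambda>i\<in>T. \<lambda>k. \<Sum>j\<in>S. M i j * s j k)"

lemma vact_sum: "vact (\<lambda>k. \<Sum>j\<in>S. c j * s j k) a = (\<lambda>k. \<Sum>j\<in>S. c j * vact (s j) a k)"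
proof
  fix l
  have "vact (\<lambda>k. \<Sum>j\<in>S. c j * s j k) a l = (\<Sum>k\<in>Ps. \<Sum>j\<in>S. c j * (s j k * lambda_tilde p m a k l))"
    by (simp add: vact_def sum_distrib_right mult.assoc)
  also have "\<dots> = (\<Sum>j\<in>S. \<Sum>k\<in>Ps. c j * (s j k * lambda_tilde p m a k l))" by (rule sum.swap)
  finally show "vact (\<lambda>k. \<Sum>j\<in>S. c j * s j k) a l = (\<Sum>j\<in>S. c j * vact (s j) a l)"
    by (simp add: vact_def sum_distrib_left)
qed

text \<open>For \<open>j \<ge> i\<close> the rows of \<open>R(j)\<close> already belong to
  \<open>R(i)\<close>; for \<open>j < i\<close> the factor \<open>p\<close> in the entry makes up
  for it. Linearity holds because \<open>M\<close> acts on the index of the summand and the ring on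
  the coordinates.\<close>

lemma mat_map_hom:
  assumes M: "\<And>i j. i \<in> T \<Longrightarrow> j \<in> S \<Longrightarrow> j < i \<Longrightarrow> int p dvd M i j"
  shows "mat_map S T M \<in> rmod_hom \<Lambda> (Rs S) (Rs T)"
proof (rule rmod_homI)
  fix s assume s: "s \<in> carrier (Rs S)"
  then have sj: "s j \<in> carrier (Rm j)" if "j \<in> S" for j using that by (auto simp: Rsum_sel)
  have "(\<lambda>k. \<Sum>j\<in>S. M i j * s j k) \<in> carrier (Rm i)" if i: "i \<in> T" for i
  proof -
    have "int p dvd M i j * s j k" if "j \<in> S" "k < i" for j k
    proof (cases "j < i")
      case True
      then show ?thesis using M[OF i that(1)] by simp
    next
      case False
      then show ?thesis using sj[OF that(1)] that(2) by (simp add: carrier_Rmod)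
    qed
    then show ?thesis using sj by (auto simp: carrier_Rmod V_def intro!: dvd_sum)
  qed
  then show "mat_map S T M s \<in> carrier (Rs T)" by (auto simp: mat_map_def Rsum_sel)
next
  fix s s' assume "s \<in> carrier (Rs S)" "s' \<in> carrier (Rs S)"
  then show "mat_map S T M (s \<oplus>\<^bsub>Rs S\<^esub> s') = mat_map S T M s \<oplus>\<^bsub>Rs T\<^esub> mat_map S T M s'"
    by (auto simp: mat_map_def Rsum_sel fun_eq_iff distrib_left sum.distrib)
next
  fix s a
  show "mat_map S T M (s \<cdot>\<^bsub>Rs S\<^esub> a) = mat_map S T M s \<cdot>\<^bsub>Rs T\<^esub> a"
    by (auto simp: mat_map_def Rsum_sel fun_eq_iff vact_sum)
qed

lemma mat_map_mat_map:
  "mat_map T U N (mat_map S T M s) = mat_map S U (mat_prod T N M) s"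
proof (intro ext)
  fix i k
  have "(\<Sum>j\<in>T. N i j * (\<Sum>l\<in>S. M j l * s l k)) = (\<Sum>j\<in>T. \<Sum>l\<in>S. N i j * M j l * s l k)"
    by (simp add: sum_distrib_left mult.assoc)
  also have "\<dots> = (\<Sum>l\<in>S. \<Sum>j\<in>T. N i j * M j l * s l k)" by (rule sum.swap)
  finally show "mat_map T U N (mat_map S T M s) i k = mat_map S U (mat_prod T N M) s i k"
    by (simp add: mat_map_def mat_prod_def sum_distrib_right)
qed

lemma mat_map_one:
  assumes "finite S" "s \<in> carrier (Rs S)" "\<And>i j. i \<in> S \<Longrightarrow> j \<in> S \<Longrightarrow> M i j = mat_one i j"
  shows "mat_map S S M s = s"
proof (intro ext)
  fix i k
  show "mat_map S S M s i k = s i k"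
  proof (cases "i \<in> S")
    case True
    then have "mat_map S S M s i k = (\<Sum>j\<in>S. if i = j then s j k else 0)"
      using assms(3) by (auto simp: mat_map_def mat_one_def intro!: sum.cong)
    then show ?thesis using True assms(1) by simp
  next
    case False
    then show ?thesis using assms(2) by (auto simp: mat_map_def Rsum_sel PiE_iff extensional_def)
  qed
qed

section \<open>Homomorphisms that factor through \<Lambda>\<close>

lemma Psi_props:
  assumes "is_Psi p m \<iota>"
  shows "\<iota> \<in> rmod_hom \<Lambda> (Rs Ps) (regular_rmod \<Lambda>)" and "inj_on \<iota> (carrier (Rs Ps))"
    and "a \<in> carrier \<Lambda> \<Longrightarrow> eps p a = (\<lambda>_. 0) \<Longrightarrow> a \<in> \<iota> ` carrier (Rs Ps)"
proof -
  have z: "\<zero>\<^bsub>ZC_rmod p\<^esub> = (\<lambda>_. 0)" by (simp add: ZC_rmod_def restrict_rmod_def ZC_def int_group_ring_def)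
  have ker: "\<iota> ` carrier (Rs Ps) = {a \<in> carrier \<Lambda>. eps p a = (\<lambda>_. 0)}"
    using assms by (simp add: is_Psi_def short_exact_def z)
  show "\<iota> \<in> rmod_hom \<Lambda> (Rs Ps) (regular_rmod \<Lambda>)" "inj_on \<iota> (carrier (Rs Ps))"
    using assms by (simp_all add: is_Psi_def short_exact_def)
  show "a \<in> carrier \<Lambda> \<Longrightarrow> eps p a = (\<lambda>_. 0) \<Longrightarrow> a \<in> \<iota> ` carrier (Rs Ps)"
    using ker by blast+
qed

text \<open>The homomorphism from the free module \<Lambda> that sends 1 to \<open>r\<close>. Maps
  of this kind carry the part of a homomorphism that vanishes in the derived category.\<close>

lemma vact_hom:
  assumes "ring \<Lambda>" "i \<in> Ps" "r \<in> carrier (Rm i)"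
  shows "vact r \<in> rmod_hom \<Lambda> (regular_rmod \<Lambda>) (Rm i)"
proof -
  interpret right_module \<Lambda> "Rm i" by (rule right_module_Rmod[OF assms(1,2)])
  show ?thesis
    using ract_closed[OF assms(3)] ract_add_right[OF assms(3)] ract_mult[OF assms(3)]
    by (intro rmod_homI) simp_all
qed

text \<open>Let \<open>\<iota> w = x - 1\<close>, and let \<open>U\<close> be the integer matrix with \<open>e\<^sub>k \<cdot> \<iota> s = \<Sum>j. U k j * s j\<close>. Then
  \<open>t ^ (k + 1) = \<Sum>j. U k j * w j\<close>, so the \<open>w j\<close> are linearly independent, and the row \<open>b\<close> of value
  \<open>(\<Sum>j. N j * w j) / t\<close> satisfies \<open>b U = N\<close>.\<close>

lemma row_factors_through_Psi:
  assumes ring: "ring \<Lambda>" and Psi: "is_Psi p m \<iota>" and i: "i \<in> Ps"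
    and N: "\<And>j. j \<in> Ps \<Longrightarrow> j \<le> i \<Longrightarrow> int p dvd N j"
  shows "\<exists>b\<in>carrier (Rm i). \<forall>s\<in>carrier (Rs Ps). vact b (\<iota> s) = (\<lambda>k. \<Sum>j\<in>Ps. N j * s j k)"
proof -
  note \<iota> = Psi_props[OF Psi]
  have "\<forall>k\<in>Ps. \<exists>M. \<forall>s\<in>carrier (Rs Ps). vact (unit_row k) (\<iota> s) = (\<lambda>l. \<Sum>j\<in>Ps. M j * s j l)"
  proof
    fix k assume k: "k \<in> Ps"
    have "(\<lambda>s. vact (unit_row k) (\<iota> s)) \<in> rmod_hom \<Lambda> (Rs Ps) (Rm k)"
      by (rule rmod_hom_compose[OF \<iota>(1) vact_hom[OF ring k unit_row_Rmod[OF k]]])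
    from hom_Rsum_row[OF ring this subset_refl k]
    show "\<exists>M. \<forall>s\<in>carrier (Rs Ps). vact (unit_row k) (\<iota> s) = (\<lambda>l. \<Sum>j\<in>Ps. M j * s j l)"
      by blast
  qed
  from bchoice[OF this] obtain U where U: "\<And>k s. k \<in> Ps \<Longrightarrow> s \<in> carrier (Rs Ps) \<Longrightarrow>
      vact (unit_row k) (\<iota> s) = (\<lambda>l. \<Sum>j\<in>Ps. U k j * s j l)" by blast

  define X where "X = (\<lambda>g. delta [(Gen_x, True)] g - delta [] g)"
  have "{g. X g \<noteq> 0} \<subseteq> {cls [(Gen_x, True)], cls []}" by (auto simp: X_def delta_def)
  then have X: "X \<in> carrier \<Lambda>"
    using finite_subset[of "{g. X g \<noteq> 0}"] by (auto simp: carrier_Lam carrier_G)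
  have "delta [(Gen_x, True)] = X \<oplus>\<^bsub>\<Lambda>\<^esub> delta []" by (simp add: add_Lam X_def)
  then have X_add: "lact v (delta [(Gen_x, True)]) = lact v X + lact v (delta [])" for v
    using lact_add_right[OF X, of "delta []" v] by simp
  have lact_X: "lact v X = v * t" if "v \<in> \<O>" for v
    using X_add[of v] that by (simp add: lact_delta zeta_eq algebra_simps)
  obtain w where w: "w \<in> carrier (Rs Ps)" "X = \<iota> w"
    using \<iota>(3)[OF X] eps_x_minus_1 by (auto simp: X_def)
  have wj: "w j \<in> carrier (Rm j)" if "j \<in> Ps" for j using w that by (auto simp: Rsum_sel)
  have shift: "t ^ Suc k = (\<Sum>j\<in>Ps. of_int (U k j) * val (w j))" if k: "k \<in> Ps" for k
  proof -
    have "t ^ Suc k = val (vact (unit_row k) X)"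
      using k by (simp add: val_vact X val_unit_row lact_X O_power)
    also have "\<dots> = (\<Sum>j\<in>Ps. of_int (U k j) * val (w j))"
      using U[OF k w(1)] by (simp add: w(2) val_sum val_scale)
    finally show ?thesis .
  qed
  have combine: "(\<Sum>k\<in>Ps. of_int (v k) * t ^ Suc k) = (\<Sum>j\<in>Ps. of_int (\<Sum>k\<in>Ps. v k * U k j) * val (w j))" for v
  proof -
    have "(\<Sum>k\<in>Ps. of_int (v k) * t ^ Suc k) = (\<Sum>k\<in>Ps. \<Sum>j\<in>Ps. of_int (v k * U k j) * val (w j))"
      by (rule sum.cong) (simp_all only: shift sum_distrib_left of_int_mult mult.assoc)
    also have "\<dots> = (\<Sum>j\<in>Ps. \<Sum>k\<in>Ps. of_int (v k * U k j) * val (w j))" by (rule sum.swap)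
    finally show ?thesis by (simp add: sum_distrib_right)
  qed
  have val_w: "(\<Sum>j\<in>Ps. of_int (c j) * val (w j)) = val (\<lambda>l. \<Sum>j\<in>Ps. c j * w j l)" for c
    by (simp add: val_sum val_scale)
  \<comment> \<open>By \<open>combine\<close>, a vector \<open>v\<close> annihilated by the product
    of \<open>U\<close> with the matrix of rows \<open>w j\<close> satisfies
    \<open>t * val v = 0\<close>, so this product has trivial left kernel. The square factor formed
    by the \<open>w j\<close> inherits this.\<close>
  have w_indep: "c j = 0" if c: "(\<Sum>j\<in>Ps. of_int (c j) * val (w j)) = 0" and j: "j \<in> Ps" for c j
  proof (rule left_kernel_trivial_of_factor[where n = "p - 1" and U = U and W = w, OF _ _ j])
    fix l
    have "val (\<lambda>l. \<Sum>j\<in>Ps. c j * w j l) = val (\<lambda>_. 0)" using c unfolding val_w by (simp add: val_def)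
    then have "(\<lambda>l. \<Sum>j\<in>Ps. c j * w j l) = (\<lambda>_. 0)"
      using wj by (intro val_inj) (auto simp: V_def carrier_Rmod)
    then show "(\<Sum>j\<in>Ps. c j * w j l) = 0" by (rule fun_cong)
  next
    fix v k assume *: "\<And>l. l \<in> Ps \<Longrightarrow> (\<Sum>k\<in>Ps. v k * (\<Sum>j\<in>Ps. U k j * w j l)) = 0" and k: "k \<in> Ps"
    have "(\<Sum>j\<in>Ps. (\<Sum>k\<in>Ps. v k * U k j) * w j l) = (\<Sum>k\<in>Ps. v k * (\<Sum>j\<in>Ps. U k j * w j l))" for l
      unfolding sum_distrib_right sum_distrib_left by (subst sum.swap) (simp add: mult.assoc)
    then have "(\<Sum>j\<in>Ps. (\<Sum>k\<in>Ps. v k * U k j) * w j l) = 0" if "l \<in> Ps" for l using * that by simp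
    then have "val (\<lambda>l. \<Sum>j\<in>Ps. (\<Sum>k\<in>Ps. v k * U k j) * w j l) = 0" by (simp add: val_def)
    then have "(\<Sum>k\<in>Ps. of_int (v k) * t ^ Suc k) = 0" by (simp only: combine val_w)
    moreover have "(\<Sum>k\<in>Ps. of_int (v k) * t ^ Suc k) = t * val v"
      by (simp add: val_def sum_distrib_left mult_ac)
    ultimately have "val v = 0" by simp
    then have "val (\<lambda>k. if k \<in> Ps then v k else 0) = val (\<lambda>_. 0)" by (simp add: val_def)
    then have "(\<lambda>k. if k \<in> Ps then v k else 0) = (\<lambda>_. 0)" by (intro val_inj) (auto simp: V_def)
    then show "v k = 0" using k by (metis (full_types))
  qed

  define y where "y = (\<Sum>j\<in>Ps. of_int (N j) * val (w j))"
  \<comment> \<open>The exponent is \<open>i + 1\<close> since one factor \<open>t\<close> will be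
    divided out. For \<open>j \<le> i\<close> it comes from \<open>p\<close> dividing
    \<open>N j\<close>, as \<open>p * t\<close> lies in \<open>I p\<close>; for \<open>j > i\<close>
    it comes from \<open>w j\<close> being a row of \<open>R(j)\<close>. The case
    \<open>j = i\<close> is where divisibility on the diagonal enters.\<close>
  have "of_int (N j) * val (w j) \<in> I (Suc i)" if j: "j \<in> Ps" for j
  proof (cases "j \<le> i")
    case True
    then obtain d where "N j = int p * d" using N[OF j] by (auto simp: dvd_def)
    then have "of_int (N j) * val (w j) = of_int d * (of_nat p * val (w j))" by simp
    moreover have "of_nat p * val (w j) \<in> I (p - 1 + 1)" by (intro I_mult_I p_in_I val_in_I_1)
    moreover have "I (p - 1 + 1) \<subseteq> I (Suc i)" using i by (intro I_antimono) auto
    ultimately show ?thesis by (metis I_mult' O_int subsetD)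
  next
    case False
    then have "I j \<subseteq> I (Suc i)" by (intro I_antimono) auto
    moreover have "val (w j) \<in> I j" using wj[OF j] j by (simp add: carrier_Rmod_val)
    ultimately show ?thesis by (metis I_mult' O_int subsetD)
  qed
  then have "y \<in> I (Suc i)" unfolding y_def by (rule I_sum)
  then obtain u where u: "u \<in> \<O>" "y = t ^ Suc i * u" by (auto simp: I_iff)
  define b where "b = zeta_coords p (t ^ i * u)"
  have ui: "t ^ i * u \<in> I i" using u by (auto simp: I_iff)
  then have "t ^ i * u \<in> I 1" using I_antimono[of 1 i] i by auto
  then have b: "b \<in> V" "val b = t ^ i * u" using zeta_coords by (auto simp: b_def)
  have bi: "b \<in> carrier (Rm i)" using b ui i by (simp add: carrier_Rmod_val)
  \<comment> \<open>Both \<open>b U\<close> and \<open>N\<close>, combined with the values of the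
    \<open>w j\<close>, give \<open>t * val b = y\<close>; independence then allows the coefficients
    to be compared.\<close>
  have "(\<Sum>j\<in>Ps. of_int (\<Sum>k\<in>Ps. b k * U k j) * val (w j)) = t * val b"
    by (simp only: combine[symmetric]) (simp add: val_def sum_distrib_left mult_ac)
  also have "\<dots> = y" using b u by simp
  finally have "(\<Sum>j\<in>Ps. of_int ((\<Sum>k\<in>Ps. b k * U k j) - N j) * val (w j)) = 0"
    by (simp add: y_def left_diff_distrib sum_subtractf)
  then have bU: "(\<Sum>k\<in>Ps. b k * U k j) = N j" if "j \<in> Ps" for j
    using w_indep[OF _ that] by fastforce
  have "vact b (\<iota> s) = (\<lambda>k. \<Sum>j\<in>Ps. N j * s j k)" if s: "s \<in> carrier (Rs Ps)" for s
  proof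
    fix l
    have row: "lambda_tilde p m (\<iota> s) k l = (\<Sum>j\<in>Ps. U k j * s j l)" if "k \<in> Ps" for k
    proof -
      have "vact (unit_row k) (\<iota> s) l = (\<Sum>k'\<in>Ps. if k' = k then lambda_tilde p m (\<iota> s) k' l else 0)"
        unfolding vact_def by (rule sum.cong) (auto simp: unit_row_def)
      also have "\<dots> = lambda_tilde p m (\<iota> s) k l" using that by simp
      finally show ?thesis using U[OF that s] by simp
    qed
    have "vact b (\<iota> s) l = (\<Sum>k\<in>Ps. \<Sum>j\<in>Ps. b k * U k j * s j l)"
      unfolding vact_def by (rule sum.cong) (simp_all add: row sum_distrib_left mult.assoc)
    also have "\<dots> = (\<Sum>j\<in>Ps. (\<Sum>k\<in>Ps. b k * U k j) * s j l)"
      by (subst sum.swap) (simp add: sum_distrib_right)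
    also have "\<dots> = (\<Sum>j\<in>Ps. N j * s j l)" by (rule sum.cong[OF refl]) (simp only: bU)
    finally show "vact b (\<iota> s) l = (\<Sum>j\<in>Ps. N j * s j l)" .
  qed
  with bi show ?thesis by blast
qed

subsection \<open>Extensions with non-zero \<open>k\<close>-invariants\<close>

lemma Rsum_mat_map_automorphism:
  assumes inv: "inverse_mats Ps F G" and s: "s \<in> carrier (Rs Ps)"
  shows "mat_map Ps Ps F (mat_map Ps Ps G s) = s" "mat_map Ps Ps G (mat_map Ps Ps F s) = s"
  unfolding mat_map_mat_map
  by (rule mat_map_one; use inv s in \<open>simp add: inverse_mats_def\<close>)+

lemma isomorphic_quotient_by_Rmod:
  assumes ring: "ring \<Lambda>" and Psi: "is_Psi p m \<iota>" and n: "n \<in> Ps"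
    and K: "right_module \<Lambda> K"
    and exK: "short_exact \<Lambda> (Rs (Ps - {n})) \<alpha> K \<beta> (ZC_rmod p)"
    and kinv: "is_k_invariants p m n \<iota> \<alpha> K \<beta> \<kappa>"
    and nz: "\<forall>i\<in>Ps - {n}. \<kappa> i \<noteq> 0"
  shows "\<exists>h\<in>rmod_hom \<Lambda> (Rm n) (regular_rmod \<Lambda>). inj_on h (carrier (Rm n)) \<and>
    rmod_isomorphic \<Lambda> K (quot_rmod (regular_rmod \<Lambda>) (h ` carrier (Rm n)))"
proof -
  define Q where "Q = Ps - {n}"
  have Q: "Q \<subseteq> Ps" "finite Q" "n \<notin> Q" "Ps = insert n Q" using n by (auto simp: Q_def)
  let ?A = "Rs Ps" and ?B = "Rs Q" and ?L = "regular_rmod \<Lambda>"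
  note \<iota> = Psi_props[OF Psi]
  have RM: "right_module \<Lambda> ?L" "right_module \<Lambda> ?A" "right_module \<Lambda> ?B"
    using right_module_regular[OF ring] right_module_Rsum[OF ring subset_refl] right_module_Rsum[OF ring Q(1)]
    by blast+
  obtain f where f: "f \<in> rmod_hom \<Lambda> ?A ?B"
    and cong: "congruent_ext \<Lambda> ?B \<alpha> K \<beta> (pushout_in ?A \<iota> ?L f ?B) (pushout_rmod ?A \<iota> ?L f ?B) (pushout_out (eps p))"
    and diag: "\<And>i. i \<in> Q \<Longrightarrow> \<exists>d. (\<forall>r\<in>carrier (Rm i). f (dsum_inj Ps Rm i r) i = (\<lambda>j. d * r j)) \<and> \<kappa> i = d mod int p"
    using kinv unfolding is_k_invariants_def Let_def Q_def[symmetric] by blast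

  have "\<forall>i\<in>Q. \<exists>M. (\<forall>s\<in>carrier ?A. f s i = (\<lambda>k. \<Sum>j\<in>Ps. M j * s j k)) \<and> (\<forall>j\<in>Ps. j < i \<longrightarrow> int p dvd M j)"
  proof
    fix i assume i: "i \<in> Q"
    have "(\<lambda>s. f s i) \<in> rmod_hom \<Lambda> ?A (Rm i)"
      by (rule rmod_hom_compose[OF f Rsum_proj_hom[OF i]])
    then show "\<exists>M. (\<forall>s\<in>carrier ?A. f s i = (\<lambda>k. \<Sum>j\<in>Ps. M j * s j k)) \<and> (\<forall>j\<in>Ps. j < i \<longrightarrow> int p dvd M j)"
      by (rule hom_Rsum_row[OF ring _ subset_refl subsetD[OF Q(1) i]])
  qed
  from bchoice[OF this] obtain M where M: "\<And>i s. i \<in> Q \<Longrightarrow> s \<in> carrier ?A \<Longrightarrow> f s i = (\<lambda>k. \<Sum>j\<in>Ps. M i j * s j k)"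
    and M_dvd: "\<And>i j. i \<in> Q \<Longrightarrow> j \<in> Ps \<Longrightarrow> j < i \<Longrightarrow> int p dvd M i j" by blast
  have inj_mem: "dsum_inj Ps Rm j r \<in> carrier ?A" if "j \<in> Ps" "r \<in> carrier (Rm j)" for j r
    using rmod_homD(1)[OF Rsum_inj_hom[OF ring subset_refl that(1)] that(2)] .
  have inj_row: "(\<Sum>j\<in>Ps. c j * dsum_inj Ps Rm i r j k) = c i * r k" if "i \<in> Ps" for c i r k
  proof -
    have "(\<Sum>j\<in>Ps. c j * dsum_inj Ps Rm i r j k) = (\<Sum>j\<in>Ps. if j = i then c j * r k else 0)"
      by (rule sum.cong) (auto simp: dsum_inj_def)
    then show ?thesis using that by simp
  qed
  \<comment> \<open>Evaluating on a unit row identifies \<open>M i i\<close> with the integer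
    \<open>d\<close> of the definition of the k-invariants, whose residue \<open>\<kappa> i\<close>
    is non-zero.\<close>
  have cop: "coprime (M i i) (int p)" if i: "i \<in> Ps - {n}" for i
  proof -
    have iP: "i \<in> Ps" "i \<in> Q" using i by (auto simp: Q_def)
    obtain d where d: "\<forall>r\<in>carrier (Rm i). f (dsum_inj Ps Rm i r) i = (\<lambda>j. d * r j)" "\<kappa> i = d mod int p"
      using diag[OF iP(2)] by blast
    note e = unit_row_Rmod[OF iP(1)]
    have "f (dsum_inj Ps Rm i (unit_row i)) i = (\<lambda>k. M i i * unit_row i k)"
      using M[OF iP(2) inj_mem[OF iP(1) e]] inj_row[OF iP(1)] by simp
    then have "(\<lambda>k. M i i * unit_row i k) = (\<lambda>k. d * unit_row i k)" using d(1) e by metis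
    from fun_cong[OF this, of i] have "M i i = d" by (simp add: unit_row_def)
    then have "\<not> int p dvd M i i" using d(2) nz i by (auto simp: dvd_eq_mod_eq_0)
    then show ?thesis using prime_p by (metis coprime_commute prime_imp_coprime prime_nat_int_transfer)
  qed
  obtain F G where inv: "inverse_mats Ps F G"
    and dF: "diagonal_mod (int p) Ps F" and dG: "diagonal_mod (int p) Ps G"
    and FM: "\<And>i. i \<in> Ps - {n} \<Longrightarrow> [F i i = M i i] (mod int p)"
    using ex_inverse_mats_with_diagonal[OF _ n, where q = "int p" and d = "\<lambda>i. M i i"] cop by blast
  have F_dvd: "int p dvd F i j" and G_dvd: "int p dvd G i j" if "i \<in> Ps" "j \<in> Ps" "j < i" for i j
    using dF dG that by (auto simp: diagonal_mod_def)

  \<comment> \<open>Below the diagonal both \<open>M i j\<close> and \<open>F i j\<close> are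
    divisible by \<open>p\<close>, and on it they are congruent. Above it any integers will do, so
    \<open>M\<close> and \<open>F\<close> may differ there arbitrarily.\<close>
  have "\<forall>i\<in>Q. \<exists>b. b \<in> carrier (Rm i) \<and> (\<forall>s\<in>carrier ?A. vact b (\<iota> s) = (\<lambda>k. \<Sum>j\<in>Ps. (M i j - F i j) * s j k))"
  proof
    fix i assume i: "i \<in> Q"
    have iP: "i \<in> Ps" "i \<in> Ps - {n}" using i Q_def by auto
    have "int p dvd M i j - F i j" if "j \<in> Ps" "j \<le> i" for j
    proof (cases "j = i")
      case True
      then show ?thesis using FM[OF iP(2)] by (metis cong_iff_dvd_diff cong_sym)
    next
      case False
      then show ?thesis using M_dvd[OF i] F_dvd[OF iP(1)] that by (simp add: dvd_diff)
    qed
    then show "\<exists>b. b \<in> carrier (Rm i) \<and> (\<forall>s\<in>carrier ?A. vact b (\<iota> s) = (\<lambda>k. \<Sum>j\<in>Ps. (M i j - F i j) * s j k))"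
      using row_factors_through_Psi[OF ring Psi iP(1), of "\<lambda>j. M i j - F i j"] by blast
  qed
  from bchoice[OF this] obtain b where b: "\<And>i. i \<in> Q \<Longrightarrow> b i \<in> carrier (Rm i)"
    and b_row: "\<And>i s. i \<in> Q \<Longrightarrow> s \<in> carrier ?A \<Longrightarrow>
      vact (b i) (\<iota> s) = (\<lambda>k. \<Sum>j\<in>Ps. (M i j - F i j) * s j k)" by blast

  define g where "g l = (\<lambda>i\<in>Q. vact (b i) l)" for l
  have g: "g \<in> rmod_hom \<Lambda> ?L ?B"
  proof (rule rmod_homI)
    have hom: "vact (b i) \<in> rmod_hom \<Lambda> ?L (Rm i)" if "i \<in> Q" for i
      using vact_hom[OF ring _ b[OF that]] that Q(1) by blast
    fix l l' assume l: "l \<in> carrier ?L"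
    show "g l \<in> carrier ?B" using rmod_homD(1)[OF hom] l by (auto simp: g_def Rsum_sel)
    show "g (l \<oplus>\<^bsub>?L\<^esub> l') = g l \<oplus>\<^bsub>?B\<^esub> g l'" if "l' \<in> carrier ?L"
      using rmod_homD(2)[OF hom] l that by (auto simp: g_def Rsum_sel fun_eq_iff)
    show "g (l \<cdot>\<^bsub>?L\<^esub> a) = g l \<cdot>\<^bsub>?B\<^esub> a" if "a \<in> carrier \<Lambda>" for a
      using rmod_homD(3)[OF hom] l that by (auto simp: g_def Rsum_sel fun_eq_iff)
  qed
  \<comment> \<open>\<open>f'\<close> omits row \<open>n\<close> of \<open>F\<close> and
    \<open>s\<close> omits column \<open>n\<close> of \<open>G\<close>. The products still run over
    all of \<open>Ps\<close>, so \<open>F G = 1\<close> restricted to the other indices says that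
    \<open>f' s\<close> is the identity.\<close>
  define f' where "f' = mat_map Ps Q F"
  define s where "s = mat_map Q Ps G"
  have f': "f' \<in> rmod_hom \<Lambda> ?A ?B" unfolding f'_def
    by (rule mat_map_hom) (use F_dvd Q(1) in blast)
  have s: "s \<in> rmod_hom \<Lambda> ?B ?A" unfolding s_def
    by (rule mat_map_hom) (use G_dvd Q(1) in blast)
  have f_eq: "f a = f' a \<oplus>\<^bsub>?B\<^esub> g (\<iota> a)" if a: "a \<in> carrier ?A" for a
  proof
    fix i
    show "f a i = (f' a \<oplus>\<^bsub>?B\<^esub> g (\<iota> a)) i"
    proof (cases "i \<in> Q")
      case True
      then show ?thesis
        using M[OF True a] b_row[OF True a]
        by (simp add: f'_def mat_map_def g_def Rsum_sel sum.distrib[symmetric] algebra_simps)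
    next
      case False
      then show ?thesis using rmod_homD(1)[OF f a] by (auto simp: Rsum_sel PiE_iff extensional_def)
    qed
  qed
  have split: "f' (s x) = x" if "x \<in> carrier ?B" for x
    unfolding f'_def s_def mat_map_mat_map
    using that inv Q by (intro mat_map_one) (auto simp: inverse_mats_def)
  have ZC: "abelian_group (ZC_rmod p)"
  proof (rule abelian_groupI)
    fix x assume x: "x \<in> carrier (ZC_rmod p)"
    have "(\<lambda>k. - x k) \<in> carrier (ZC_rmod p)"
      using x by (simp add: ZC_rmod_def restrict_rmod_def ZC_def int_group_ring_def)
    then show "\<exists>y\<in>carrier (ZC_rmod p). y \<oplus>\<^bsub>ZC_rmod p\<^esub> x = \<zero>\<^bsub>ZC_rmod p\<^esub>"
      by (rule rev_bexI) (simp add: ZC_rmod_def restrict_rmod_def ZC_def int_group_ring_def)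
  next
    fix x y assume xy: "x \<in> carrier (ZC_rmod p)" "y \<in> carrier (ZC_rmod p)"
    have "{k. x k + y k \<noteq> 0} \<subseteq> {k. x k \<noteq> 0} \<union> {k. y k \<noteq> 0}" by auto
    then show "x \<oplus>\<^bsub>ZC_rmod p\<^esub> y \<in> carrier (ZC_rmod p)"
      using xy finite_subset by (auto simp: ZC_rmod_def restrict_rmod_def ZC_def int_group_ring_def)
  qed (auto simp: ZC_rmod_def restrict_rmod_def ZC_def int_group_ring_def add_ac)
  have exL: "short_exact \<Lambda> ?A \<iota> ?L (eps p) (ZC_rmod p)" using Psi by (simp only: is_Psi_def)
  have iso: "rmod_isomorphic \<Lambda> K (quot_rmod ?L (\<iota> ` {a \<in> carrier ?A. f' a = \<zero>\<^bsub>?B\<^esub>}))"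
    by (rule pushout_isomorphic_quotient[OF K RM ZC exL exK[folded Q_def] cong f f' s g])
      (rule f_eq, assumption, rule split, assumption)

  \<comment> \<open>An element lies in the kernel of \<open>f'\<close> iff \<open>F\<close> maps it
    into the summand of index \<open>n\<close>. So this kernel is the image of that summand under
    \<open>G\<close>, which \<iota> then carries into \<Lambda>.\<close>
  define h where "h r = \<iota> (mat_map Ps Ps G (dsum_inj Ps Rm n r))" for r
  have GA: "mat_map Ps Ps G \<in> rmod_hom \<Lambda> ?A ?A" by (rule mat_map_hom) (rule G_dvd)
  have FA: "mat_map Ps Ps F \<in> rmod_hom \<Lambda> ?A ?A" by (rule mat_map_hom) (rule F_dvd)
  have h: "h \<in> rmod_hom \<Lambda> (Rm n) ?L"
    unfolding h_def
    by (rule rmod_hom_compose[OF rmod_hom_compose[OF Rsum_inj_hom[OF ring subset_refl n] GA] \<iota>(1)])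
  note auto = Rsum_mat_map_automorphism[OF inv]
  have "inj_on h (carrier (Rm n))"
  proof (rule inj_onI)
    fix r r' assume r: "r \<in> carrier (Rm n)" and r': "r' \<in> carrier (Rm n)" and eq: "h r = h r'"
    note mem = inj_mem[OF n r] inj_mem[OF n r']
    from eq have "mat_map Ps Ps G (dsum_inj Ps Rm n r) = mat_map Ps Ps G (dsum_inj Ps Rm n r')"
      unfolding h_def by (rule inj_onD[OF \<iota>(2)]) (use rmod_homD(1)[OF GA] mem in auto)
    then have "dsum_inj Ps Rm n r = dsum_inj Ps Rm n r'" using auto(1)[OF mem(1)] auto(1)[OF mem(2)] by simp
    from fun_cong[OF this, of n] show "r = r'" using n by (simp add: dsum_inj_def)
  qed
  moreover have "\<iota> ` {a \<in> carrier ?A. f' a = \<zero>\<^bsub>?B\<^esub>} = h ` carrier (Rm n)"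
  proof (intro equalityI subsetI)
    fix l assume "l \<in> \<iota> ` {a \<in> carrier ?A. f' a = \<zero>\<^bsub>?B\<^esub>}"
    then obtain a where a: "a \<in> carrier ?A" "f' a = \<zero>\<^bsub>?B\<^esub>" "l = \<iota> a" by blast
    define r where "r = mat_map Ps Ps F a n"
    have Fa: "mat_map Ps Ps F a \<in> carrier ?A" by (rule rmod_homD(1)[OF FA a(1)])
    then have r: "r \<in> carrier (Rm n)" using n by (auto simp: r_def Rsum_sel)
    have "mat_map Ps Ps F a = dsum_inj Ps Rm n r"
    proof
      fix i
      show "mat_map Ps Ps F a i = dsum_inj Ps Rm n r i"
      proof (cases "i \<in> Q")
        case True
        have "f' a i = (\<lambda>_. 0)" using a(2) True by (simp add: Rsum_sel)
        then show ?thesis using True Q by (auto simp: f'_def mat_map_def dsum_inj_def)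
      next
        case False
        then show ?thesis using Q(4) by (auto simp: mat_map_def dsum_inj_def r_def)
      qed
    qed
    then have "a = mat_map Ps Ps G (dsum_inj Ps Rm n r)" using auto(2)[OF a(1)] by simp
    then show "l \<in> h ` carrier (Rm n)" using r a by (auto simp: h_def)
  next
    fix l assume "l \<in> h ` carrier (Rm n)"
    then obtain r where r: "r \<in> carrier (Rm n)" "l = h r" by blast
    let ?a = "mat_map Ps Ps G (dsum_inj Ps Rm n r)"
    have a: "?a \<in> carrier ?A" by (rule rmod_homD(1)[OF GA inj_mem[OF n r(1)]])
    have "mat_map Ps Ps F ?a = dsum_inj Ps Rm n r" by (rule auto(1)[OF inj_mem[OF n r(1)]])
    moreover have "f' ?a i = mat_map Ps Ps F ?a i" if "i \<in> Q" for i
      using that Q(1) by (auto simp: f'_def mat_map_def)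
    ultimately have "f' ?a i = (\<lambda>_. 0)" if "i \<in> Q" for i
      using that Q by (auto simp: dsum_inj_def)
    then have "f' ?a = \<zero>\<^bsub>?B\<^esub>"
      by (auto simp: f'_def mat_map_def Rsum_sel fun_eq_iff)
    then show "l \<in> \<iota> ` {a \<in> carrier ?A. f' a = \<zero>\<^bsub>?B\<^esub>}" using a r by (auto simp: h_def)
  qed
  ultimately show ?thesis using h iso by auto
qed

end

theorem theorem12:
  fixes p n :: nat
    and m :: int
    and \<iota> :: "(nat \<Rightarrow> nat \<Rightarrow> int) \<Rightarrow> (gen word set \<Rightarrow> int)"
    and K :: "(gen word set \<Rightarrow> int, 'k) rmodule"
    and \<alpha> :: "(nat \<Rightarrow> nat \<Rightarrow> int) \<Rightarrow> 'k"
    and \<beta> :: "'k \<Rightarrow> int \<Rightarrow> int"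
    and \<kappa> :: "nat \<Rightarrow> int"
  assumes "prime p" and "odd p"
    and "ord p (nat (m mod int p)) = p - 1"
    and "1 \<le> n" and "n \<le> p - 1"
    and "is_Psi p m \<iota>"
    and "right_module (Lam p m) K"
    and "short_exact (Lam p m) (Rsum p m ({1..p - 1} - {n})) \<alpha> K \<beta> (ZC_rmod p)"
    and "is_k_invariants p m n \<iota> \<alpha> K \<beta> \<kappa>"
    and "\<forall>i \<in> {1..p - 1} - {n}. \<kappa> i \<noteq> 0"
  shows "\<exists>h \<in> rmod_hom (Lam p m) (Rmod p m n) (regular_rmod (Lam p m)).
           inj_on h (carrier (Rmod p m n)) \<and>
           rmod_isomorphic (Lam p m) K
             (quot_rmod (regular_rmod (Lam p m)) (h ` carrier (Rmod p m n)))"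
proof -
  interpret metacyclic p m by unfold_locales (use assms in auto)
  \<comment> \<open>The locale \<open>right_module\<close> includes the ring axioms for the scalars,
    so they come with the module \<open>K\<close>.\<close>
  have "ring (Lam p m)" using assms(7) by (simp add: right_module_def)
  from isomorphic_quotient_by_Rmod[OF this assms(6) _ assms(7-10)] assms(4,5) show ?thesis by simp
qed

end
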